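(* Let $n \geq 4$ and $l=\frac n2-1$. There exist constants $C>0$ and $t_0>1$, independent of $t,u_0,u_1$, such that if $(u_0,u_1)\in (L^{1,1}(\mathbf{R}^n)\cap Y^{l+1})\times (L^{1,1}(\mathbf{R}^n)\cap Y^{l})$ and $u$ is the solution of $u_{tt}+Lu+(I+L)^{-1}u_t=0$, $u(0,\cdot)=u_0$, $u_t(0,\cdot)=u_1$, then $$\|u(t,\cdot)-\mathcal{F}^{-1}_{\xi\to x}(\varphi(t,\xi))(\cdot)\|_{L^2(\mathbf{R}^n)}\le C I_{0,l}\, t^{-\frac{n+2}{4}}\qquad\text{for all } t\ge t_0,$$ where $\varphi(t,\xi):=\varphi_1(t,\xi)+\varphi_2(t,\xi)$ with $$\varphi_1(t,\xi):=e^{-t\log(1+|\xi|^2)(1+\log(1+|\xi|^2))}(P_0+P_1),$$ $$\varphi_2(t,\xi):=e^{-\frac{t}{2\log(1+|\xi|^2)}}\,\frac{\sin\big(\sqrt{\log(1+|\xi|^2)}\,t\big)}{\sqrt{\log(1+|\xi|^2)}}\,\hat u_1(\xi)+e^{-\frac{t}{2\log(1+|\xi|^2)}}\cos\big(\sqrt{\log(1+|\xi|^2)}\,t\big)\,\hat u_0(\xi).$$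
   Context: The Fourier transform is $\mathcal F(f)(\xi)=\hat f(\xi)=\int_{\mathbf{R}^n}e^{-ix\cdot\xi}f(x)\,dx$ (extended to $L^2(\mathbf{R}^n)$), with inverse $\mathcal{F}^{-1}_{\xi\to x}$. The operator $L$ on $L^2(\mathbf{R}^n)$ is the Fourier multiplier $\widehat{Lf}(\xi)=\log(1+|\xi|^2)\hat f(\xi)$ with its maximal domain. For $\delta\ge 0$, $Y^\delta=\{f\in L^2(\mathbf{R}^n):\int_{\mathbf{R}^n}(1+\log(1+|\xi|^2))^\delta|\hat f(\xi)|^2d\xi<\infty\}$, with norm $\|f\|_{Y^\delta}=\big(\int_{\mathbf{R}^n}(1+\log(1+|\xi|^2))^\delta|\hat f(\xi)|^2d\xi\big)^{1/2}$. $L^{1,1}(\mathbf{R}^n)=\{f\in L^1(\mathbf{R}^n):\|f\|_{1,1}:=\int_{\mathbf{R}^n}(1+|x|)|f(x)|dx<\infty\}$. Cauchy problem: $u_{tt}+Lu+(I+L)^{-1}u_t=0$ on $(0,\infty)\times\mathbf{R}^n$, $u(0,\cdot)=u_0$, $u_t(0,\cdot)=u_1$. For $(u_0,u_1)\in Y^2\times Y^1$ the solution is the unique weak solution $u\in C([0,\infty),Y^2)\cap C^1([0,\infty),Y^1)\cap C^2([0,\infty),L^2(\mathbf{R}^n))$; for a.e. $\xi$, $\hat u(t,\xi)$ solves $\hat u_{tt}+\log(1+|\xi|^2)\hat u+(1+\log(1+|\xi|^2))^{-1}\hat u_t=0$ with $\hat u(0,\xi)=\hat u_0(\xi)$, $\hat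 u_t(0,\xi)=\hat u_1(\xi)$. Notation: $I_{0,l}:=\sqrt{\|u_0\|_{1,1}^2+\|u_1\|_{1,1}^2+\|u_0\|_{Y^{l+1}}^2+\|u_1\|_{Y^l}^2}$ and $P_j:=\int_{\mathbf{R}^n}u_j(x)\,dx$ ($j=0,1$). *)

theory Defs
  imports "HOL-Analysis.Analysis"
begin

text \<open>
  Elements of $L^2$ are represented by Borel functions; equality of such elements is equality
  almost everywhere.  Since the Bochner integral of a non-integrable function is 0, the norms
  below are meaningful only together with membership in the corresponding space.
\<close>

definition L2 :: "(real^'n \<Rightarrow> complex) set" where
  "L2 = {f. f \<in> borel_measurable lborel \<and> integrable lborel (\<lambda>x. (cmod (f x))\<^sup>2)}"

definition L2_norm :: "(real^'n \<Rightarrow> complex) \<Rightarrow> real" where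
  "L2_norm f = sqrt (\<integral>x. (cmod (f x))\<^sup>2 \<partial>lborel)"

definition L11 :: "(real^'n \<Rightarrow> complex) set" where
  "L11 = {f. integrable lborel f \<and> integrable lborel (\<lambda>x. (1 + norm x) * cmod (f x))}"

definition L11_norm :: "(real^'n \<Rightarrow> complex) \<Rightarrow> real" where
  "L11_norm f = (\<integral>x. (1 + norm x) * cmod (f x) \<partial>lborel)"

definition fourier_integral :: "(real^'n \<Rightarrow> complex) \<Rightarrow> real^'n \<Rightarrow> complex" where
  "fourier_integral f \<xi> =
     (\<integral>x. exp (- (\<i> * complex_of_real (x \<bullet> \<xi>))) * f x \<partial>lborel)"

text \<open>\<open>g\<close> is the value at \<open>f\<close> of the continuous extension of the Fourier integral from
  $L^1 \cap L^2$ to $L^2$.\<close>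

definition fourier_extension :: "(real^'n \<Rightarrow> complex) \<Rightarrow> (real^'n \<Rightarrow> complex) \<Rightarrow> bool" where
  "fourier_extension f g \<longleftrightarrow> f \<in> L2 \<and> g \<in> L2 \<and>
     (\<exists>s :: nat \<Rightarrow> real^'n \<Rightarrow> complex.
        (\<forall>k. s k \<in> L2 \<and> integrable lborel (s k) \<and> fourier_integral (s k) \<in> L2) \<and>
        (\<lambda>k. L2_norm (\<lambda>x. s k x - f x)) \<longlonglongrightarrow> 0 \<and>
        (\<lambda>k. L2_norm (\<lambda>\<xi>. fourier_integral (s k) \<xi> - g \<xi>)) \<longlonglongrightarrow> 0)"

definition fourier :: "(real^'n \<Rightarrow> complex) \<Rightarrow> real^'n \<Rightarrow> complex" where
  "fourier f = (if integrable lborel f then fourier_integral f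
                else (SOME g. fourier_extension f g))"

text \<open>The inverse of the Fourier transform as an operator on $L^2$.\<close>

definition inv_fourier :: "(real^'n \<Rightarrow> complex) \<Rightarrow> real^'n \<Rightarrow> complex" where
  "inv_fourier g = (SOME f. f \<in> L2 \<and> (AE \<xi> in lborel. fourier f \<xi> = g \<xi>))"

definition log_symbol :: "real^'n \<Rightarrow> real" where
  "log_symbol \<xi> = ln (1 + (norm \<xi>)\<^sup>2)"

definition dom_L :: "(real^'n \<Rightarrow> complex) set" where
  "dom_L = {f \<in> L2. (\<lambda>\<xi>. complex_of_real (log_symbol \<xi>) * fourier f \<xi>) \<in> L2}"

definition op_L :: "(real^'n \<Rightarrow> complex) \<Rightarrow> real^'n \<Rightarrow> complex" where
  "op_L f = inv_fourier (\<lambda>\<xi>. complex_of_real (log_symbol \<xi>) * fourier f \<xi>)"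

text \<open>The operator $(I+L)^{-1}$ on $L^2$.\<close>

definition inv_I_plus_L :: "(real^'n \<Rightarrow> complex) \<Rightarrow> real^'n \<Rightarrow> complex" where
  "inv_I_plus_L f = (SOME g. g \<in> dom_L \<and> (AE x in lborel. g x + op_L g x = f x))"

definition Y :: "real \<Rightarrow> (real^'n \<Rightarrow> complex) set" where
  "Y \<delta> = {f \<in> L2. integrable lborel
            (\<lambda>\<xi>. (1 + log_symbol \<xi>) powr \<delta> * (cmod (fourier f \<xi>))\<^sup>2)}"

definition Y_norm :: "real \<Rightarrow> (real^'n \<Rightarrow> complex) \<Rightarrow> real" where
  "Y_norm \<delta> f =
     sqrt (\<integral>\<xi>. (1 + log_symbol \<xi>) powr \<delta> * (cmod (fourier f \<xi>))\<^sup>2 \<partial>lborel)"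

text \<open>Membership in $C([0,\infty),X)$ and $C^1([0,\infty),X)$ for the space \<open>S\<close> with norm \<open>N\<close>;
  in the latter case \<open>v\<close> is the derivative of \<open>u\<close> in $X$ (one-sided at time 0).\<close>

definition C0_into ::
  "(real^'n \<Rightarrow> complex) set \<Rightarrow> ((real^'n \<Rightarrow> complex) \<Rightarrow> real) \<Rightarrow>
   (real \<Rightarrow> real^'n \<Rightarrow> complex) \<Rightarrow> bool" where
  "C0_into S N u \<longleftrightarrow> (\<forall>t\<ge>0. u t \<in> S) \<and>
     (\<forall>t\<ge>0. ((\<lambda>s. N (\<lambda>x. u s x - u t x)) \<longlongrightarrow> 0) (at t within {0..}))"

definition C1_into ::
  "(real^'n \<Rightarrow> complex) set \<Rightarrow> ((real^'n \<Rightarrow> complex) \<Rightarrow> real) \<Rightarrow>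
   (real \<Rightarrow> real^'n \<Rightarrow> complex) \<Rightarrow> (real \<Rightarrow> real^'n \<Rightarrow> complex) \<Rightarrow> bool" where
  "C1_into S N u v \<longleftrightarrow> C0_into S N u \<and> C0_into S N v \<and>
     (\<forall>t\<ge>0. ((\<lambda>s. N (\<lambda>x. (u s x - u t x) / complex_of_real (s - t) - v t x)) \<longlongrightarrow> 0)
               (at t within {0..}))"

text \<open>For $u$ in the solution class every term of the equation lies in $L^2$ for each time, so
  the equation is required to hold in $L^2$; \<open>v\<close> and \<open>w\<close> are $u_t$ and $u_{tt}$.\<close>

definition is_solution ::
  "(real^'n \<Rightarrow> complex) \<Rightarrow> (real^'n \<Rightarrow> complex) \<Rightarrow> (real \<Rightarrow> real^'n \<Rightarrow> complex) \<Rightarrow> bool" where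
  "is_solution u0 u1 u \<longleftrightarrow> (\<exists>v w.
     C0_into (Y 2) (Y_norm 2) u \<and>
     C1_into (Y 1) (Y_norm 1) u v \<and>
     C1_into L2 L2_norm u v \<and> C1_into L2 L2_norm v w \<and>
     (\<forall>t>0. AE x in lborel. w t x + op_L (u t) x + inv_I_plus_L (v t) x = 0) \<and>
     (AE x in lborel. u 0 x = u0 x) \<and>
     (AE x in lborel. v 0 x = u1 x))"

definition I0 :: "real \<Rightarrow> (real^'n \<Rightarrow> complex) \<Rightarrow> (real^'n \<Rightarrow> complex) \<Rightarrow> real" where
  "I0 l u0 u1 = sqrt ((L11_norm u0)\<^sup>2 + (L11_norm u1)\<^sup>2
                      + (Y_norm (l + 1) u0)\<^sup>2 + (Y_norm l u1)\<^sup>2)"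

definition P :: "(real^'n \<Rightarrow> complex) \<Rightarrow> complex" where
  "P f = (\<integral>x. f x \<partial>lborel)"

definition phi1 ::
  "(real^'n \<Rightarrow> complex) \<Rightarrow> (real^'n \<Rightarrow> complex) \<Rightarrow> real \<Rightarrow> real^'n \<Rightarrow> complex" where
  "phi1 u0 u1 t \<xi> =
     complex_of_real (exp (- t * log_symbol \<xi> * (1 + log_symbol \<xi>))) * (P u0 + P u1)"

text \<open>At $\xi = 0$, a null set, the divisions below are by 0.\<close>

definition phi2 ::
  "(real^'n \<Rightarrow> complex) \<Rightarrow> (real^'n \<Rightarrow> complex) \<Rightarrow> real \<Rightarrow> real^'n \<Rightarrow> complex" where
  "phi2 u0 u1 t \<xi> =
     complex_of_real (exp (- t / (2 * log_symbol \<xi>)) *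
       (sin (sqrt (log_symbol \<xi>) * t) / sqrt (log_symbol \<xi>))) * fourier u1 \<xi> +
     complex_of_real (exp (- t / (2 * log_symbol \<xi>)) *
       cos (sqrt (log_symbol \<xi>) * t)) * fourier u0 \<xi>"

definition phi ::
  "(real^'n \<Rightarrow> complex) \<Rightarrow> (real^'n \<Rightarrow> complex) \<Rightarrow> real \<Rightarrow> real^'n \<Rightarrow> complex" where
  "phi u0 u1 t \<xi> = phi1 u0 u1 t \<xi> + phi2 u0 u1 t \<xi>"

end

theory Submission
  imports Defs "HOL-Probability.Characteristic_Functions" "HOL-Probability.Sinc_Integral"
begin

text \<open>
  Write $\mu = \log(1+|\xi|^2)$ and $r_\pm$ for the roots of $z^2 + z/(1+\mu) + \mu$.  For a
  solution $u$, the combination $\hat u_t - r_\mp \hat u$ solves the scalar equation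
  $q' = r_\pm q$; testing against indicators of bounded sets turns this $L^2$-valued equation into
  an explicit formula for $\hat u$.  For small $\mu$ the roots are real, $r_+$ is
  $-\mu(1+\mu)$ up to $O(\mu^2)$ and $r_- \le -3/4$, which gives $\varphi_1$ with an error of
  order $|\xi| e^{-t|\xi|^2/4}$.  For larger $\mu$ the difference to $\varphi_2$ is governed by
  $x = t/(1+\mu)$: it is at most a constant times $e^{-x/16}(1+x)$ times
  $(1+\mu)^{-1/2}|\hat u_0| + (1+\mu)^{-1}|\hat u_1|$, and bounded powers of $x$ trade the
  regularity of the data for decay in $t$.

  Plancherel's theorem is obtained from the Gaussian-regularised integrals of $|\hat f|^2$.  They
  show that $(2\pi)^n \|f\|^2 - \|\hat f\|^2$ is nonnegative, and that it vanishes on indicators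
  of open sets, hence everywhere by the parallelogram law and outer regularity.
\<close>

section \<open>Square-integrable functions\<close>

text \<open>A solution is differentiable only as a curve in L2, so no single frequency carries a
  differential equation from the outset. Moreover \<open>fourier\<close>, \<open>inv_fourier\<close>
  and \<open>inv_I_plus_L\<close> involve choices, whose values are determined up to null sets only
  through Plancherel's theorem and surjectivity. The frequency thresholds come from the
  discriminant: for \<mu> < 1/16 the roots are real and at least 3/4 apart, for \<mu> \<ge> 1 they
  are complex conjugates, and the double root lies in between. In that middle band nothing is
  compared: the solution and \<open>phi2\<close> are each exponentially small. The value l = n/2 - 1
  balances the zones. The square of |\<xi>| exp(-t |\<xi>|^2 / 4) integrates to a multiple of
  t^(-n/2-1), and the weights (1 + \<mu>)^(l+1) and (1 + \<mu>)^l on the squared data buy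
  t^(-(l+2)), which is the same power. The time threshold is n, because exp(-t \<mu>) = (1 +
  |\<xi>|^2)^(-t) then has an integrable majorant independent of t.\<close>

lemma L2_measurable [measurable_dest]: "f \<in> L2 \<Longrightarrow> f \<in> borel_measurable lborel"
  by (simp add: L2_def)

lemma L2_integrable: "f \<in> L2 \<Longrightarrow> integrable lborel (\<lambda>x. (cmod (f x))\<^sup>2)"
  by (simp add: L2_def)

lemma L2I: "f \<in> borel_measurable lborel \<Longrightarrow> integrable lborel (\<lambda>x. (cmod (f x))\<^sup>2) \<Longrightarrow> f \<in> L2"
  by (simp add: L2_def)

lemma L2_norm_nonneg [simp]: "0 \<le> L2_norm f"
  by (simp add: L2_norm_def)

lemma L2_norm_power2: "(L2_norm f)\<^sup>2 = (\<integral>x. (cmod (f x))\<^sup>2 \<partial>lborel)"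
  by (simp add: L2_norm_def)

lemma L2_bound:
  fixes f g :: "real^'n \<Rightarrow> complex"
  assumes "g \<in> L2" "f \<in> borel_measurable lborel" "\<And>x. cmod (f x) \<le> cmod (g x)"
  shows "f \<in> L2"
  using assms(2) by (intro L2I Bochner_Integration.integrable_bound[OF L2_integrable[OF assms(1)]])
    (auto intro!: AE_I2 power_mono assms(3))

lemma L2_scale:
  assumes "f \<in> L2" shows "(\<lambda>x. c * f x) \<in> L2"
proof -
  note [measurable] = L2_measurable[OF assms]
  show ?thesis
    using L2_integrable[OF assms] by (intro L2I) (auto simp: norm_mult power_mult_distrib)
qed

lemma norm_add_power2_le: "(norm (a + b))\<^sup>2 \<le> 2 * (norm a)\<^sup>2 + 2 * (norm b)\<^sup>2"
  for a b :: "'a::real_normed_vector"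
proof -
  have "(norm (a + b))\<^sup>2 \<le> (norm a + norm b)\<^sup>2"
    by (intro power_mono norm_triangle_ineq) auto
  also have "\<dots> \<le> 2 * (norm a)\<^sup>2 + 2 * (norm b)\<^sup>2"
    using sum_squares_bound[of "norm a" "norm b"] by (simp add: power2_sum)
  finally show ?thesis .
qed

lemma L2_add:
  assumes "f \<in> L2" "g \<in> L2" shows "(\<lambda>x. f x + g x) \<in> L2"
proof -
  note [measurable] = L2_measurable[OF assms(1)] L2_measurable[OF assms(2)]
  have "integrable lborel (\<lambda>x. 2 * (cmod (f x))\<^sup>2 + 2 * (cmod (g x))\<^sup>2)"
    using assms[THEN L2_integrable] by auto
  then have "integrable lborel (\<lambda>x. (cmod (f x + g x))\<^sup>2)"
    by (rule Bochner_Integration.integrable_bound) (auto intro!: AE_I2 norm_add_power2_le)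
  then show ?thesis by (intro L2I) auto
qed

lemma L2_diff:
  assumes "f \<in> L2" "g \<in> L2" shows "(\<lambda>x. f x - g x) \<in> L2"
  using L2_add[OF assms(1) L2_scale[OF assms(2), of "-1"]] by simp

lemma borel_measurable_cnj [measurable]: "cnj \<in> borel_measurable borel"
  by (intro borel_measurable_continuous_onI continuous_intros)

lemma L2_cnj: "f \<in> L2 \<Longrightarrow> (\<lambda>x. cnj (f x)) \<in> L2"
  by (rule L2_bound[of f]) (auto dest!: L2_measurable intro: measurable_compose[OF _ borel_measurable_cnj])

lemma L2_zero [simp]: "(\<lambda>x. 0) \<in> L2"
  by (simp add: L2_def)

lemma L2_norm_cnj [simp]: "L2_norm (\<lambda>x. cnj (f x)) = L2_norm f"
  by (simp add: L2_norm_def)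

lemma L2_norm_scale: "L2_norm (\<lambda>x. c * f x) = cmod c * L2_norm f"
  by (simp add: L2_norm_def norm_mult power_mult_distrib real_sqrt_mult)

lemma L2_norm_minus_commute: "L2_norm (\<lambda>x. f x - g x) = L2_norm (\<lambda>x. g x - f x)"
  by (simp add: L2_norm_def norm_minus_commute)

lemma L2_mult_bounded:
  fixes f :: "real^'n \<Rightarrow> complex"
  assumes "f \<in> L2" "g \<in> borel_measurable lborel" "\<And>x. cmod (g x) \<le> B"
  shows "(\<lambda>x. g x * f x) \<in> L2"
proof (rule L2_bound[OF L2_scale[OF assms(1), of B]])
  show "(\<lambda>x. g x * f x) \<in> borel_measurable lborel"
    using assms(1,2) by (auto dest: L2_measurable)
  show "cmod (g x * f x) \<le> cmod (of_real B * f x)" for x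
    using assms(3)[of x] by (auto simp: norm_mult intro!: mult_right_mono order_trans[OF assms(3)])
qed

lemma L2_norm_cong_AE:
  assumes "f \<in> borel_measurable lborel" "g \<in> borel_measurable lborel" "AE x in lborel. f x = g x"
  shows "L2_norm f = L2_norm g"
  unfolding L2_norm_def using assms by (intro arg_cong[where f=sqrt] integral_cong_AE) auto

lemma L2_cong_AE:
  assumes "f \<in> L2" "g \<in> borel_measurable lborel" "AE x in lborel. f x = g x"
  shows "g \<in> L2"
proof (rule L2I[OF assms(2)])
  have "integrable lborel (\<lambda>x. (cmod (f x))\<^sup>2) \<longleftrightarrow> integrable lborel (\<lambda>x. (cmod (g x))\<^sup>2)"
    using assms L2_measurable[OF assms(1)] by (intro integrable_cong_AE) auto
  then show "integrable lborel (\<lambda>x. (cmod (g x))\<^sup>2)"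
    using L2_integrable[OF assms(1)] by blast
qed

lemma L2_norm_eq_0_iff:
  assumes "f \<in> L2" shows "L2_norm f = 0 \<longleftrightarrow> (AE x in lborel. f x = 0)"
proof -
  have "L2_norm f = 0 \<longleftrightarrow> (\<integral>x. (cmod (f x))\<^sup>2 \<partial>lborel) = 0"
    by (simp add: L2_norm_def)
  also have "\<dots> \<longleftrightarrow> (AE x in lborel. (cmod (f x))\<^sup>2 = 0)"
    by (rule integral_nonneg_eq_0_iff_AE) (use L2_integrable[OF assms] in auto)
  finally show ?thesis by simp
qed

lemma nn_integral_L2:
  assumes "f \<in> L2"
  shows "(\<integral>\<^sup>+x. (cmod (f x))\<^sup>2 \<partial>lborel) = ennreal ((L2_norm f)\<^sup>2)"
  unfolding L2_norm_power2 by (rule nn_integral_eq_integral) (use L2_integrable[OF assms] in auto)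

lemma L2I_nn_integral:
  assumes "f \<in> borel_measurable lborel" "(\<integral>\<^sup>+x. (cmod (f x))\<^sup>2 \<partial>lborel) \<le> ennreal C" "0 \<le> C"
  shows "f \<in> L2" "(L2_norm f)\<^sup>2 \<le> C"
proof -
  note [measurable] = assms(1)
  have "integrable lborel (\<lambda>x. (cmod (f x))\<^sup>2)"
    using assms(2) by (intro integrableI_bounded) (auto intro: le_less_trans)
  then show *: "f \<in> L2" by (intro L2I) auto
  show "(L2_norm f)\<^sup>2 \<le> C"
    using assms(2,3) nn_integral_L2[OF *] by simp
qed

lemma integrable_L2_mult:
  assumes "f \<in> L2" "g \<in> L2" shows "integrable lborel (\<lambda>x. f x * g x)"
proof -
  note [measurable] = L2_measurable[OF assms(1)] L2_measurable[OF assms(2)]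
  have "integrable lborel (\<lambda>x. (cmod (f x))\<^sup>2 + (cmod (g x))\<^sup>2)"
    using assms[THEN L2_integrable] by auto
  then show ?thesis
  proof (rule Bochner_Integration.integrable_bound)
    show "AE x in lborel. norm (f x * g x) \<le> norm ((cmod (f x))\<^sup>2 + (cmod (g x))\<^sup>2)"
    proof (rule AE_I2)
      fix x
      have "2 * (cmod (f x) * cmod (g x)) \<le> (cmod (f x))\<^sup>2 + (cmod (g x))\<^sup>2"
        using sum_squares_bound[of "cmod (f x)" "cmod (g x)"] by (simp add: mult.assoc)
      moreover have "0 \<le> cmod (f x) * cmod (g x)" by simp
      ultimately show "norm (f x * g x) \<le> norm ((cmod (f x))\<^sup>2 + (cmod (g x))\<^sup>2)"
        unfolding norm_mult real_norm_def by linarith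
    qed
  qed auto
qed

lemma L2_Cauchy_Schwarz:
  assumes "f \<in> L2" "g \<in> L2"
  shows "(\<integral>x. cmod (f x) * cmod (g x) \<partial>lborel) \<le> L2_norm f * L2_norm g"
    and "cmod (\<integral>x. f x * g x \<partial>lborel) \<le> L2_norm f * L2_norm g"
proof -
  note [measurable] = L2_measurable[OF assms(1)] L2_measurable[OF assms(2)]
  have int: "integrable lborel (\<lambda>x. cmod (f x) * cmod (g x))"
    using integrable_norm[OF integrable_L2_mult[OF assms]] by (simp add: norm_mult)
  have "(\<integral>\<^sup>+x. ennreal (cmod (f x)) * ennreal (cmod (g x)) \<partial>lborel)\<^sup>2
     \<le> (\<integral>\<^sup>+x. ennreal (cmod (f x)) ^ 2 \<partial>lborel) * (\<integral>\<^sup>+x. ennreal (cmod (g x)) ^ 2 \<partial>lborel)"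
    by (rule Cauchy_Schwarz_nn_integral) auto
  also have "\<dots> = ennreal ((L2_norm f * L2_norm g)\<^sup>2)"
    using nn_integral_L2[OF assms(1)] nn_integral_L2[OF assms(2)]
    by (simp add: ennreal_power power_mult_distrib ennreal_mult)
  also have "(\<integral>\<^sup>+x. ennreal (cmod (f x)) * ennreal (cmod (g x)) \<partial>lborel)
     = ennreal (\<integral>x. cmod (f x) * cmod (g x) \<partial>lborel)"
    using nn_integral_eq_integral[OF int] by (simp add: ennreal_mult)
  finally have "(\<integral>x. cmod (f x) * cmod (g x) \<partial>lborel)\<^sup>2 \<le> (L2_norm f * L2_norm g)\<^sup>2"
    by (simp add: ennreal_power)
  then show *: "(\<integral>x. cmod (f x) * cmod (g x) \<partial>lborel) \<le> L2_norm f * L2_norm g"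
    by (rule power2_le_imp_le) simp
  have "cmod (\<integral>x. f x * g x \<partial>lborel) \<le> (\<integral>x. cmod (f x * g x) \<partial>lborel)"
    by (rule integral_norm_bound)
  then show "cmod (\<integral>x. f x * g x \<partial>lborel) \<le> L2_norm f * L2_norm g"
    using * by (simp add: norm_mult)
qed

lemma L2_norm_triangle:
  assumes "f \<in> L2" "g \<in> L2"
  shows "L2_norm (\<lambda>x. f x + g x) \<le> L2_norm f + L2_norm g"
proof (rule power2_le_imp_le)
  have int: "integrable lborel (\<lambda>x. cmod (f x) * cmod (g x))"
    using integrable_norm[OF integrable_L2_mult[OF assms]] by (simp add: norm_mult)
  have "(L2_norm (\<lambda>x. f x + g x))\<^sup>2
      \<le> (\<integral>x. (cmod (f x))\<^sup>2 + (cmod (g x))\<^sup>2 + 2 * (cmod (f x) * cmod (g x)) \<partial>lborel)"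
    unfolding L2_norm_power2
  proof (rule integral_mono)
    fix x
    have "(cmod (f x + g x))\<^sup>2 \<le> (cmod (f x) + cmod (g x))\<^sup>2"
      by (intro power_mono norm_triangle_ineq) auto
    then show "(cmod (f x + g x))\<^sup>2
        \<le> (cmod (f x))\<^sup>2 + (cmod (g x))\<^sup>2 + 2 * (cmod (f x) * cmod (g x))"
      by (simp add: power2_sum)
  qed (use assms[THEN L2_integrable] int L2_integrable[OF L2_add[OF assms]] in auto)
  also have "\<dots> = (L2_norm f)\<^sup>2 + (L2_norm g)\<^sup>2 + 2 * (\<integral>x. cmod (f x) * cmod (g x) \<partial>lborel)"
    unfolding L2_norm_power2 using assms[THEN L2_integrable] int by simp
  also have "\<dots> \<le> (L2_norm f + L2_norm g)\<^sup>2"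
    using L2_Cauchy_Schwarz(1)[OF assms] by (simp add: power2_sum)
  finally show "(L2_norm (\<lambda>x. f x + g x))\<^sup>2 \<le> (L2_norm f + L2_norm g)\<^sup>2" .
qed simp

lemma L2_norm_triangle_diff:
  assumes "f \<in> L2" "g \<in> L2"
  shows "\<bar>L2_norm f - L2_norm g\<bar> \<le> L2_norm (\<lambda>x. f x - g x)"
proof -
  have "L2_norm f \<le> L2_norm (\<lambda>x. f x - g x) + L2_norm g"
    using L2_norm_triangle[OF L2_diff[OF assms] assms(2)] by simp
  moreover have "L2_norm g \<le> L2_norm (\<lambda>x. f x - g x) + L2_norm f"
    using L2_norm_triangle[OF L2_diff[OF assms(2,1)] assms(1)] by (simp add: L2_norm_minus_commute[of f])
  ultimately show ?thesis by simp
qed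

lemma L2_norm_diff_triangle:
  assumes "f \<in> L2" "g \<in> L2" "h \<in> L2"
  shows "L2_norm (\<lambda>x. f x - h x) \<le> L2_norm (\<lambda>x. f x - g x) + L2_norm (\<lambda>x. g x - h x)"
  using L2_norm_triangle[OF L2_diff[OF assms(1,2)] L2_diff[OF assms(2,3)]] by simp

lemma L2_norm_mult_bounded:
  fixes f :: "real^'n \<Rightarrow> complex"
  assumes "f \<in> L2" "g \<in> borel_measurable lborel" "\<And>x. cmod (g x) \<le> B"
  shows "L2_norm (\<lambda>x. g x * f x) \<le> B * L2_norm f"
proof (rule power2_le_imp_le)
  have B: "0 \<le> B" using assms(3)[of undefined] norm_ge_zero order_trans by blast
  have "(L2_norm (\<lambda>x. g x * f x))\<^sup>2 \<le> (\<integral>x. B\<^sup>2 * (cmod (f x))\<^sup>2 \<partial>lborel)"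
    unfolding L2_norm_power2
    by (intro integral_mono L2_integrable L2_mult_bounded[OF assms])
       (use assms L2_integrable[OF assms(1)] in
         \<open>auto simp: norm_mult power_mult_distrib intro!: mult_right_mono power_mono\<close>)
  then show "(L2_norm (\<lambda>x. g x * f x))\<^sup>2 \<le> (B * L2_norm f)\<^sup>2"
    by (simp add: L2_norm_power2 power_mult_distrib)
  show "0 \<le> B * L2_norm f" using B by simp
qed

lemma L2_norm_tendsto:
  assumes "\<And>k. s k \<in> L2" "f \<in> L2" "(\<lambda>k. L2_norm (\<lambda>x. s k x - f x)) \<longlonglongrightarrow> 0"
  shows "(\<lambda>k. L2_norm (s k)) \<longlonglongrightarrow> L2_norm f"
proof (rule LIM_zero_cancel, rule tendsto_norm_zero_cancel)
  show "(\<lambda>k. norm (L2_norm (s k) - L2_norm f)) \<longlonglongrightarrow> 0"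
    by (rule tendsto_sandwich[OF _ _ tendsto_const assms(3)])
       (auto intro!: always_eventually L2_norm_triangle_diff assms)
qed

text \<open>The pairing is bilinear, without conjugation: this is the form in which the
  multiplication formula passes to limits and in which the modes of the solution are differentiated
  in time.\<close>

lemma L2_pairing_tendsto:
  assumes s: "\<And>k. s k \<in> L2" "f \<in> L2" "(\<lambda>k. L2_norm (\<lambda>x. s k x - f x)) \<longlonglongrightarrow> 0"
    and r: "\<And>k. r k \<in> L2" "g \<in> L2" "(\<lambda>k. L2_norm (\<lambda>x. r k x - g x)) \<longlonglongrightarrow> 0"
  shows "(\<lambda>k. \<integral>x. s k x * r k x \<partial>lborel) \<longlonglongrightarrow> (\<integral>x. f x * g x \<partial>lborel)"
proof (rule LIM_zero_cancel, rule tendsto_norm_zero_cancel)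
  let ?b = "\<lambda>k. L2_norm (\<lambda>x. s k x - f x) * L2_norm (r k) + L2_norm f * L2_norm (\<lambda>x. r k x - g x)"
  have "?b \<longlonglongrightarrow> 0 * L2_norm g + L2_norm f * 0"
    by (intro tendsto_intros s r L2_norm_tendsto[OF r])
  then have b: "?b \<longlonglongrightarrow> 0" by simp
  have "norm ((\<integral>x. s k x * r k x \<partial>lborel) - (\<integral>x. f x * g x \<partial>lborel)) \<le> ?b k" for k
  proof -
    have "(\<integral>x. s k x * r k x \<partial>lborel) - (\<integral>x. f x * g x \<partial>lborel)
      = (\<integral>x. s k x * r k x - f x * g x \<partial>lborel)"
      by (rule Bochner_Integration.integral_diff[symmetric]) (intro integrable_L2_mult s r)+
    also have "\<dots> = (\<integral>x. (s k x - f x) * r k x + f x * (r k x - g x) \<partial>lborel)"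
      by (simp add: algebra_simps)
    also have "\<dots> = (\<integral>x. (s k x - f x) * r k x \<partial>lborel) + (\<integral>x. f x * (r k x - g x) \<partial>lborel)"
      by (rule Bochner_Integration.integral_add) (intro integrable_L2_mult L2_diff s r)+
    finally show ?thesis
      using norm_triangle_ineq[of "\<integral>x. (s k x - f x) * r k x \<partial>lborel" "\<integral>x. f x * (r k x - g x) \<partial>lborel"]
        L2_Cauchy_Schwarz(2)[OF L2_diff[OF s(1)[of k] s(2)] r(1)[of k]]
        L2_Cauchy_Schwarz(2)[OF s(2) L2_diff[OF r(1)[of k] r(2)]] by simp
  qed
  then show "(\<lambda>k. norm ((\<integral>x. s k x * r k x \<partial>lborel) - (\<integral>x. f x * g x \<partial>lborel))) \<longlonglongrightarrow> 0"
    by (intro tendsto_sandwich[OF _ _ tendsto_const b]) (auto intro!: always_eventually)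
qed

lemma L2_indicator_mult:
  assumes "f \<in> L2" "A \<in> sets lborel" shows "(\<lambda>x. indicator A x * f x) \<in> L2"
  using assms by (intro L2_mult_bounded[where B=1]) (auto simp: indicator_def)

lemma L2_indicator:
  assumes "A \<in> sets lborel" "emeasure lborel A < \<infinity>"
  shows "(\<lambda>x. indicator A x :: complex) \<in> L2"
    and "(L2_norm (\<lambda>x. indicator A x :: complex))\<^sup>2 = measure lborel A"
proof -
  have eq: "(\<lambda>x. (cmod (indicator A x))\<^sup>2) = (\<lambda>x. indicator A x :: real)"
    by (auto simp: indicator_def fun_eq_iff)
  show "(\<lambda>x. indicator A x :: complex) \<in> L2"
    using assms by (intro L2I) (auto simp: eq)
  show "(L2_norm (\<lambda>x. indicator A x :: complex))\<^sup>2 = measure lborel A"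
    using assms by (simp add: L2_norm_power2 eq)
qed

section \<open>Completeness of L2 along geometrically fast Cauchy sequences\<close>

lemma summable_geometric_of_bounded:
  assumes "\<And>k::nat. 2 ^ k * (norm (d k))\<^sup>2 \<le> M"
  shows "summable (\<lambda>k. d k :: 'a::banach)"
proof (rule summable_comparison_test)
  have M: "0 \<le> M" using assms[of 0] by (rule order_trans[rotated]) simp
  let ?q = "1 / sqrt 2"
  show "\<exists>N. \<forall>k\<ge>N. norm (d k) \<le> sqrt M * ?q ^ k"
  proof (intro exI allI impI)
    fix k
    have "(norm (d k))\<^sup>2 \<le> M / 2 ^ k" using assms[of k] by (simp add: field_simps)
    then have "norm (d k) \<le> sqrt (M / 2 ^ k)" by (rule real_le_rsqrt)
    also have "\<dots> = sqrt M * ?q ^ k"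
      by (simp add: real_sqrt_divide real_sqrt_power power_divide)
    finally show "norm (d k) \<le> sqrt M * ?q ^ k" .
  qed
  show "summable (\<lambda>k. sqrt M * ?q ^ k)"
    by (intro summable_mult summable_geometric) auto
qed

text \<open>Riesz-Fischer for sequences that are Cauchy at the rate 2^(-k). The squared increments
  decay like 4^(-k), so even with the weight 2^k their sum has a finite integral. Almost everywhere
  the weighted squares are therefore bounded and the increments summable; Fatou's lemma turns the
  pointwise limit into a limit in norm.\<close>

lemma L2_complete:
  fixes s :: "nat \<Rightarrow> real^'n \<Rightarrow> complex"
  assumes s: "\<And>k. s k \<in> L2"
    and fast: "\<And>j k. k \<le> j \<Longrightarrow> (L2_norm (\<lambda>x. s j x - s k x))\<^sup>2 \<le> C / 4 ^ k" and C: "0 \<le> C"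
  obtains g where "g \<in> L2" "(\<lambda>k. L2_norm (\<lambda>x. s k x - g x)) \<longlonglongrightarrow> 0"
    "AE x in lborel. (\<lambda>k. s k x) \<longlonglongrightarrow> g x"
proof -
  note [measurable] = L2_measurable[OF s]
  define d where "d k x = s (Suc k) x - s k x" for k x
  have d: "d k \<in> L2" for k unfolding d_def by (intro L2_diff s)
  note [measurable] = L2_measurable[OF d]
  have "(\<integral>\<^sup>+x. (\<Sum>k. ennreal (2 ^ k * (cmod (d k x))\<^sup>2)) \<partial>lborel)
      = (\<Sum>k. \<integral>\<^sup>+x. ennreal (2 ^ k * (cmod (d k x))\<^sup>2) \<partial>lborel)"
    by (rule nn_integral_suminf) auto
  also have "\<dots> \<le> (\<Sum>k. ennreal (C * (1/2) ^ k))"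
  proof (intro suminf_le)
    fix k
    have "(\<integral>\<^sup>+x. ennreal (2 ^ k * (cmod (d k x))\<^sup>2) \<partial>lborel) = ennreal (2 ^ k) * ennreal ((L2_norm (d k))\<^sup>2)"
      using nn_integral_L2[OF d, of k] by (simp add: ennreal_mult nn_integral_cmult)
    also have "\<dots> = ennreal (2 ^ k * (L2_norm (d k))\<^sup>2)" by (simp add: ennreal_mult)
    also have "\<dots> \<le> ennreal (2 ^ k * (C / 4 ^ k))"
      using fast[of k "Suc k"] unfolding d_def by (intro ennreal_leI mult_left_mono) auto
    also have "2 ^ k * (C / 4 ^ k) = C * (1/2) ^ k"
      by (simp add: power_divide field_simps flip: power_mult_distrib)
    finally show "(\<integral>\<^sup>+x. ennreal (2 ^ k * (cmod (d k x))\<^sup>2) \<partial>lborel) \<le> ennreal (C * (1/2) ^ k)" .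
  qed auto
  also have "\<dots> = ennreal (\<Sum>k. C * (1/2) ^ k)"
    using C by (intro suminf_ennreal2 summable_mult summable_geometric) auto
  also have "\<dots> < \<infinity>" by simp
  finally have "AE x in lborel. (\<Sum>k. ennreal (2 ^ k * (cmod (d k x))\<^sup>2)) \<noteq> \<infinity>"
    by (intro nn_integral_noteq_infinite) auto
  then have conv: "AE x in lborel. convergent (\<lambda>k. s k x)"
  proof eventually_elim
    fix x assume fin: "(\<Sum>k. ennreal (2 ^ k * (cmod (d k x))\<^sup>2)) \<noteq> \<infinity>"
    then obtain M where M: "(\<Sum>k. ennreal (2 ^ k * (cmod (d k x))\<^sup>2)) = ennreal M" "0 \<le> M"
      unfolding infinity_ennreal_def less_top less_top_ennreal by blast
    have "summable (\<lambda>k. d k x)"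
    proof (rule summable_geometric_of_bounded)
      fix k
      have "ennreal (2 ^ k * (cmod (d k x))\<^sup>2) \<le> ennreal M"
        using sum_le_suminf[of "\<lambda>k. ennreal (2 ^ k * (cmod (d k x))\<^sup>2)" "{k}"] M(1) by simp
      with M(2) show "2 ^ k * (cmod (d k x))\<^sup>2 \<le> M"
        by (simp only: ennreal_le_iff)
    qed
    then have "(\<lambda>n. \<Sum>k<n. d k x) \<longlonglongrightarrow> (\<Sum>k. d k x)" by (rule summable_LIMSEQ)
    then have "(\<lambda>n. s n x - s 0 x) \<longlonglongrightarrow> (\<Sum>k. d k x)"
      unfolding d_def by (simp add: sum_lessThan_telescope[of "\<lambda>n. s n x"])
    then have "(\<lambda>n. (s n x - s 0 x) + s 0 x) \<longlonglongrightarrow> (\<Sum>k. d k x) + s 0 x" by (intro tendsto_intros)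
    then show "convergent (\<lambda>k. s k x)" by (auto simp: convergent_def)
  qed
  \<comment> \<open>\<open>lim\<close> is a total function, so \<open>g\<close> is measurable on the
    whole space; on the null set of divergence its value does not matter.\<close>
  define g where "g x = lim (\<lambda>k. s k x)" for x
  have [measurable]: "g \<in> borel_measurable lborel"
    unfolding g_def by measurable
  have lim: "AE x in lborel. (\<lambda>k. s k x) \<longlonglongrightarrow> g x"
    using conv by eventually_elim (simp add: g_def convergent_LIMSEQ_iff)
  have bound: "(\<integral>\<^sup>+x. (cmod (g x - s k x))\<^sup>2 \<partial>lborel) \<le> ennreal (C / 4 ^ k)" for k
  proof -
    have "(\<integral>\<^sup>+x. (cmod (g x - s k x))\<^sup>2 \<partial>lborel)
        = (\<integral>\<^sup>+x. liminf (\<lambda>j. ennreal ((cmod (s j x - s k x))\<^sup>2)) \<partial>lborel)"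
    proof (rule nn_integral_cong_AE)
      show "AE x in lborel. ennreal ((cmod (g x - s k x))\<^sup>2) = liminf (\<lambda>j. ennreal ((cmod (s j x - s k x))\<^sup>2))"
        using lim
      proof eventually_elim
        fix x assume "(\<lambda>k. s k x) \<longlonglongrightarrow> g x"
        then have "(\<lambda>j. ennreal ((cmod (s j x - s k x))\<^sup>2)) \<longlonglongrightarrow> ennreal ((cmod (g x - s k x))\<^sup>2)"
          by (intro tendsto_intros tendsto_ennrealI)
        then show "ennreal ((cmod (g x - s k x))\<^sup>2) = liminf (\<lambda>j. ennreal ((cmod (s j x - s k x))\<^sup>2))"
          using lim_imp_Liminf[OF trivial_limit_sequentially] by metis
      qed
    qed
    also have "\<dots> \<le> liminf (\<lambda>j. \<integral>\<^sup>+x. ennreal ((cmod (s j x - s k x))\<^sup>2) \<partial>lborel)"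
      by (rule nn_integral_liminf) auto
    also have "\<dots> \<le> liminf (\<lambda>j. ennreal (C / 4 ^ k))"
    proof (rule Liminf_mono, rule eventually_sequentiallyI[of k])
      fix j assume "k \<le> j"
      then show "(\<integral>\<^sup>+x. ennreal ((cmod (s j x - s k x))\<^sup>2) \<partial>lborel) \<le> ennreal (C / 4 ^ k)"
        using fast[of k j] nn_integral_L2[OF L2_diff[OF s s], of j k] by (simp add: ennreal_leI)
    qed
    finally show ?thesis by (simp add: Liminf_const)
  qed
  have gs: "(\<lambda>x. g x - s k x) \<in> L2" "(L2_norm (\<lambda>x. g x - s k x))\<^sup>2 \<le> C / 4 ^ k" for k
    by (rule L2I_nn_integral[OF _ bound], use C in auto)+
  show thesis
  proof (rule that[OF _ _ lim])
    show "g \<in> L2" using L2_add[OF gs(1)[of 0] s[of 0]] by simp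
    have "(\<lambda>k. sqrt (C * (1/4) ^ k)) \<longlonglongrightarrow> sqrt (C * 0)"
      by (intro tendsto_intros LIMSEQ_realpow_zero) auto
    then have lim0: "(\<lambda>k. sqrt (C * (1/4) ^ k)) \<longlonglongrightarrow> 0" by simp
    have "L2_norm (\<lambda>x. s k x - g x) \<le> sqrt (C * (1/4) ^ k)" for k
      using gs(2)[of k] by (subst L2_norm_minus_commute, intro real_le_rsqrt)
        (simp add: power_divide)
    then show "(\<lambda>k. L2_norm (\<lambda>x. s k x - g x)) \<longlonglongrightarrow> 0"
      by (intro tendsto_sandwich[OF _ _ tendsto_const lim0]) (auto intro!: always_eventually)
  qed
qed

section \<open>Gaussians\<close>

text \<open>Lebesgue measure is the image of the product of one-dimensional Lebesgue measures under
  the coordinate map. Serves both the Gaussians and the majorant \<open>tail_weight\<close>.\<close>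

lemma lborel_prod_integral:
  fixes f :: "'a::euclidean_space \<Rightarrow> real \<Rightarrow> 'b::{real_normed_field,banach,second_countable_topology}"
  assumes "\<And>b. b \<in> Basis \<Longrightarrow> integrable lborel (f b)"
  shows "integrable lborel (\<lambda>x. \<Prod>b\<in>Basis. f b (x \<bullet> b))"
    and "(\<integral>x. (\<Prod>b\<in>Basis. f b (x \<bullet> b)) \<partial>lborel) = (\<Prod>b\<in>Basis. \<integral>x. f b x \<partial>lborel)"
proof -
  interpret product_sigma_finite "\<lambda>_::'a. lborel :: real measure" ..
  have [measurable]: "f b \<in> borel_measurable borel" if "b \<in> Basis" for b
    using assms[OF that] by auto
  have meas: "(\<lambda>x. \<Prod>b\<in>Basis. f b (x \<bullet> b)) \<in> borel_measurable (borel :: 'a measure)"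
    by measurable
  have eq: "(\<Prod>b\<in>Basis. f b ((\<Sum>b\<in>Basis. g b *\<^sub>R b) \<bullet> b)) = (\<Prod>b\<in>Basis. f b (g b))" for g :: "'a \<Rightarrow> real"
    by (intro prod.cong refl) (simp add: inner_sum_left_Basis)
  show "integrable lborel (\<lambda>x. \<Prod>b\<in>Basis. f b (x \<bullet> b))"
    unfolding lborel_eq[where 'a='a]
    by (subst integrable_distr_eq)
       (auto simp: eq meas intro!: product_integrable_prod[of Basis f] assms)
  show "(\<integral>x. (\<Prod>b\<in>Basis. f b (x \<bullet> b)) \<partial>lborel) = (\<Prod>b\<in>Basis. \<integral>x. f b x \<partial>lborel)"
    unfolding lborel_eq[where 'a='a]
    by (subst integral_distr)
       (auto simp: eq meas intro!: product_integral_prod[of Basis f] assms)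
qed

text \<open>The characteristic function of the standard normal law, rescaled by sqrt s.\<close>

lemma gaussian_fourier_real:
  fixes s t :: real
  assumes s: "0 < s"
  shows "integrable lborel (\<lambda>x. exp (- (\<i> * of_real (x * t))) * of_real (exp (- (s / 2) * x\<^sup>2)))"
    and "(\<integral>x. exp (- (\<i> * of_real (x * t))) * of_real (exp (- (s / 2) * x\<^sup>2)) \<partial>lborel)
         = of_real (sqrt (2 * pi / s) * exp (- (1 / s / 2) * t\<^sup>2))"
proof -
  \<comment> \<open>Chosen such that \<open>u * (sqrt s * x) = - (x * t)\<close>.\<close>
  define u where "u = - (t / sqrt s)"
  have base: "integrable lborel (\<lambda>x. std_normal_density x *\<^sub>R iexp (u * x))"
  proof (rule Bochner_Integration.integrable_bound)
    show "integrable lborel std_normal_density" by (rule integrable_normal_density) simp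
  qed auto
  have val: "(\<integral>x. std_normal_density x *\<^sub>R iexp (u * x) \<partial>lborel) = of_real (exp (- (u\<^sup>2) / 2))"
    using fun_cong[OF char_std_normal_distribution, of u] unfolding char_def
    by (subst (asm) integral_density) auto
  have rs: "sqrt s \<noteq> 0" using s by simp
  have eq: "exp (- (\<i> * of_real (x * t))) * of_real (exp (- (s / 2) * x\<^sup>2))
     = of_real (sqrt (2 * pi)) * (std_normal_density (0 + sqrt s * x) *\<^sub>R iexp (u * (0 + sqrt s * x)))" for x
  proof -
    have "u * (sqrt s * x) = - (x * t)" using rs by (simp add: u_def)
    then show ?thesis
      using s by (simp add: std_normal_density_def scaleR_conv_of_real power_mult_distrib real_sqrt_mult)
  qed
  show "integrable lborel (\<lambda>x. exp (- (\<i> * of_real (x * t))) * of_real (exp (- (s / 2) * x\<^sup>2)))"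
    unfolding eq by (intro integrable_mult_right lborel_integrable_real_affine base rs)
  have "(\<integral>x. exp (- (\<i> * of_real (x * t))) * of_real (exp (- (s / 2) * x\<^sup>2)) \<partial>lborel)
     = of_real (sqrt (2 * pi)) * (\<integral>x. std_normal_density (0 + sqrt s * x) *\<^sub>R iexp (u * (0 + sqrt s * x)) \<partial>lborel)"
    unfolding eq by (rule integral_mult_right_zero)
  also have "(\<integral>x. std_normal_density (0 + sqrt s * x) *\<^sub>R iexp (u * (0 + sqrt s * x)) \<partial>lborel)
     = (1 / sqrt s) *\<^sub>R of_real (exp (- (u\<^sup>2) / 2))"
    using lborel_integral_real_affine[OF rs, of "\<lambda>x. std_normal_density x *\<^sub>R iexp (u * x)" 0] val s
    by (simp add: field_simps scaleR_conv_of_real)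
  also have "u\<^sup>2 = t\<^sup>2 / s" using s by (simp add: u_def power_divide)
  finally show "(\<integral>x. exp (- (\<i> * of_real (x * t))) * of_real (exp (- (s / 2) * x\<^sup>2)) \<partial>lborel)
         = of_real (sqrt (2 * pi / s) * exp (- (1 / s / 2) * t\<^sup>2))"
    by (simp add: scaleR_conv_of_real real_sqrt_divide real_sqrt_mult)
qed

text \<open>The parameter is an inverse variance: the Fourier transform sends \<open>s\<close> to
  \<open>1 / s\<close>, and the weight tends to 1 as \<open>s\<close> tends to 0.\<close>

definition gauss :: "real \<Rightarrow> 'a::euclidean_space \<Rightarrow> real" where
  "gauss s x = exp (- (s / 2) * (norm x)\<^sup>2)"

lemma gauss_pos: "0 < gauss s x"
  and gauss_le_1: "0 < s \<Longrightarrow> gauss s x \<le> 1"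
  by (auto simp: gauss_def)

lemma gauss_measurable [measurable]: "gauss s \<in> borel_measurable borel"
  unfolding gauss_def by measurable

lemma gauss_prod: "gauss s x = (\<Prod>b\<in>Basis. exp (- (s / 2) * (x \<bullet> b)\<^sup>2))"
proof -
  have "(norm x)\<^sup>2 = (\<Sum>b\<in>Basis. (x \<bullet> b)\<^sup>2)"
    unfolding power2_norm_eq_inner by (subst euclidean_inner) (simp add: power2_eq_square)
  then show ?thesis
    by (simp add: gauss_def exp_sum[symmetric] sum_distrib_left)
qed

lemma gaussian_fourier:
  fixes \<xi> :: "'a::euclidean_space"
  assumes s: "0 < s"
  shows "integrable lborel (\<lambda>x. exp (- (\<i> * of_real (x \<bullet> \<xi>))) * of_real (gauss s x))"
    and "(\<integral>x. exp (- (\<i> * of_real (x \<bullet> \<xi>))) * of_real (gauss s x) \<partial>lborel)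
         = of_real (sqrt (2 * pi / s) ^ DIM('a) * gauss (1 / s) \<xi>)"
proof -
  let ?f = "\<lambda>b x. exp (- (\<i> * of_real (x * (\<xi> \<bullet> b)))) * of_real (exp (- (s / 2) * x\<^sup>2))"
  have eq: "exp (- (\<i> * of_real (x \<bullet> \<xi>))) * of_real (gauss s x) = (\<Prod>b\<in>Basis. ?f b (x \<bullet> b))" for x
    unfolding gauss_prod prod.distrib of_real_prod
    by (subst euclidean_inner) (simp add: sum_distrib_left sum_negf[symmetric] exp_sum[symmetric])
  show "integrable lborel (\<lambda>x. exp (- (\<i> * of_real (x \<bullet> \<xi>))) * of_real (gauss s x))"
    unfolding eq by (rule lborel_prod_integral) (rule gaussian_fourier_real[OF s])
  have "(\<integral>x. exp (- (\<i> * of_real (x \<bullet> \<xi>))) * of_real (gauss s x) \<partial>lborel)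
     = (\<Prod>b\<in>Basis. of_real (sqrt (2 * pi / s) * exp (- (1 / s / 2) * (\<xi> \<bullet> b)\<^sup>2)))"
    unfolding eq
    by (subst lborel_prod_integral(2), rule gaussian_fourier_real[OF s])
       (simp only: gaussian_fourier_real(2)[OF s])
  then show "(\<integral>x. exp (- (\<i> * of_real (x \<bullet> \<xi>))) * of_real (gauss s x) \<partial>lborel)
         = of_real (sqrt (2 * pi / s) ^ DIM('a) * gauss (1 / s) \<xi>)"
    by (simp add: gauss_prod[of "1/s"] prod.distrib)
qed

lemma gauss_integral:
  assumes s: "0 < s"
  shows "integrable lborel (gauss s :: 'a::euclidean_space \<Rightarrow> real)"
    and "(\<integral>x. gauss s x \<partial>(lborel :: 'a measure)) = sqrt (2 * pi / s) ^ DIM('a)"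
proof -
  have *: "integrable lborel (\<lambda>x::'a. complex_of_real (gauss s x))"
    using gaussian_fourier(1)[OF s, of "0::'a"] by simp
  then show "integrable lborel (gauss s :: 'a \<Rightarrow> real)"
    by (simp add: complex_of_real_integrable_eq)
  have "(\<integral>x. complex_of_real (gauss s x) \<partial>(lborel :: 'a measure)) = of_real (sqrt (2 * pi / s) ^ DIM('a))"
    using gaussian_fourier(2)[OF s, of "0::'a"] by (simp add: gauss_def)
  then show "(\<integral>x. gauss s x \<partial>(lborel :: 'a measure)) = sqrt (2 * pi / s) ^ DIM('a)"
    unfolding integral_complex_of_real of_real_eq_iff .
qed

text \<open>This is the Fourier transform of \<open>gauss s\<close>. Its mass is (2 pi)^n for every
  \<open>s\<close>, the transform being unnormalised; hence the constant in Plancherel's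
  identity.\<close>

definition heat_kernel :: "real \<Rightarrow> 'a::euclidean_space \<Rightarrow> real" where
  "heat_kernel s z = sqrt (2 * pi / s) ^ DIM('a) * gauss (1 / s) z"

lemma heat_kernel_nonneg: "0 < s \<Longrightarrow> 0 \<le> heat_kernel s z"
  by (simp add: heat_kernel_def less_imp_le[OF gauss_pos])

lemma heat_kernel_measurable [measurable]: "heat_kernel s \<in> borel_measurable borel"
  unfolding heat_kernel_def by measurable

lemma lborel_translate:
  fixes f :: "'a::euclidean_space \<Rightarrow> 'b::{banach,second_countable_topology}"
  assumes [measurable]: "f \<in> borel_measurable borel"
  shows "integrable lborel (\<lambda>y. f (y - x)) \<longleftrightarrow> integrable lborel f"
    and "(\<integral>y. f (y - x) \<partial>lborel) = (\<integral>y. f y \<partial>lborel)"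
proof -
  have d: "distr lborel borel ((+) (-x)) = (lborel :: 'a measure)" by (rule lborel_distr_plus)
  show "integrable lborel (\<lambda>y. f (y - x)) \<longleftrightarrow> integrable lborel f"
    by (subst (2) d[symmetric], subst integrable_distr_eq) simp_all
  show "(\<integral>y. f (y - x) \<partial>lborel) = (\<integral>y. f y \<partial>lborel)"
    by (subst (2) d[symmetric], subst integral_distr) simp_all
qed

lemma heat_kernel_integral:
  assumes s: "0 < s"
  shows "integrable lborel (\<lambda>y. heat_kernel s (y - x :: 'a::euclidean_space))"
    and "(\<integral>y. heat_kernel s (y - x :: 'a) \<partial>lborel) = (2 * pi) ^ DIM('a)"
proof -
  have int: "integrable lborel (gauss (1/s) :: 'a \<Rightarrow> real)" using s by (intro gauss_integral) auto
  show "integrable lborel (\<lambda>y. heat_kernel s (y - x :: 'a))"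
    by (subst lborel_translate) (auto simp: heat_kernel_def[abs_def] int)
  have "sqrt (2 * pi / s) * sqrt (2 * pi / (1 / s)) = 2 * pi"
    using s real_sqrt_abs[of "2 * pi"]
    by (simp add: real_sqrt_mult[symmetric] power2_eq_square del: real_sqrt_abs)
  then have "sqrt (2 * pi / s) ^ DIM('a) * sqrt (2 * pi / (1 / s)) ^ DIM('a) = (2 * pi) ^ DIM('a)"
    by (metis power_mult_distrib)
  then show "(\<integral>y. heat_kernel s (y - x :: 'a) \<partial>lborel) = (2 * pi) ^ DIM('a)"
    using gauss_integral(2)[of "1/s", where 'a='a] s
    by (subst lborel_translate) (simp_all add: heat_kernel_def[abs_def])
qed

section \<open>The Fourier integral\<close>

lemma fourier_kernel_norm [simp]: "cmod (exp (- (\<i> * complex_of_real r))) = 1"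
  by (simp add: norm_exp_eq_Re)

lemma fourier_integrand_integrable:
  fixes f :: "real^'n \<Rightarrow> complex"
  assumes "integrable lborel f"
  shows "integrable lborel (\<lambda>x. exp (- (\<i> * complex_of_real (x \<bullet> \<xi>))) * f x)"
  using assms by (rule Bochner_Integration.integrable_bound) (use assms in \<open>auto simp: norm_mult\<close>)

lemma fourier_integral_measurable [measurable]:
  fixes f :: "real^'n \<Rightarrow> complex"
  assumes "integrable lborel f"
  shows "fourier_integral f \<in> borel_measurable borel"
proof -
  have [measurable]: "f \<in> borel_measurable borel" using assms by auto
  show ?thesis unfolding fourier_integral_def by measurable
qed

lemma fourier_integral_bound:
  fixes f :: "real^'n \<Rightarrow> complex"
  shows "cmod (fourier_integral f \<xi>) \<le> (\<integral>x. cmod (f x) \<partial>lborel)"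
  using integral_norm_bound[of lborel "\<lambda>x. exp (- (\<i> * complex_of_real (x \<bullet> \<xi>))) * f x"]
  by (simp add: fourier_integral_def norm_mult)

lemma integrable_mult_bounded:
  fixes f g :: "'a \<Rightarrow> complex"
  assumes "integrable M f" "g \<in> borel_measurable M" "\<And>x. cmod (g x) \<le> B"
  shows "integrable M (\<lambda>x. g x * f x)"
proof (rule Bochner_Integration.integrable_bound[where f="\<lambda>x. B * cmod (f x)"])
  show "AE x in M. norm (g x * f x) \<le> norm (B * cmod (f x))"
  proof (rule AE_I2)
    fix x
    have "norm (g x * f x) \<le> B * cmod (f x)"
      unfolding norm_mult by (intro mult_right_mono assms) simp
    then show "norm (g x * f x) \<le> norm (B * cmod (f x))" by simp
  qed
qed (use assms in auto)

text \<open>Fubini's theorem: the kernel is symmetric in both variables and has modulus 1, so the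
  double integral converges absolutely.\<close>

lemma fourier_integral_multiplication:
  fixes f h :: "real^'n \<Rightarrow> complex"
  assumes f: "integrable lborel f" and h: "integrable lborel h"
  shows "(\<integral>\<xi>. fourier_integral f \<xi> * h \<xi> \<partial>lborel) = (\<integral>x. f x * fourier_integral h x \<partial>lborel)"
proof -
  have [measurable]: "f \<in> borel_measurable borel" "h \<in> borel_measurable borel" using f h by auto
  let ?k = "\<lambda>\<xi> x. exp (- (\<i> * complex_of_real (x \<bullet> \<xi>))) * f x * h \<xi>"
  have int: "integrable (lborel \<Otimes>\<^sub>M lborel) (case_prod ?k)"
  proof (rule lborel_pair.Fubini_integrable)
    show "integrable lborel (\<lambda>\<xi>. \<integral>x. norm (case (\<xi>, x) of (\<xi>, x) \<Rightarrow> ?k \<xi> x) \<partial>lborel)"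
      using h by (simp add: norm_mult)
    show "AE \<xi> in lborel. integrable lborel (\<lambda>x. case (\<xi>, x) of (\<xi>, x) \<Rightarrow> ?k \<xi> x)"
      by (intro AE_I2) (simp add: fourier_integrand_integrable[OF f])
  qed (simp add: borel_prod)
  have "(\<integral>\<xi>. fourier_integral f \<xi> * h \<xi> \<partial>lborel) = (\<integral>\<xi>. (\<integral>x. ?k \<xi> x \<partial>lborel) \<partial>lborel)"
    by (simp add: fourier_integral_def)
  also have "\<dots> = (\<integral>x. (\<integral>\<xi>. ?k \<xi> x \<partial>lborel) \<partial>lborel)"
    using lborel_pair.Fubini_integral[OF int] by simp
  also have "\<dots> = (\<integral>x. f x * (\<integral>\<xi>. exp (- (\<i> * complex_of_real (\<xi> \<bullet> x))) * h \<xi> \<partial>lborel) \<partial>lborel)"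
    by (simp add: mult_ac inner_commute flip: integral_mult_right_zero)
  finally show ?thesis by (simp add: fourier_integral_def)
qed


lemma fourier_integral_cnj:
  "cnj (fourier_integral f \<xi>) = (\<integral>x. exp (\<i> * complex_of_real (x \<bullet> \<xi>)) * cnj (f x) \<partial>lborel)"
  unfolding fourier_integral_def by (subst Bochner_Integration.integral_cnj[symmetric]) (simp add: exp_cnj)

text \<open>Modulation of the Gaussian becomes translation of its transform.\<close>

lemma fourier_integral_modulated_gauss:
  fixes x :: "real^'n"
  assumes s: "0 < s"
  shows "integrable lborel (\<lambda>\<xi>. exp (\<i> * complex_of_real (\<xi> \<bullet> x)) * complex_of_real (gauss s \<xi>))"
    and "fourier_integral (\<lambda>\<xi>. exp (\<i> * complex_of_real (\<xi> \<bullet> x)) * complex_of_real (gauss s \<xi>)) y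
         = complex_of_real (heat_kernel s (y - x))"
proof -
  show "integrable lborel (\<lambda>\<xi>. exp (\<i> * complex_of_real (\<xi> \<bullet> x)) * complex_of_real (gauss s \<xi>))"
    using gaussian_fourier(1)[OF s, of "-x"] by simp
  have "exp (- (\<i> * complex_of_real (\<xi> \<bullet> y))) * (exp (\<i> * complex_of_real (\<xi> \<bullet> x)) * complex_of_real (gauss s \<xi>))
     = exp (- (\<i> * complex_of_real (\<xi> \<bullet> (y - x)))) * complex_of_real (gauss s \<xi>)" for \<xi> :: "real^'n"
    by (simp add: inner_diff_right algebra_simps exp_add[symmetric] flip: mult.assoc)
  then show "fourier_integral (\<lambda>\<xi>. exp (\<i> * complex_of_real (\<xi> \<bullet> x)) * complex_of_real (gauss s \<xi>)) y
         = complex_of_real (heat_kernel s (y - x))"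
    unfolding fourier_integral_def heat_kernel_def
    by (simp only: gaussian_fourier(2)[OF s, of "y - x"])
qed

text \<open>Write the left-hand integrand as the transform of \<open>f\<close> times
  \<open>h\<close>, where \<open>h\<close> is the conjugate of that transform times the Gaussian.
  The multiplication formula moves the transform onto \<open>h\<close>, and a second use of it
  identifies the transform of \<open>h\<close> as the conjugate of a heat-kernel average of
  \<open>f\<close>. No inversion theorem is involved.\<close>

lemma gauss_weighted_integral:
  fixes f :: "real^'n \<Rightarrow> complex"
  assumes f: "integrable lborel f" and s: "0 < s"
  shows "integrable lborel (\<lambda>\<xi>. gauss s \<xi> * (cmod (fourier_integral f \<xi>))\<^sup>2)"
    and "complex_of_real (\<integral>\<xi>. gauss s \<xi> * (cmod (fourier_integral f \<xi>))\<^sup>2 \<partial>lborel)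
     = (\<integral>x. f x * cnj (\<integral>y. complex_of_real (heat_kernel s (y - x)) * f y \<partial>lborel) \<partial>lborel)"
proof -
  note [measurable] = fourier_integral_measurable[OF f]
  define B where "B = (\<integral>x. cmod (f x) \<partial>lborel)"
  have bd: "cmod (fourier_integral f \<xi>) \<le> B" for \<xi> unfolding B_def by (rule fourier_integral_bound)
  define h where "h \<xi> = cnj (fourier_integral f \<xi>) * complex_of_real (gauss s \<xi>)" for \<xi>
  have gi: "integrable lborel (\<lambda>\<xi>::real^'n. complex_of_real (gauss s \<xi>))"
    using gauss_integral(1)[OF s] by (simp only: complex_of_real_integrable_eq)
  have h: "integrable lborel h"
    unfolding h_def by (rule integrable_mult_bounded[OF gi, where B=B]) (auto simp: bd)
  have eq: "fourier_integral f \<xi> * h \<xi> = complex_of_real (gauss s \<xi> * (cmod (fourier_integral f \<xi>))\<^sup>2)" for \<xi>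
  proof -
    have "fourier_integral f \<xi> * cnj (fourier_integral f \<xi>) = complex_of_real ((cmod (fourier_integral f \<xi>))\<^sup>2)"
      using complex_norm_square[of "fourier_integral f \<xi>"] by simp
    then show ?thesis unfolding h_def of_real_mult by (metis mult.assoc mult.commute)
  qed
  have "integrable lborel (\<lambda>\<xi>. fourier_integral f \<xi> * h \<xi>)"
    by (rule integrable_mult_bounded[OF h, where B=B]) (auto simp: bd)
  then show "integrable lborel (\<lambda>\<xi>. gauss s \<xi> * (cmod (fourier_integral f \<xi>))\<^sup>2)"
    unfolding eq by (simp only: complex_of_real_integrable_eq)
  have hh: "fourier_integral h x = cnj (\<integral>y. complex_of_real (heat_kernel s (y - x)) * f y \<partial>lborel)" for x
  proof -
    let ?e = "\<lambda>\<xi>::real^'n. exp (\<i> * complex_of_real (\<xi> \<bullet> x)) * complex_of_real (gauss s \<xi>)"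
    have "cnj (fourier_integral h x) = (\<integral>\<xi>. fourier_integral f \<xi> * ?e \<xi> \<partial>lborel)"
      unfolding fourier_integral_cnj by (simp add: h_def mult_ac)
    also have "\<dots> = (\<integral>y. f y * fourier_integral ?e y \<partial>lborel)"
      by (rule fourier_integral_multiplication[OF f fourier_integral_modulated_gauss(1)[OF s]])
    finally have "cnj (fourier_integral h x) = (\<integral>y. complex_of_real (heat_kernel s (y - x)) * f y \<partial>lborel)"
      unfolding fourier_integral_modulated_gauss(2)[OF s] by (simp only: mult.commute)
    then show ?thesis by (metis complex_cnj_cnj)
  qed
  have "complex_of_real (\<integral>\<xi>. gauss s \<xi> * (cmod (fourier_integral f \<xi>))\<^sup>2 \<partial>lborel)
      = (\<integral>\<xi>. fourier_integral f \<xi> * h \<xi> \<partial>lborel)"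
    unfolding eq by (simp only: integral_complex_of_real)
  also have "\<dots> = (\<integral>x. f x * fourier_integral h x \<partial>lborel)"
    by (rule fourier_integral_multiplication[OF f h])
  finally show "complex_of_real (\<integral>\<xi>. gauss s \<xi> * (cmod (fourier_integral f \<xi>))\<^sup>2 \<partial>lborel)
     = (\<integral>x. f x * cnj (\<integral>y. complex_of_real (heat_kernel s (y - x)) * f y \<partial>lborel) \<partial>lborel)"
    by (simp only: hh)
qed

section \<open>The transform is bounded in L2 on integrable square-integrable functions\<close>

lemma heat_kernel_nn_integral:
  assumes "0 < s"
  shows "(\<integral>\<^sup>+y. ennreal (heat_kernel s (y - x :: 'a::euclidean_space)) \<partial>lborel) = ennreal ((2 * pi) ^ DIM('a))"
  using heat_kernel_integral[OF assms, of x]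
  by (subst nn_integral_eq_integral) (auto intro!: AE_I2 heat_kernel_nonneg[OF assms])

lemma heat_kernel_commute: "heat_kernel s (y - x) = heat_kernel s (x - y)"
  by (simp add: heat_kernel_def gauss_def norm_minus_commute)

text \<open>Schur's test: the kernel is symmetric with mass (2 pi)^n in either variable, and |f(x)
  f(y)| \<le> |f(x)|^2 / 2 + |f(y)|^2 / 2, so each half contributes the same amount. The bound is
  uniform in \<open>s\<close>.\<close>

lemma gauss_weighted_bound:
  fixes f :: "real^'n \<Rightarrow> complex"
  assumes f: "integrable lborel f" "f \<in> L2" and s: "0 < s"
  shows "(\<integral>\<xi>. gauss s \<xi> * (cmod (fourier_integral f \<xi>))\<^sup>2 \<partial>lborel) \<le> (2 * pi) ^ CARD('n) * (L2_norm f)\<^sup>2"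
proof -
  have [measurable]: "f \<in> borel_measurable borel" using f(1) by auto
  let ?c = "(2 * pi) ^ CARD('n)" and ?k = "\<lambda>x y :: real^'n. heat_kernel s (y - x)"
  let ?I = "\<integral>\<xi>. gauss s \<xi> * (cmod (fourier_integral f \<xi>))\<^sup>2 \<partial>lborel"
  note kn = heat_kernel_nonneg[OF s] and kI = heat_kernel_nn_integral[OF s, where 'a="real^'n", simplified DIM_cart DIM_real mult_1_right]
  have I0: "0 \<le> ?I"
    by (intro integral_nonneg_AE AE_I2) (simp add: less_imp_le[OF gauss_pos])
  have pt: "ennreal (cmod (f x * cnj (\<integral>y. complex_of_real (?k x y) * f y \<partial>lborel)))
      \<le> (\<integral>\<^sup>+y. ennreal (?k x y * (cmod (f x))\<^sup>2 / 2) + ennreal (?k x y * (cmod (f y))\<^sup>2 / 2) \<partial>lborel)" for x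
  proof -
    have "ennreal (cmod (f x * cnj (\<integral>y. complex_of_real (?k x y) * f y \<partial>lborel)))
       = ennreal (cmod (\<integral>y. f x * (complex_of_real (?k x y) * f y) \<partial>lborel))"
      by (simp add: norm_mult)
    also have "\<dots> \<le> (\<integral>\<^sup>+y. ennreal (cmod (f x * (complex_of_real (?k x y) * f y))) \<partial>lborel)"
    \<comment> \<open>Integrability need not be established: a non-integrable function has integral
      0, for which the bound is trivial. The outer integral is treated in the same way
      below.\<close>
    proof (cases "integrable lborel (\<lambda>y. f x * (complex_of_real (?k x y) * f y))")
      case True then show ?thesis by (rule integral_norm_bound_ennreal)
    next
      case False show ?thesis unfolding not_integrable_integral_eq[OF False] by simp
    qed
    also have "\<dots> \<le> (\<integral>\<^sup>+y. ennreal (?k x y * (cmod (f x))\<^sup>2 / 2 + ?k x y * (cmod (f y))\<^sup>2 / 2) \<partial>lborel)"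
    proof (intro nn_integral_mono ennreal_leI)
      fix y
      have "cmod (f x) * cmod (f y) \<le> (cmod (f x))\<^sup>2 / 2 + (cmod (f y))\<^sup>2 / 2"
        using sum_squares_bound[of "cmod (f x)" "cmod (f y)"] by simp
      from mult_left_mono[OF this kn[of "y - x"]]
      show "cmod (f x * (complex_of_real (?k x y) * f y)) \<le> ?k x y * (cmod (f x))\<^sup>2 / 2 + ?k x y * (cmod (f y))\<^sup>2 / 2"
        using kn[of "y - x"] by (simp add: norm_mult algebra_simps)
    qed
    also have "\<dots> = (\<integral>\<^sup>+y. ennreal (?k x y * (cmod (f x))\<^sup>2 / 2) + ennreal (?k x y * (cmod (f y))\<^sup>2 / 2) \<partial>lborel)"
      by (intro nn_integral_cong ennreal_plus) (auto simp: kn)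
    finally show ?thesis .
  qed
  have half1: "(\<integral>\<^sup>+x. \<integral>\<^sup>+y. ennreal (?k x y * (cmod (f x))\<^sup>2 / 2) \<partial>lborel \<partial>lborel)
     = ennreal (?c * (L2_norm f)\<^sup>2 / 2)"
  proof -
    have "(\<integral>\<^sup>+x. \<integral>\<^sup>+y. ennreal (?k x y * (cmod (f x))\<^sup>2 / 2) \<partial>lborel \<partial>lborel)
       = (\<integral>\<^sup>+x. ennreal ?c * ennreal ((cmod (f x))\<^sup>2 / 2) \<partial>lborel)"
      using kI by (simp add: ennreal_mult kn nn_integral_multc flip: times_divide_eq_right)
    also have "\<dots> = (\<integral>\<^sup>+x. ennreal (?c / 2) * ennreal ((cmod (f x))\<^sup>2) \<partial>lborel)"
      by (simp flip: ennreal_mult)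
    also have "\<dots> = ennreal (?c / 2) * ennreal ((L2_norm f)\<^sup>2)"
      using nn_integral_L2[OF f(2)] by (simp add: nn_integral_cmult)
    finally show ?thesis by (simp flip: ennreal_mult)
  qed
  have half2: "(\<integral>\<^sup>+x. \<integral>\<^sup>+y. ennreal (?k x y * (cmod (f y))\<^sup>2 / 2) \<partial>lborel \<partial>lborel)
     = ennreal (?c * (L2_norm f)\<^sup>2 / 2)"
  proof -
    have "(\<integral>\<^sup>+x. \<integral>\<^sup>+y. ennreal (?k x y * (cmod (f y))\<^sup>2 / 2) \<partial>lborel \<partial>lborel)
       = (\<integral>\<^sup>+y. \<integral>\<^sup>+x. ennreal (?k x y * (cmod (f y))\<^sup>2 / 2) \<partial>lborel \<partial>lborel)"
      by (rule lborel_pair.Fubini'[symmetric]) (simp add: borel_prod)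
    also have "\<dots> = ennreal (?c * (L2_norm f)\<^sup>2 / 2)"
      using half1 by (simp only: heat_kernel_commute)
    finally show ?thesis .
  qed
  have "ennreal ?I = ennreal (cmod (complex_of_real ?I))"
    using I0 by simp
  also have "\<dots> \<le> (\<integral>\<^sup>+x. ennreal (cmod (f x * cnj (\<integral>y. complex_of_real (?k x y) * f y \<partial>lborel))) \<partial>lborel)"
    unfolding gauss_weighted_integral(2)[OF f(1) s]
  proof (cases "integrable lborel (\<lambda>x. f x * cnj (\<integral>y. complex_of_real (?k x y) * f y \<partial>lborel))")
    case True then show "ennreal (cmod (\<integral>x. f x * cnj (\<integral>y. complex_of_real (?k x y) * f y \<partial>lborel) \<partial>lborel))
      \<le> (\<integral>\<^sup>+x. ennreal (cmod (f x * cnj (\<integral>y. complex_of_real (?k x y) * f y \<partial>lborel))) \<partial>lborel)"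
      by (rule integral_norm_bound_ennreal)
  qed (simp add: not_integrable_integral_eq)
  also have "\<dots> \<le> (\<integral>\<^sup>+x. \<integral>\<^sup>+y. ennreal (?k x y * (cmod (f x))\<^sup>2 / 2) + ennreal (?k x y * (cmod (f y))\<^sup>2 / 2) \<partial>lborel \<partial>lborel)"
    by (intro nn_integral_mono pt)
  also have "\<dots> = ennreal (?c * (L2_norm f)\<^sup>2 / 2) + ennreal (?c * (L2_norm f)\<^sup>2 / 2)"
  proof -
    have "(\<integral>\<^sup>+y. ennreal (?k x y * (cmod (f x))\<^sup>2 / 2) + ennreal (?k x y * (cmod (f y))\<^sup>2 / 2) \<partial>lborel)
      = (\<integral>\<^sup>+y. ennreal (?k x y * (cmod (f x))\<^sup>2 / 2) \<partial>lborel) + (\<integral>\<^sup>+y. ennreal (?k x y * (cmod (f y))\<^sup>2 / 2) \<partial>lborel)" for x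
      by (rule nn_integral_add) auto
    then have "?thesis \<longleftrightarrow> (\<integral>\<^sup>+x. (\<integral>\<^sup>+y. ennreal (?k x y * (cmod (f x))\<^sup>2 / 2) \<partial>lborel) + (\<integral>\<^sup>+y. ennreal (?k x y * (cmod (f y))\<^sup>2 / 2) \<partial>lborel) \<partial>lborel)
      = (\<integral>\<^sup>+x. \<integral>\<^sup>+y. ennreal (?k x y * (cmod (f x))\<^sup>2 / 2) \<partial>lborel \<partial>lborel) + (\<integral>\<^sup>+x. \<integral>\<^sup>+y. ennreal (?k x y * (cmod (f y))\<^sup>2 / 2) \<partial>lborel \<partial>lborel)"
      by (simp only: half1 half2)
    then show ?thesis
      by (simp only:, intro nn_integral_add lborel.borel_measurable_nn_integral)
         (simp_all add: borel_prod)
  qed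
  also have "\<dots> = ennreal (?c * (L2_norm f)\<^sup>2)" by (simp flip: ennreal_plus)
  finally show ?thesis by simp
qed

lemma gauss_tendsto_1: "(\<lambda>k. gauss (1 / real (Suc k)) x) \<longlonglongrightarrow> 1"
proof -
  have "(\<lambda>k. exp (- (inverse (real (Suc k)) / 2) * (norm x)\<^sup>2)) \<longlonglongrightarrow> exp (- (0 / 2) * (norm x)\<^sup>2)"
    by (intro tendsto_intros LIMSEQ_inverse_real_of_nat) simp
  then show ?thesis by (simp add: gauss_def inverse_eq_divide)
qed

text \<open>Fatou's lemma as the Gaussian weight tends to 1. It yields only an inequality; the
  opposite one is found through the defect below.\<close>

lemma fourier_integral_L2_bound:
  fixes f :: "real^'n \<Rightarrow> complex"
  assumes f: "integrable lborel f" "f \<in> L2"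
  shows "fourier_integral f \<in> L2" "(L2_norm (fourier_integral f))\<^sup>2 \<le> (2 * pi) ^ CARD('n) * (L2_norm f)\<^sup>2"
proof -
  note [measurable] = fourier_integral_measurable[OF f(1)]
  let ?c = "(2 * pi) ^ CARD('n) * (L2_norm f)\<^sup>2"
  let ?s = "\<lambda>k. 1 / real (Suc k)"
  have "(\<integral>\<^sup>+\<xi>. (cmod (fourier_integral f \<xi>))\<^sup>2 \<partial>lborel)
      = (\<integral>\<^sup>+\<xi>. liminf (\<lambda>k. ennreal (gauss (?s k) \<xi> * (cmod (fourier_integral f \<xi>))\<^sup>2)) \<partial>lborel)"
  proof (rule nn_integral_cong)
    fix \<xi> :: "real^'n"
    have "(\<lambda>k. ennreal (gauss (?s k) \<xi> * (cmod (fourier_integral f \<xi>))\<^sup>2))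
        \<longlonglongrightarrow> ennreal (1 * (cmod (fourier_integral f \<xi>))\<^sup>2)"
      by (intro tendsto_ennrealI tendsto_intros gauss_tendsto_1)
    then show "ennreal ((cmod (fourier_integral f \<xi>))\<^sup>2)
       = liminf (\<lambda>k. ennreal (gauss (?s k) \<xi> * (cmod (fourier_integral f \<xi>))\<^sup>2))"
      using lim_imp_Liminf[OF trivial_limit_sequentially] by fastforce
  qed
  also have "\<dots> \<le> liminf (\<lambda>k. \<integral>\<^sup>+\<xi>. ennreal (gauss (?s k) \<xi> * (cmod (fourier_integral f \<xi>))\<^sup>2) \<partial>lborel)"
    by (rule nn_integral_liminf) auto
  also have "\<dots> \<le> liminf (\<lambda>k. ennreal ?c)"
  proof (intro Liminf_mono always_eventually allI)
    fix k
    have "(\<integral>\<^sup>+\<xi>. ennreal (gauss (?s k) \<xi> * (cmod (fourier_integral f \<xi>))\<^sup>2) \<partial>lborel)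
      = ennreal (\<integral>\<xi>. gauss (?s k) \<xi> * (cmod (fourier_integral f \<xi>))\<^sup>2 \<partial>lborel)"
      by (intro nn_integral_eq_integral gauss_weighted_integral f)
         (auto simp: less_imp_le[OF gauss_pos])
    also have "\<dots> \<le> ennreal ?c"
      by (intro ennreal_leI gauss_weighted_bound f) simp
    finally show "(\<integral>\<^sup>+\<xi>. ennreal (gauss (?s k) \<xi> * (cmod (fourier_integral f \<xi>))\<^sup>2) \<partial>lborel) \<le> ennreal ?c" .
  qed
  finally have *: "(\<integral>\<^sup>+\<xi>. (cmod (fourier_integral f \<xi>))\<^sup>2 \<partial>lborel) \<le> ennreal ?c"
    by (simp add: Liminf_const)
  show "fourier_integral f \<in> L2" "(L2_norm (fourier_integral f))\<^sup>2 \<le> ?c"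
    by (rule L2I_nn_integral[OF _ *]; simp)+
qed


section \<open>Vanishing of the Plancherel defect\<close>

lemma fourier_integral_add:
  fixes f g :: "real^'n \<Rightarrow> complex"
  assumes "integrable lborel f" "integrable lborel g"
  shows "fourier_integral (\<lambda>x. f x + g x) = (\<lambda>\<xi>. fourier_integral f \<xi> + fourier_integral g \<xi>)"
  unfolding fourier_integral_def
  using fourier_integrand_integrable[OF assms(1)] fourier_integrand_integrable[OF assms(2)]
  by (simp add: distrib_left)

lemma fourier_integral_diff:
  fixes f g :: "real^'n \<Rightarrow> complex"
  assumes "integrable lborel f" "integrable lborel g"
  shows "fourier_integral (\<lambda>x. f x - g x) = (\<lambda>\<xi>. fourier_integral f \<xi> - fourier_integral g \<xi>)"
  unfolding fourier_integral_def
  using fourier_integrand_integrable[OF assms(1)] fourier_integrand_integrable[OF assms(2)]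
  by (simp add: right_diff_distrib)

lemma fourier_integral_scale:
  "fourier_integral (\<lambda>x. c * f x) = (\<lambda>\<xi>. c * fourier_integral f \<xi>)"
  unfolding fourier_integral_def by (subst integral_mult_right_zero[symmetric]) (simp add: mult_ac)

lemma L2_parallelogram:
  assumes "f \<in> L2" "g \<in> L2"
  shows "(L2_norm (\<lambda>x. f x + g x))\<^sup>2 + (L2_norm (\<lambda>x. f x - g x))\<^sup>2 = 2 * (L2_norm f)\<^sup>2 + 2 * (L2_norm g)\<^sup>2"
proof -
  have "(cmod (f x + g x))\<^sup>2 + (cmod (f x - g x))\<^sup>2 = 2 * (cmod (f x))\<^sup>2 + 2 * (cmod (g x))\<^sup>2" for x
    by (simp add: power2_norm_eq_inner inner_simps inner_commute)
  then have "(\<integral>x. (cmod (f x + g x))\<^sup>2 + (cmod (f x - g x))\<^sup>2 \<partial>lborel)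
      = (\<integral>x. 2 * (cmod (f x))\<^sup>2 + 2 * (cmod (g x))\<^sup>2 \<partial>lborel)" by simp
  then show ?thesis
    unfolding L2_norm_power2
    using L2_integrable[OF L2_add[OF assms]] L2_integrable[OF L2_diff[OF assms]] assms[THEN L2_integrable]
    by simp
qed

text \<open>A bounded nonnegative quadratic form, so its zeros form a closed subspace by the parallelogram
  law.\<close>

definition plancherel_defect :: "(real^'n \<Rightarrow> complex) \<Rightarrow> real" where
  "plancherel_defect f = (2 * pi) ^ CARD('n) * (L2_norm f)\<^sup>2 - (L2_norm (fourier_integral f))\<^sup>2"

lemma plancherel_defect_nonneg:
  "integrable lborel f \<Longrightarrow> f \<in> L2 \<Longrightarrow> 0 \<le> plancherel_defect f"
  using fourier_integral_L2_bound(2) by (simp add: plancherel_defect_def)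

lemma plancherel_defect_le: "plancherel_defect (f :: real^'n \<Rightarrow> complex) \<le> (2 * pi) ^ CARD('n) * (L2_norm f)\<^sup>2"
  by (simp add: plancherel_defect_def)

lemma plancherel_defect_scale: "plancherel_defect (\<lambda>x. c * f x) = (cmod c)\<^sup>2 * plancherel_defect f"
  by (simp add: plancherel_defect_def fourier_integral_scale L2_norm_scale power_mult_distrib algebra_simps)

text \<open>The parallelogram law holds for both norms, hence for the defect, and the defect of the
  difference is dropped because it is nonnegative. This replaces a triangle inequality: sums of
  functions with zero defect have zero defect.\<close>

lemma plancherel_defect_add_le:
  fixes f g :: "real^'n \<Rightarrow> complex"
  assumes f: "integrable lborel f" "f \<in> L2" and g: "integrable lborel g" "g \<in> L2"
  shows "plancherel_defect (\<lambda>x. f x + g x) \<le> 2 * plancherel_defect f + 2 * plancherel_defect g"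
proof -
  have lin: "(c * a - A) + (c * b - B) = 2 * (c * p - P) + 2 * (c * q - Q)"
    if "a + b = 2 * p + 2 * q" "A + B = 2 * P + 2 * Q" for a b p q A B P Q c :: real
  proof -
    have "(c * a - A) + (c * b - B) = c * (a + b) - (A + B)" by (simp add: algebra_simps)
    then show ?thesis unfolding that by (simp add: algebra_simps)
  qed
  have "plancherel_defect (\<lambda>x. f x + g x) + plancherel_defect (\<lambda>x. f x - g x)
     = 2 * plancherel_defect f + 2 * plancherel_defect g"
    unfolding plancherel_defect_def fourier_integral_add[OF f(1) g(1)] fourier_integral_diff[OF f(1) g(1)]
    by (rule lin[OF L2_parallelogram[OF f(2) g(2)]
      L2_parallelogram[OF fourier_integral_L2_bound(1)[OF f] fourier_integral_L2_bound(1)[OF g]]])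
  moreover have "0 \<le> plancherel_defect (\<lambda>x. f x - g x)"
    using f g by (intro plancherel_defect_nonneg L2_diff) auto
  ultimately show ?thesis by simp
qed

lemma lborel_affine_integral:
  fixes f :: "'a::euclidean_space \<Rightarrow> real"
  assumes [measurable]: "f \<in> borel_measurable borel" and c: "c \<noteq> 0"
  shows "(\<integral>y. f y \<partial>lborel) = \<bar>c\<bar> ^ DIM('a) * (\<integral>z. f (t + c *\<^sub>R z) \<partial>lborel)"
  by (subst lborel_affine[OF c, of t], subst integral_density) (auto simp: integral_distr)

text \<open>The substitution y = x + sqrt s * z freezes the kernel and leaves \<open>s\<close> only
  in the argument of \<open>f\<close>, which is the form that dominated convergence needs.\<close>

lemma heat_kernel_convolution_scale:
  fixes f :: "'a::euclidean_space \<Rightarrow> real"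
  assumes [measurable]: "f \<in> borel_measurable borel" and s: "0 < s"
  shows "(\<integral>y. heat_kernel s (y - x) * f y \<partial>lborel) = (\<integral>z. heat_kernel 1 z * f (x + sqrt s *\<^sub>R z) \<partial>lborel)"
proof -
  have "sqrt s ^ DIM('a) * heat_kernel s (sqrt s *\<^sub>R z) = heat_kernel 1 z" for z :: 'a
  proof -
    have "sqrt s ^ DIM('a) * sqrt (2 * pi / s) ^ DIM('a) = sqrt (2 * pi) ^ DIM('a)"
      using s by (simp add: real_sqrt_mult[symmetric] flip: power_mult_distrib)
    then show ?thesis
      using s by (simp add: heat_kernel_def gauss_def power_mult_distrib flip: mult.assoc)
  qed
  then have "sqrt s ^ DIM('a) * (\<integral>z. heat_kernel s (sqrt s *\<^sub>R z) * f (x + sqrt s *\<^sub>R z) \<partial>lborel)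
     = (\<integral>z. heat_kernel 1 z * f (x + sqrt s *\<^sub>R z) \<partial>lborel)"
    by (subst integral_mult_right_zero[symmetric]) (simp flip: mult.assoc)
  then show ?thesis
    using s by (subst lborel_affine_integral[where t=x and c="sqrt s"]) auto
qed

lemma integrable_indicator_complex:
  assumes "A \<in> sets M" "emeasure M A < \<infinity>"
  shows "integrable M (\<lambda>x. indicator A x :: complex)"
proof -
  have "integrable M (\<lambda>x. complex_of_real (indicator A x))"
    using assms by (subst complex_of_real_integrable_eq) (rule integrable_real_indicator)
  then show ?thesis by (simp add: of_real_indicator)
qed

text \<open>Openness enters through pointwise convergence: for x in U and any z, the point x + sqrt
  s * z lies in U once \<open>s\<close> is small, so the heat-kernel averages of the indicator tend
  to the full mass at every point of U.\<close>

lemma plancherel_defect_open: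
  fixes U :: "(real^'n) set"
  assumes U: "open U" "emeasure lborel U < \<infinity>"
  shows "plancherel_defect (\<lambda>x. indicator U x) = 0"
proof -
  let ?f = "\<lambda>x. indicator U x :: complex" and ?c = "(2 * pi) ^ CARD('n)" and ?s = "\<lambda>k. 1 / real (Suc k)"
  have [measurable]: "U \<in> sets borel" using U(1) by auto
  have f: "integrable lborel ?f" "?f \<in> L2" and nf: "(L2_norm ?f)\<^sup>2 = measure lborel U"
    using U(2) L2_indicator[of U] integrable_indicator_complex[of U] by auto
  define J where "J k x = (\<integral>z. heat_kernel 1 z * indicator U (x + sqrt (?s k) *\<^sub>R z) \<partial>lborel)" for k and x :: "real^'n"
  note hk = heat_kernel_integral[of 1 "0::real^'n", simplified]
  have I: "(\<integral>\<xi>. gauss (?s k) \<xi> * (cmod (fourier_integral ?f \<xi>))\<^sup>2 \<partial>lborel) = (\<integral>x. indicator U x * J k x \<partial>lborel)" for k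
  proof -
    have s: "0 < ?s k" by simp
    have "(\<integral>y. complex_of_real (heat_kernel (?s k) (y - x)) * ?f y \<partial>lborel) = complex_of_real (J k x)" for x
    proof -
      have "(\<integral>y. complex_of_real (heat_kernel (?s k) (y - x)) * ?f y \<partial>lborel)
        = (\<integral>y. complex_of_real (heat_kernel (?s k) (y - x) * indicator U y) \<partial>lborel)"
        by (intro Bochner_Integration.integral_cong) (auto simp: indicator_def)
      also have "\<dots> = complex_of_real (\<integral>y. heat_kernel (?s k) (y - x) * indicator U y \<partial>lborel)"
        by (rule integral_complex_of_real)
      also have "(\<integral>y. heat_kernel (?s k) (y - x) * indicator U y \<partial>lborel) = J k x"
        unfolding J_def by (rule heat_kernel_convolution_scale[OF _ s]) simp
      finally show ?thesis .
    qed
    then have "complex_of_real (\<integral>\<xi>. gauss (?s k) \<xi> * (cmod (fourier_integral ?f \<xi>))\<^sup>2 \<partial>lborel)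
       = (\<integral>x. ?f x * cnj (complex_of_real (J k x)) \<partial>lborel)"
      unfolding gauss_weighted_integral(2)[OF f(1) s] by simp
    also have "\<dots> = (\<integral>x. complex_of_real (indicator U x * J k x) \<partial>lborel)"
      by (intro Bochner_Integration.integral_cong) (auto simp: indicator_def)
    finally show ?thesis unfolding integral_complex_of_real of_real_eq_iff .
  qed
  have Jlim: "(\<lambda>k. indicator U x * J k x) \<longlonglongrightarrow> indicator U x * ?c" for x
  proof (cases "x \<in> U")
    case True
    have "(\<lambda>k. J k x) \<longlonglongrightarrow> (\<integral>z. heat_kernel 1 (z :: real^'n) \<partial>lborel)"
      unfolding J_def
    proof (rule integral_dominated_convergence[where w="heat_kernel 1"])
      show "AE z in lborel. (\<lambda>k. heat_kernel 1 z * indicator U (x + sqrt (?s k) *\<^sub>R z)) \<longlonglongrightarrow> heat_kernel 1 z"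
      proof (rule AE_I2)
        fix z
        have "(\<lambda>k. x + sqrt (inverse (real (Suc k))) *\<^sub>R z) \<longlonglongrightarrow> x + sqrt 0 *\<^sub>R z"
          by (intro tendsto_intros LIMSEQ_inverse_real_of_nat)
        then have "\<forall>\<^sub>F k in sequentially. x + sqrt (?s k) *\<^sub>R z \<in> U"
          using U(1) True by (intro topological_tendstoD[of _ x]) (auto simp: inverse_eq_divide)
        then have "\<forall>\<^sub>F k in sequentially. heat_kernel 1 z * indicator U (x + sqrt (?s k) *\<^sub>R z) = heat_kernel 1 z"
          by eventually_elim simp
        then show "(\<lambda>k. heat_kernel 1 z * indicator U (x + sqrt (?s k) *\<^sub>R z)) \<longlonglongrightarrow> heat_kernel 1 z"
          by (rule tendsto_eventually)
      qed
    qed (use hk in \<open>auto intro!: AE_I2 simp: heat_kernel_nonneg indicator_def\<close>)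
    with True hk show ?thesis by simp
  qed simp
  have Jb: "\<bar>J k x\<bar> \<le> ?c" for k x
  proof -
    have "\<bar>J k x\<bar> \<le> (\<integral>z. heat_kernel 1 (z :: real^'n) \<partial>lborel)"
      unfolding J_def
      by (rule integral_abs_bound_integral)
         (use hk in \<open>auto simp: heat_kernel_nonneg indicator_def
            intro!: Bochner_Integration.integrable_bound[OF hk(1)] AE_I2\<close>)
    with hk show ?thesis by simp
  qed
  have "(\<lambda>k. \<integral>x. indicator U x * J k x \<partial>lborel) \<longlonglongrightarrow> (\<integral>x. indicator U x * ?c \<partial>lborel)"
  proof (rule integral_dominated_convergence[where w="\<lambda>x. indicator U x * ?c"])
    show "(\<lambda>x. indicator U x * J k x) \<in> borel_measurable lborel" for k
      unfolding J_def by measurable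
    show "integrable lborel (\<lambda>x. indicator U x * ?c)" using U(2) by simp
    show "AE x in lborel. norm (indicator U x * J k x) \<le> indicator U x * ?c" for k
      using Jb by (intro AE_I2) (simp split: split_indicator)
  qed (use Jlim in auto)
  \<comment> \<open>The Gaussian weight is at most 1, so every regularised integral lies below the
    squared norm of the transform. Their limit is (2 pi)^n times the measure of U, which is the
    missing inequality.\<close>
  moreover have "(\<integral>x. indicator U x * J k x \<partial>lborel) \<le> (L2_norm (fourier_integral ?f))\<^sup>2" for k
    unfolding I[symmetric] L2_norm_power2
    by (intro integral_mono gauss_weighted_integral f L2_integrable fourier_integral_L2_bound)
       (auto intro!: mult_left_le_one_le simp: gauss_le_1 less_imp_le[OF gauss_pos])
  ultimately have "(\<integral>x. indicator U x * ?c \<partial>lborel) \<le> (L2_norm (fourier_integral ?f))\<^sup>2"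
    by (intro LIMSEQ_le_const2) auto
  then have "plancherel_defect ?f \<le> 0"
    using nf U(2) by (simp add: plancherel_defect_def mult.commute)
  then show ?thesis using plancherel_defect_nonneg[OF f] by simp
qed

text \<open>The indicator of A is that of an open superset U, which has zero defect, minus that of U
  - A, whose defect is at most a constant times its measure.\<close>

lemma plancherel_defect_indicator:
  fixes A :: "(real^'n) set"
  assumes A: "A \<in> sets lborel" "emeasure lborel A < \<infinity>"
  shows "plancherel_defect (\<lambda>x. indicator A x) = 0"
proof -
  let ?c = "(2 * pi) ^ CARD('n)"
  note ind = L2_indicator[OF A]
  have "plancherel_defect (\<lambda>x. indicator A x) \<le> 0 + e" if e: "0 < e" for e
  proof -
    \<comment> \<open>Such that the final bound \<open>2 * (?c * d)\<close> equals
      \<open>e\<close>.\<close>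
    define d where "d = e / (2 * ?c)"
    have d: "0 < d" using e by (simp add: d_def)
    from A(1) have "A \<in> sets borel" by simp
    from outer_regular_lborel_le[OF this d] obtain U where U: "open U" "A \<subseteq> U" "emeasure lborel (U - A) \<le> ennreal d"
      by blast
    have mU: "U \<in> sets lborel" using U(1) by simp
    have dU: "U - A \<in> sets lborel" "emeasure lborel (U - A) < \<infinity>"
      using mU A U(3) by (auto intro: le_less_trans)
    have "emeasure lborel U = emeasure lborel (A \<union> (U - A))" using U(2) by (simp add: Un_absorb1)
    also have "\<dots> \<le> emeasure lborel A + emeasure lborel (U - A)"
      using A dU by (intro emeasure_subadditive) auto
    finally have U_fin: "emeasure lborel U < \<infinity>" using A dU
      by (metis ennreal_add_less_top infinity_ennreal_def le_less_trans)
    note indU = L2_indicator[OF mU U_fin] and indD = L2_indicator[OF dU]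
    have eq: "(\<lambda>x. indicator A x :: complex) = (\<lambda>x. indicator U x + (- 1) * indicator (U - A) x)"
      using U(2) by (auto simp: indicator_def fun_eq_iff)
    have "plancherel_defect (\<lambda>x. indicator A x)
        \<le> 2 * plancherel_defect (\<lambda>x. indicator U x) + 2 * plancherel_defect (\<lambda>x. (- 1) * indicator (U - A) x)"
      unfolding eq using indU indD mU dU U_fin
      by (intro plancherel_defect_add_le L2_scale integrable_mult_right integrable_indicator_complex) auto
    also have "\<dots> = 2 * plancherel_defect (\<lambda>x. indicator (U - A) x)"
      using plancherel_defect_open[OF U(1) U_fin] by (simp add: plancherel_defect_scale[of "-1", simplified])
    also have "\<dots> \<le> 2 * (?c * measure lborel (U - A))"
      using plancherel_defect_le[of "\<lambda>x. indicator (U - A) x"] indD(2) by simp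
    also have "measure lborel (U - A) \<le> d"
      using U(3) dU(2) d by (simp add: measure_def enn2real_leI)
    finally show ?thesis using e by (simp add: d_def mult_left_mono)
  qed
  then have "plancherel_defect (\<lambda>x. indicator A x) \<le> 0" by (rule field_le_epsilon)
  then show ?thesis
    using plancherel_defect_nonneg[OF integrable_indicator_complex[OF A] ind(1)] by simp
qed

lemma plancherel_defect_simple:
  fixes g :: "real^'n \<Rightarrow> complex"
  assumes g: "simple_function lborel g" "integrable lborel g" "g \<in> L2"
  shows "plancherel_defect g = 0"
proof -
  have fin: "finite (range g)" using simple_functionD(1)[OF g(1)] by simp
  have sets: "g -` {y} \<in> sets lborel" for y using simple_functionD(2)[OF g(1), of "{y}"] by simp
  have eq: "g x = (\<Sum>y\<in>range g. y * indicator (g -` {y}) x)" for x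
    using fin by (subst sum.remove[of _ "g x"]) (auto intro!: sum.neutral simp: indicator_def)
  have level: "integrable lborel (\<lambda>x. y * indicator (g -` {y}) x) \<and> (\<lambda>x. y * indicator (g -` {y}) x) \<in> L2
      \<and> plancherel_defect (\<lambda>x. y * indicator (g -` {y}) x) = 0" for y
  \<comment> \<open>The zero level set may have infinite measure, but it enters with coefficient 0.
    For the other levels, integrability of \<open>g\<close> makes the measure finite.\<close>
  proof (cases "y = 0")
    case True then show ?thesis using plancherel_defect_scale[of 0 "\<lambda>_. 0"] by simp
  next
    case False
    have "integrable lborel (\<lambda>x. indicator (g -` {y}) x * g x)"
      by (intro integrable_mult_bounded[OF g(2), where B=1] borel_measurable_indicator sets)
         (simp add: indicator_def)
    also have "(\<lambda>x. indicator (g -` {y}) x * g x) = (\<lambda>x. indicator (g -` {y}) x * y)"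
      by (auto simp: indicator_def)
    finally have "integrable lborel (\<lambda>x. (indicator (g -` {y}) x * y) * inverse y)"
      by (rule integrable_mult_left)
    then have this1: "integrable lborel (\<lambda>x. indicator (g -` {y}) x :: complex)"
      using False by (simp add: mult.assoc)
    have cind: "(\<lambda>x. cmod (indicator S x)) = indicator S" for S :: "(real^'n) set"
      by (auto simp: indicator_def fun_eq_iff)
    from integrable_norm[OF this1] have "integrable lborel (\<lambda>x. indicator (g -` {y}) x :: real)"
      by (simp only: cind)
    then have "emeasure lborel (g -` {y}) < \<infinity>"
      using sets by (simp add: integrable_indicator_iff)
    with sets[of y] show ?thesis
      using plancherel_defect_scale[of y "\<lambda>x. indicator (g -` {y}) x"] plancherel_defect_indicator[of "g -` {y}"]
      by (auto intro!: L2_scale L2_indicator integrable_indicator_complex)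
  qed
  have "integrable lborel (\<lambda>x. \<Sum>y\<in>S. y * indicator (g -` {y}) x) \<and> (\<lambda>x. \<Sum>y\<in>S. y * indicator (g -` {y}) x) \<in> L2
      \<and> plancherel_defect (\<lambda>x. \<Sum>y\<in>S. y * indicator (g -` {y}) x) = 0" if "finite S" for S
    using that
  proof induction
    case empty
    then show ?case using plancherel_defect_scale[of 0 "\<lambda>_. 0"] by simp
  next
    case (insert y S)
    have "plancherel_defect (\<lambda>x. y * indicator (g -` {y}) x + (\<Sum>y\<in>S. y * indicator (g -` {y}) x)) \<le> 0"
      using plancherel_defect_add_le[of "\<lambda>x. y * indicator (g -` {y}) x" "\<lambda>x. \<Sum>y\<in>S. y * indicator (g -` {y}) x"]
        insert.IH level[of y] by simp
    moreover have "integrable lborel (\<lambda>x. y * indicator (g -` {y}) x + (\<Sum>y\<in>S. y * indicator (g -` {y}) x))"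
      "(\<lambda>x. y * indicator (g -` {y}) x + (\<Sum>y\<in>S. y * indicator (g -` {y}) x)) \<in> L2"
      using insert.IH level[of y] by (auto intro!: L2_add Bochner_Integration.integrable_add)
    ultimately show ?case
      unfolding sum.insert[OF insert.hyps] using plancherel_defect_nonneg order_antisym by blast
  qed
  from this[OF fin] show ?thesis unfolding eq[symmetric] by simp
qed

text \<open>Density: \<open>f\<close> is a simple function, which has zero defect, plus a remainder,
  so the defect of \<open>f\<close> is at most twice that of the remainder, which is controlled by
  its L2 norm.\<close>

theorem plancherel_integrable:
  fixes f :: "real^'n \<Rightarrow> complex"
  assumes f: "integrable lborel f" "f \<in> L2"
  shows "(L2_norm (fourier_integral f))\<^sup>2 = (2 * pi) ^ CARD('n) * (L2_norm f)\<^sup>2"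
proof -
  let ?c = "(2 * pi) ^ CARD('n)"
  have [measurable]: "f \<in> borel_measurable lborel" using f by auto
  from borel_measurable_implies_sequence_metric[OF this, of 0] obtain s where
    s: "\<And>i. simple_function lborel (s i)" and lim: "\<And>x. (\<lambda>i. s i x) \<longlonglongrightarrow> f x"
    and bd': "\<And>i x. dist (s i x) 0 \<le> 2 * dist (f x) 0"
    unfolding space_lborel space_borel by blast
  have bd: "cmod (s i x) \<le> 2 * cmod (f x)" for i x
    using bd'[of i x] by simp
  have [measurable]: "s i \<in> borel_measurable lborel" for i
    using s by (rule borel_measurable_simple_function)
  have si: "integrable lborel (s i)" for i
    by (rule Bochner_Integration.integrable_bound[of lborel "\<lambda>x. 2 * f x"]) (use f bd in \<open>auto simp: norm_mult\<close>)
  have s2: "s i \<in> L2" for i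
    by (rule L2_bound[OF L2_scale[OF f(2), of 2]]) (auto simp: norm_mult intro: bd)
  have "(\<lambda>i. \<integral>x. (cmod (f x - s i x))\<^sup>2 \<partial>lborel) \<longlonglongrightarrow> (\<integral>x. 0 \<partial>(lborel :: (real^'n) measure))"
  proof (rule integral_dominated_convergence[where w="\<lambda>x. 9 * (cmod (f x))\<^sup>2"])
    show "AE x in lborel. (\<lambda>i. (cmod (f x - s i x))\<^sup>2) \<longlonglongrightarrow> 0"
    proof (rule AE_I2)
      fix x have "(\<lambda>i. (cmod (f x - s i x))\<^sup>2) \<longlonglongrightarrow> (cmod (f x - f x))\<^sup>2"
        by (intro tendsto_intros lim)
      then show "(\<lambda>i. (cmod (f x - s i x))\<^sup>2) \<longlonglongrightarrow> 0" by simp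
    qed
    show "AE x in lborel. norm ((cmod (f x - s i x))\<^sup>2) \<le> 9 * (cmod (f x))\<^sup>2" for i
    proof (rule AE_I2)
      fix x
      \<comment> \<open>The simple functions satisfy |s i| \<le> 2 |f|; the square of the resulting
        factor 3 is the 9 in the dominating function.\<close>
      have "cmod (f x - s i x) \<le> 3 * cmod (f x)"
        using norm_triangle_ineq4[of "f x" "s i x"] bd[of i x] by (simp add: norm_mult)
      then have "(cmod (f x - s i x))\<^sup>2 \<le> (3 * cmod (f x))\<^sup>2" by (intro power_mono) auto
      then show "norm ((cmod (f x - s i x))\<^sup>2) \<le> 9 * (cmod (f x))\<^sup>2" by (simp add: power_mult_distrib)
    qed
  qed (use L2_integrable[OF f(2)] in auto)
  then have L: "(\<lambda>i. 2 * (?c * (L2_norm (\<lambda>x. f x - s i x))\<^sup>2)) \<longlonglongrightarrow> 2 * (?c * 0)"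
    unfolding L2_norm_power2 by (intro tendsto_intros) simp
  have M: "plancherel_defect f \<le> 2 * (?c * (L2_norm (\<lambda>x. f x - s i x))\<^sup>2)" for i
  proof -
    have "plancherel_defect (\<lambda>x. s i x + (f x - s i x)) \<le> 2 * plancherel_defect (s i) + 2 * plancherel_defect (\<lambda>x. f x - s i x)"
      using f si s2 by (intro plancherel_defect_add_le L2_diff) auto
    with plancherel_defect_simple[OF s si s2] plancherel_defect_le[of "\<lambda>x. f x - s i x"]
    show ?thesis by simp
  qed
  have "plancherel_defect f \<le> 2 * (?c * 0)"
    by (rule LIMSEQ_le_const[OF L]) (use M in blast)
  then show ?thesis using plancherel_defect_nonneg[OF f] by (simp add: plancherel_defect_def)
qed

section \<open>The Fourier transform on \<open>L\<^sup>2\<close>\<close>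

lemma plancherel_integrable_norm:
  fixes f :: "real^'n \<Rightarrow> complex"
  assumes "integrable lborel f" "f \<in> L2"
  shows "L2_norm (fourier_integral f) = sqrt ((2 * pi) ^ CARD('n)) * L2_norm f"
proof -
  have "sqrt ((L2_norm (fourier_integral f))\<^sup>2) = sqrt ((2 * pi) ^ CARD('n) * (L2_norm f)\<^sup>2)"
    using plancherel_integrable[OF assms] by simp
  then show ?thesis by (simp add: real_sqrt_mult)
qed

lemma fourier_extension_L2: "fourier_extension f g \<Longrightarrow> f \<in> L2" "fourier_extension f g \<Longrightarrow> g \<in> L2"
  by (auto simp: fourier_extension_def)

lemma fourier_extension_fourier_integral:
  assumes "integrable lborel f" "f \<in> L2" shows "fourier_extension f (fourier_integral f)"
  unfolding fourier_extension_def using assms fourier_integral_L2_bound(1)[OF assms]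
  by (intro conjI exI[of _ "\<lambda>k. f"]) (auto simp: L2_norm_def)

lemma L2_tendsto_add:
  assumes f: "\<And>k::nat. s k \<in> L2" "f \<in> L2" and g: "\<And>k. r k \<in> L2" "g \<in> L2"
    and lim: "(\<lambda>k. L2_norm (\<lambda>x. s k x - f x)) \<longlonglongrightarrow> 0" "(\<lambda>k. L2_norm (\<lambda>x. r k x - g x)) \<longlonglongrightarrow> 0"
  shows "(\<lambda>k. L2_norm (\<lambda>x. (s k x + r k x) - (f x + g x))) \<longlonglongrightarrow> 0"
proof (rule tendsto_sandwich[OF _ _ tendsto_const])
  show "\<forall>\<^sub>F k in sequentially. 0 \<le> L2_norm (\<lambda>x. (s k x + r k x) - (f x + g x))" by simp
  show "(\<lambda>k. L2_norm (\<lambda>x. s k x - f x) + L2_norm (\<lambda>x. r k x - g x)) \<longlonglongrightarrow> 0"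
    using tendsto_add[OF lim] by simp
  show "\<forall>\<^sub>F k in sequentially. L2_norm (\<lambda>x. (s k x + r k x) - (f x + g x))
      \<le> L2_norm (\<lambda>x. s k x - f x) + L2_norm (\<lambda>x. r k x - g x)"
  proof (rule always_eventually, rule allI)
    fix k
    have "(\<lambda>x. (s k x + r k x) - (f x + g x)) = (\<lambda>x. (s k x - f x) + (r k x - g x))" by auto
    then show "L2_norm (\<lambda>x. (s k x + r k x) - (f x + g x))
      \<le> L2_norm (\<lambda>x. s k x - f x) + L2_norm (\<lambda>x. r k x - g x)"
      using L2_norm_triangle[OF L2_diff[OF f(1)[of k] f(2)] L2_diff[OF g(1)[of k] g(2)]] by simp
  qed
qed

lemma fourier_extension_add:
  assumes "fourier_extension f g" "fourier_extension f' g'"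
  shows "fourier_extension (\<lambda>x. f x + f' x) (\<lambda>x. g x + g' x)"
proof -
  from assms obtain s s' where
    s: "\<And>k. s k \<in> L2" "\<And>k. integrable lborel (s k)" "\<And>k. fourier_integral (s k) \<in> L2"
      "(\<lambda>k. L2_norm (\<lambda>x. s k x - f x)) \<longlonglongrightarrow> 0" "(\<lambda>k. L2_norm (\<lambda>\<xi>. fourier_integral (s k) \<xi> - g \<xi>)) \<longlonglongrightarrow> 0"
    and s': "\<And>k. s' k \<in> L2" "\<And>k. integrable lborel (s' k)" "\<And>k. fourier_integral (s' k) \<in> L2"
      "(\<lambda>k. L2_norm (\<lambda>x. s' k x - f' x)) \<longlonglongrightarrow> 0" "(\<lambda>k. L2_norm (\<lambda>\<xi>. fourier_integral (s' k) \<xi> - g' \<xi>)) \<longlonglongrightarrow> 0"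
    unfolding fourier_extension_def by blast
  note L = fourier_extension_L2[OF assms(1)] fourier_extension_L2[OF assms(2)]
  show ?thesis
    unfolding fourier_extension_def
  proof (intro conjI exI[of _ "\<lambda>k x. s k x + s' k x"] allI)
    show "(\<lambda>k. L2_norm (\<lambda>\<xi>. fourier_integral (\<lambda>x. s k x + s' k x) \<xi> - (g \<xi> + g' \<xi>))) \<longlonglongrightarrow> 0"
      unfolding fourier_integral_add[OF s(2) s'(2)]
      by (rule L2_tendsto_add[OF s(3) L(2) s'(3) L(4) s(5) s'(5)])
    show "fourier_integral (\<lambda>x. s k x + s' k x) \<in> L2" for k
      unfolding fourier_integral_add[OF s(2) s'(2)] by (intro L2_add s s')
  qed (use L s s' in \<open>auto intro!: L2_add L2_tendsto_add\<close>)
qed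

lemma fourier_extension_scale:
  assumes "fourier_extension f g"
  shows "fourier_extension (\<lambda>x. c * f x) (\<lambda>x. c * g x)"
proof -
  from assms obtain s where
    s: "\<And>k. s k \<in> L2" "\<And>k. integrable lborel (s k)" "\<And>k. fourier_integral (s k) \<in> L2"
      "(\<lambda>k. L2_norm (\<lambda>x. s k x - f x)) \<longlonglongrightarrow> 0" "(\<lambda>k. L2_norm (\<lambda>\<xi>. fourier_integral (s k) \<xi> - g \<xi>)) \<longlonglongrightarrow> 0"
    unfolding fourier_extension_def by blast
  note L = fourier_extension_L2[OF assms(1)]
  show ?thesis
    unfolding fourier_extension_def fourier_integral_scale
  proof (intro conjI exI[of _ "\<lambda>k x. c * s k x"] allI)
    show "(\<lambda>k. L2_norm (\<lambda>x. c * s k x - c * f x)) \<longlonglongrightarrow> 0"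
      using tendsto_mult_left[OF s(4), of "cmod c"]
      by (simp add: L2_norm_scale flip: right_diff_distrib)
    show "(\<lambda>k. L2_norm (\<lambda>\<xi>. fourier_integral (\<lambda>x. c * s k x) \<xi> - c * g \<xi>)) \<longlonglongrightarrow> 0"
      unfolding fourier_integral_scale using tendsto_mult_left[OF s(5), of "cmod c"]
      by (simp add: L2_norm_scale flip: right_diff_distrib)
  qed (use L s in \<open>auto intro!: L2_scale simp: fourier_integral_scale\<close>)
qed

lemma fourier_extension_norm:
  fixes f :: "real^'n \<Rightarrow> complex"
  assumes "fourier_extension f g"
  shows "L2_norm g = sqrt ((2 * pi) ^ CARD('n)) * L2_norm f"
proof -
  from assms obtain s where
    s: "\<And>k. s k \<in> L2" "\<And>k. integrable lborel (s k)" "\<And>k. fourier_integral (s k) \<in> L2"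
      "(\<lambda>k. L2_norm (\<lambda>x. s k x - f x)) \<longlonglongrightarrow> 0" "(\<lambda>k. L2_norm (\<lambda>\<xi>. fourier_integral (s k) \<xi> - g \<xi>)) \<longlonglongrightarrow> 0"
    unfolding fourier_extension_def by blast
  note L = fourier_extension_L2[OF assms(1)]
  have "(\<lambda>k. sqrt ((2 * pi) ^ CARD('n)) * L2_norm (s k)) \<longlonglongrightarrow> L2_norm g"
    using L2_norm_tendsto[OF s(3) L(2) s(5)] plancherel_integrable_norm[OF s(2) s(1)] by simp
  moreover have "(\<lambda>k. sqrt ((2 * pi) ^ CARD('n)) * L2_norm (s k)) \<longlonglongrightarrow> sqrt ((2 * pi) ^ CARD('n)) * L2_norm f"
    by (intro tendsto_intros L2_norm_tendsto[OF s(1) L(1) s(4)])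
  ultimately show ?thesis by (rule LIMSEQ_unique)
qed

text \<open>By linearity the difference is an extension pair, and its first entry has norm 0.
  Consequently the choice made in \<open>fourier\<close> is determined up to null sets.\<close>

lemma fourier_extension_unique:
  fixes f f' :: "real^'n \<Rightarrow> complex"
  assumes "fourier_extension f g" "fourier_extension f' g'" "AE x in lborel. f x = f' x"
  shows "AE \<xi> in lborel. g \<xi> = g' \<xi>"
proof -
  have ext: "fourier_extension (\<lambda>x. f x + (-1) * f' x) (\<lambda>x. g x + (-1) * g' x)"
    by (intro fourier_extension_add fourier_extension_scale assms)
  have "L2_norm (\<lambda>x. f x + (-1) * f' x) = 0"
    using assms(3) by (subst L2_norm_eq_0_iff[OF fourier_extension_L2(1)[OF ext]]) auto
  then have "L2_norm (\<lambda>x. g x + (-1) * g' x) = 0"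
    using fourier_extension_norm[OF ext] by simp
  then show ?thesis
    by (subst (asm) L2_norm_eq_0_iff[OF fourier_extension_L2(2)[OF ext]]) auto
qed

text \<open>Truncation to a ball: \<open>f\<close> times the indicator is a product of two L2
  functions, hence integrable.\<close>

lemma L2_approx_integrable:
  fixes f :: "real^'n \<Rightarrow> complex"
  assumes f: "f \<in> L2" and e: "0 < e"
  obtains g where "g \<in> L2" "integrable lborel g" "(L2_norm (\<lambda>x. f x - g x))\<^sup>2 \<le> e"
proof -
  have [measurable]: "f \<in> borel_measurable borel" using L2_measurable[OF f] by simp
  have [measurable]: "ball 0 (real m) \<in> sets (borel :: (real^'n) measure)" for m by simp
  define g where "g m x = indicator (ball 0 (real m)) x * f x" for m :: nat and x
  have bfin: "emeasure lborel (ball (0::real^'n) (real m)) < \<infinity>" for m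
    by (rule emeasure_bounded_finite) auto
  have "(\<lambda>m. \<integral>x. (cmod (f x - g m x))\<^sup>2 \<partial>lborel) \<longlonglongrightarrow> (\<integral>x. 0 \<partial>(lborel :: (real^'n) measure))"
  proof (rule integral_dominated_convergence[where w="\<lambda>x. (cmod (f x))\<^sup>2"])
    show "AE x in lborel. (\<lambda>m. (cmod (f x - g m x))\<^sup>2) \<longlonglongrightarrow> 0"
    proof (rule AE_I2)
      fix x :: "real^'n"
      obtain N :: nat where "norm x < real N" using reals_Archimedean2 by blast
      then have "\<forall>\<^sub>F m in sequentially. (cmod (f x - g m x))\<^sup>2 = 0"
        by (intro eventually_sequentiallyI[of N]) (auto simp: g_def)
      then show "(\<lambda>m. (cmod (f x - g m x))\<^sup>2) \<longlonglongrightarrow> 0" by (rule tendsto_eventually)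
    qed
    show "AE x in lborel. norm ((cmod (f x - g m x))\<^sup>2) \<le> (cmod (f x))\<^sup>2" for m
      by (intro AE_I2) (auto simp: g_def indicator_def)
    show "(\<lambda>x. (cmod (f x - g m x))\<^sup>2) \<in> borel_measurable lborel" for m
      unfolding g_def by measurable
  qed (use L2_integrable[OF f] in auto)
  then have "(\<lambda>m. \<integral>x. (cmod (f x - g m x))\<^sup>2 \<partial>lborel) \<longlonglongrightarrow> 0" by simp
  from order_tendstoD(2)[OF this e] obtain m where m: "(\<integral>x. (cmod (f x - g m x))\<^sup>2 \<partial>lborel) < e"
    by (auto simp: eventually_sequentially)
  show thesis
  proof (rule that[of "g m"])
    show "integrable lborel (g m)"
      unfolding g_def by (intro integrable_L2_mult L2_indicator f bfin) auto
    show "g m \<in> L2" unfolding g_def by (intro L2_indicator_mult f) auto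
  qed (use m in \<open>simp add: L2_norm_power2\<close>)
qed

text \<open>Plancherel on integrable functions carries the Cauchy property of the approximants over
  to their transforms. The approximation rate is prescribed so that \<open>L2_complete\<close>
  applies.\<close>

lemma fourier_extension_exists:
  fixes f :: "real^'n \<Rightarrow> complex"
  assumes f: "f \<in> L2"
  shows "\<exists>g. fourier_extension f g"
proof -
  let ?c = "(2 * pi) ^ CARD('n)"
  have "\<exists>g. g \<in> L2 \<and> integrable lborel g \<and> (L2_norm (\<lambda>x. f x - g x))\<^sup>2 \<le> 1 / 4 ^ k" for k :: nat
    using L2_approx_integrable[OF f, of "1 / 4 ^ k"] by (metis zero_less_divide_1_iff zero_less_numeral zero_less_power)
  then obtain s where s: "\<And>k. s k \<in> L2" "\<And>k. integrable lborel (s k)"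
    and bd: "\<And>k. (L2_norm (\<lambda>x. f x - s k x))\<^sup>2 \<le> 1 / 4 ^ k"
    by metis
  have bd': "L2_norm (\<lambda>x. s k x - f x) \<le> (1 / 2) ^ k" for k
  proof (rule power2_le_imp_le)
    show "(L2_norm (\<lambda>x. s k x - f x))\<^sup>2 \<le> ((1 / 2) ^ k)\<^sup>2"
      using bd[of k] by (subst L2_norm_minus_commute)
        (simp add: power_divide power_mult[symmetric] mult.commute[of k 2] power_mult)
  qed simp
  have F: "fourier_integral (s k) \<in> L2" for k by (intro fourier_integral_L2_bound s)
  \<comment> \<open>Two approximation errors add up to at most 2 * 2^(-k), whose square is 4 /
    4^k.\<close>
  have "(L2_norm (\<lambda>\<xi>. fourier_integral (s j) \<xi> - fourier_integral (s k) \<xi>))\<^sup>2 \<le> (4 * ?c) / 4 ^ k"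
    if "k \<le> j" for j k
  proof -
    have eq: "(L2_norm (\<lambda>\<xi>. fourier_integral (s j) \<xi> - fourier_integral (s k) \<xi>))\<^sup>2
       = ?c * (L2_norm (\<lambda>x. s j x - s k x))\<^sup>2"
      unfolding fourier_integral_diff[OF s(2) s(2), symmetric]
      by (rule plancherel_integrable) (intro Bochner_Integration.integrable_diff L2_diff s)+
    have "L2_norm (\<lambda>x. s j x - s k x) \<le> (1/2) ^ j + (1/2) ^ k"
      using L2_norm_diff_triangle[OF s(1)[of j] f s(1)[of k]] bd'[of j] bd'[of k]
      by (simp add: L2_norm_minus_commute[of f "s k"])
    also have "\<dots> \<le> 2 * (1/2) ^ k"
      using power_decreasing[OF that, of "1/2 :: real"] by simp
    finally have "L2_norm (\<lambda>x. s j x - s k x) \<le> 2 * (1/2) ^ k" .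
    then have "(L2_norm (\<lambda>x. s j x - s k x))\<^sup>2 \<le> (2 * (1/2) ^ k)\<^sup>2"
      by (rule power_mono) simp
    then have "?c * (L2_norm (\<lambda>x. s j x - s k x))\<^sup>2 \<le> ?c * (2 * (1/2) ^ k)\<^sup>2"
      by (rule mult_left_mono) simp
    also have "(2 * (1/2 :: real) ^ k)\<^sup>2 = 4 / 4 ^ k"
      by (simp add: power_mult_distrib power_divide power_mult[symmetric] mult.commute[of k 2] power_mult)
    finally show ?thesis unfolding eq by (simp add: mult.commute)
  qed
  from L2_complete[OF F this] obtain g where g: "g \<in> L2"
    "(\<lambda>k. L2_norm (\<lambda>\<xi>. fourier_integral (s k) \<xi> - g \<xi>)) \<longlonglongrightarrow> 0" by auto
  have "(\<lambda>k. L2_norm (\<lambda>x. s k x - f x)) \<longlonglongrightarrow> 0"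
    by (rule tendsto_sandwich[OF _ _ tendsto_const LIMSEQ_realpow_zero[of "1/2"]])
       (auto intro!: always_eventually bd')
  then show ?thesis
    unfolding fourier_extension_def using f g s F by blast
qed

text \<open>Reconciles the two branches of \<open>fourier\<close>: on L2 both the integral and the
  chosen extension satisfy the same relation, so later arguments need no case distinction.\<close>

lemma fourier_extension_fourier:
  assumes "f \<in> L2" shows "fourier_extension f (fourier f)"
proof (cases "integrable lborel f")
  case True then show ?thesis
    using fourier_extension_fourier_integral[OF True assms] by (simp add: fourier_def)
next
  case False then show ?thesis
    using someI_ex[OF fourier_extension_exists[OF assms]] by (simp add: fourier_def)
qed

lemma fourier_L2: "f \<in> L2 \<Longrightarrow> fourier f \<in> L2"
  using fourier_extension_L2(2) fourier_extension_fourier by blast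

theorem plancherel:
  fixes f :: "real^'n \<Rightarrow> complex"
  shows "f \<in> L2 \<Longrightarrow> L2_norm (fourier f) = sqrt ((2 * pi) ^ CARD('n)) * L2_norm f"
  by (intro fourier_extension_norm fourier_extension_fourier)

lemma fourier_add:
  assumes "f \<in> L2" "g \<in> L2"
  shows "AE \<xi> in lborel. fourier (\<lambda>x. f x + g x) \<xi> = fourier f \<xi> + fourier g \<xi>"
  by (rule fourier_extension_unique[OF fourier_extension_fourier[OF L2_add[OF assms]]
      fourier_extension_add[OF assms[THEN fourier_extension_fourier]]]) simp

lemma fourier_scale:
  assumes "f \<in> L2"
  shows "AE \<xi> in lborel. fourier (\<lambda>x. c * f x) \<xi> = c * fourier f \<xi>"
  by (rule fourier_extension_unique[OF fourier_extension_fourier[OF L2_scale[OF assms]]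
      fourier_extension_scale[OF assms[THEN fourier_extension_fourier]]]) simp

lemma fourier_diff:
  assumes "f \<in> L2" "g \<in> L2"
  shows "AE \<xi> in lborel. fourier (\<lambda>x. f x - g x) \<xi> = fourier f \<xi> - fourier g \<xi>"
  using fourier_add[OF assms(1) L2_scale[OF assms(2), of "-1"]] fourier_scale[OF assms(2), of "-1"]
  by eventually_elim simp

lemma fourier_cong_AE:
  assumes "f \<in> L2" "g \<in> L2" "AE x in lborel. f x = g x"
  shows "AE \<xi> in lborel. fourier f \<xi> = fourier g \<xi>"
  by (rule fourier_extension_unique[OF assms(1,2)[THEN fourier_extension_fourier] assms(3)])

lemma L2_eq_AE_if_fourier_eq:
  fixes f g :: "real^'n \<Rightarrow> complex"
  assumes "f \<in> L2" "g \<in> L2" "AE \<xi> in lborel. fourier f \<xi> = fourier g \<xi>"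
  shows "AE x in lborel. f x = g x"
proof -
  have "AE \<xi> in lborel. fourier (\<lambda>x. f x - g x) \<xi> = 0"
    using fourier_diff[OF assms(1,2)] assms(3) by eventually_elim simp
  then have "L2_norm (fourier (\<lambda>x. f x - g x)) = 0"
    using fourier_L2[OF L2_diff[OF assms(1,2)]] by (simp add: L2_norm_eq_0_iff)
  then have "L2_norm (\<lambda>x. f x - g x) = 0"
    using plancherel[OF L2_diff[OF assms(1,2)]] by simp
  then show ?thesis
    using L2_diff[OF assms(1,2)] by (simp add: L2_norm_eq_0_iff)
qed

section \<open>Multiplication formula and surjectivity on L2\<close>

lemma fourier_multiplication:
  fixes f h :: "real^'n \<Rightarrow> complex"
  assumes f: "f \<in> L2" and h: "h \<in> L2"
  shows "(\<integral>\<xi>. fourier f \<xi> * h \<xi> \<partial>lborel) = (\<integral>x. f x * fourier h x \<partial>lborel)"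
proof -
  from fourier_extension_fourier[OF f] fourier_extension_fourier[OF h] obtain s r where
    s: "\<And>k. s k \<in> L2" "\<And>k. integrable lborel (s k)" "\<And>k. fourier_integral (s k) \<in> L2"
      "(\<lambda>k. L2_norm (\<lambda>x. s k x - f x)) \<longlonglongrightarrow> 0" "(\<lambda>k. L2_norm (\<lambda>\<xi>. fourier_integral (s k) \<xi> - fourier f \<xi>)) \<longlonglongrightarrow> 0"
    and r: "\<And>k. r k \<in> L2" "\<And>k. integrable lborel (r k)" "\<And>k. fourier_integral (r k) \<in> L2"
      "(\<lambda>k. L2_norm (\<lambda>x. r k x - h x)) \<longlonglongrightarrow> 0" "(\<lambda>k. L2_norm (\<lambda>\<xi>. fourier_integral (r k) \<xi> - fourier h \<xi>)) \<longlonglongrightarrow> 0"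
    unfolding fourier_extension_def by blast
  have "(\<lambda>k. \<integral>\<xi>. fourier_integral (s k) \<xi> * r k \<xi> \<partial>lborel) \<longlonglongrightarrow> (\<integral>\<xi>. fourier f \<xi> * h \<xi> \<partial>lborel)"
    by (intro L2_pairing_tendsto s r f h fourier_L2)
  moreover have "(\<lambda>k. \<integral>x. s k x * fourier_integral (r k) x \<partial>lborel) \<longlonglongrightarrow> (\<integral>x. f x * fourier h x \<partial>lborel)"
    by (intro L2_pairing_tendsto s r f h fourier_L2)
  ultimately show ?thesis
    using fourier_integral_multiplication[OF s(2) r(2)] LIMSEQ_unique by simp
qed

lemma L2_norm_diff_expand:
  assumes "f \<in> L2" "g \<in> L2"
  shows "(L2_norm (\<lambda>x. f x - g x))\<^sup>2
    = (L2_norm f)\<^sup>2 - 2 * Re (\<integral>x. f x * cnj (g x) \<partial>lborel) + (L2_norm g)\<^sup>2"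
proof -
  have int: "integrable lborel (\<lambda>x. f x * cnj (g x))" by (intro integrable_L2_mult assms L2_cnj)
  have "(cmod (f x - g x))\<^sup>2 = (cmod (f x))\<^sup>2 - 2 * Re (f x * cnj (g x)) + (cmod (g x))\<^sup>2" for x
    unfolding cmod_power2 by (simp add: power2_eq_square algebra_simps)
  then show ?thesis
    unfolding L2_norm_power2 using assms[THEN L2_integrable] int integral_Re[OF int]
    by (simp del: times_complex.sel)
qed

text \<open>Up to a constant, the inverse of the isometry \<open>fourier\<close> is its adjoint
  \<open>g \<mapsto> cnj (fourier (cnj g))\<close>.\<close>

theorem fourier_surj:
  fixes g :: "real^'n \<Rightarrow> complex"
  assumes g: "g \<in> L2"
  shows "\<exists>f. f \<in> L2 \<and> (AE \<xi> in lborel. fourier f \<xi> = g \<xi>)"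
proof -
  define c :: real where "c = (2 * pi) ^ CARD('n)"
  have c: "0 < c" by (simp add: c_def)
  define h where "h x = cnj (fourier (\<lambda>x. cnj (g x)) x)" for x
  have h: "h \<in> L2" unfolding h_def by (intro L2_cnj fourier_L2 g)
  have nh: "(L2_norm h)\<^sup>2 = c * (L2_norm g)\<^sup>2"
    unfolding h_def using plancherel[OF L2_cnj[OF g]] c by (simp add: power_mult_distrib c_def)
  have nF: "(L2_norm (fourier h))\<^sup>2 = c * (c * (L2_norm g)\<^sup>2)"
    using plancherel[OF h] c nh by (simp add: power_mult_distrib c_def)
  have "(\<integral>\<xi>. fourier h \<xi> * cnj (of_real c * g \<xi>) \<partial>lborel) = of_real c * (\<integral>\<xi>. fourier h \<xi> * cnj (g \<xi>) \<partial>lborel)"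
    by (subst integral_mult_right_zero[symmetric]) (simp add: mult_ac)
  \<comment> \<open>The formula moves the transform onto the conjugate of \<open>g\<close>, and the
    transform of that conjugate is the conjugate of \<open>h\<close> by construction.\<close>
  also have "(\<integral>\<xi>. fourier h \<xi> * cnj (g \<xi>) \<partial>lborel) = (\<integral>x. h x * cnj (h x) \<partial>lborel)"
    unfolding fourier_multiplication[OF h L2_cnj[OF g]] by (simp add: h_def)
  also have "\<dots> = (\<integral>x. complex_of_real ((cmod (h x))\<^sup>2) \<partial>lborel)"
    using complex_norm_square[of "h _"] by simp
  also have "\<dots> = of_real ((L2_norm h)\<^sup>2)"
    unfolding L2_norm_power2 by (rule integral_complex_of_real)
  finally have ip: "Re (\<integral>\<xi>. fourier h \<xi> * cnj (of_real c * g \<xi>) \<partial>lborel) = c * (c * (L2_norm g)\<^sup>2)"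
    by (simp add: nh)
  \<comment> \<open>The three terms of the expanded square are 1, -2 and 1 times c^2 times the
    squared norm of \<open>g\<close>.\<close>
  have "(L2_norm (\<lambda>\<xi>. fourier h \<xi> - of_real c * g \<xi>))\<^sup>2 = 0"
    unfolding L2_norm_diff_expand[OF fourier_L2[OF h] L2_scale[OF g]] ip nF L2_norm_scale
    using c by (simp add: power2_eq_square)
  then have "AE \<xi> in lborel. fourier h \<xi> - of_real c * g \<xi> = 0"
    by (subst (asm) zero_eq_power2, subst (asm) L2_norm_eq_0_iff) (auto intro!: L2_diff L2_scale fourier_L2 g h)
  with fourier_scale[OF h, of "of_real (1 / c)"]
  have "AE \<xi> in lborel. fourier (\<lambda>x. of_real (1 / c) * h x) \<xi> = g \<xi>"
    by eventually_elim (use c in simp)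
  with L2_scale[OF h] show ?thesis by blast
qed

lemma inv_fourier:
  assumes "g \<in> L2"
  shows "inv_fourier g \<in> L2" "AE \<xi> in lborel. fourier (inv_fourier g) \<xi> = g \<xi>"
  using someI_ex[OF fourier_surj[OF assms]] by (auto simp: inv_fourier_def)

section \<open>Fourier multipliers\<close>

lemma log_symbol_nonneg [simp]: "0 \<le> log_symbol \<xi>"
  by (simp add: log_symbol_def)

lemma log_symbol_measurable [measurable]: "log_symbol \<in> borel_measurable borel"
  unfolding log_symbol_def by measurable

lemma op_L:
  assumes "f \<in> dom_L"
  shows "op_L f \<in> L2" "AE \<xi> in lborel. fourier (op_L f) \<xi> = complex_of_real (log_symbol \<xi>) * fourier f \<xi>"
  using assms inv_fourier unfolding op_L_def dom_L_def by blast+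

text \<open>The multiplier 1 / (1 + \<mu>) provides a preimage, which shows that the choice in
  \<open>inv_I_plus_L\<close> is not vacuous. The chosen element need not be this preimage, but
  transforming the equation that it satisfies determines its transform.\<close>

lemma inv_I_plus_L:
  fixes f :: "real^'n \<Rightarrow> complex"
  assumes f: "f \<in> L2"
  shows "inv_I_plus_L f \<in> L2"
    and "AE \<xi> in lborel. (1 + complex_of_real (log_symbol \<xi>)) * fourier (inv_I_plus_L f) \<xi> = fourier f \<xi>"
proof -
  have nz: "1 + complex_of_real (log_symbol \<xi>) \<noteq> 0" for \<xi> :: "real^'n"
  proof -
    have "complex_of_real (1 + log_symbol \<xi>) \<noteq> 0"
      unfolding of_real_eq_0_iff using log_symbol_nonneg[of \<xi>] by linarith
    then show ?thesis by simp
  qed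
  have F: "fourier f \<in> L2" by (rule fourier_L2[OF f])
  define m where "m \<xi> = complex_of_real (inverse (1 + log_symbol \<xi>))" for \<xi> :: "real^'n"
  have [measurable]: "m \<in> borel_measurable borel" unfolding m_def by measurable
  \<comment> \<open>The second bound places the preimage in the domain of L.\<close>
  have m1: "cmod (m \<xi>) \<le> 1" "cmod (complex_of_real (log_symbol \<xi>) * m \<xi>) \<le> 1" for \<xi>
  proof -
    have "0 < 1 + log_symbol \<xi>" using log_symbol_nonneg[of \<xi>] by linarith
    then show "cmod (m \<xi>) \<le> 1" "cmod (complex_of_real (log_symbol \<xi>) * m \<xi>) \<le> 1"
      unfolding m_def norm_mult norm_of_real by (simp_all add: field_simps)
  qed
  define g where "g = inv_fourier (\<lambda>\<xi>. m \<xi> * fourier f \<xi>)"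
  have gL: "(\<lambda>\<xi>. m \<xi> * fourier f \<xi>) \<in> L2" by (intro L2_mult_bounded[OF F, where B=1] m1) simp
  have gL': "(\<lambda>\<xi>. (complex_of_real (log_symbol \<xi>) * m \<xi>) * fourier f \<xi>) \<in> L2"
    by (intro L2_mult_bounded[OF F, where B=1] m1) simp
  note g = inv_fourier[OF gL, folded g_def]
  have "(\<lambda>\<xi>. complex_of_real (log_symbol \<xi>) * fourier g \<xi>) \<in> L2"
    using g L2_measurable[OF fourier_L2[OF g(1)]] by (intro L2_cong_AE[OF gL']) auto
  then have dom: "g \<in> dom_L" using g(1) by (simp add: dom_L_def)
  have sum: "AE \<xi> in lborel. fourier (\<lambda>x. k x + op_L k x) \<xi> = (1 + complex_of_real (log_symbol \<xi>)) * fourier k \<xi>"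
    if "k \<in> dom_L" for k :: "real^'n \<Rightarrow> complex"
  proof -
    have "k \<in> L2" using that by (simp add: dom_L_def)
    from fourier_add[OF this op_L(1)[OF that]] op_L(2)[OF that] show ?thesis
      by eventually_elim (simp add: algebra_simps)
  qed
  have "AE \<xi> in lborel. fourier (\<lambda>x. g x + op_L g x) \<xi> = fourier f \<xi>"
    using sum[OF dom] g(2) by eventually_elim (simp add: m_def nz)
  then have "AE x in lborel. g x + op_L g x = f x"
    by (rule L2_eq_AE_if_fourier_eq[OF L2_add[OF g(1) op_L(1)[OF dom]] f])
  then have "\<exists>g. g \<in> dom_L \<and> (AE x in lborel. g x + op_L g x = f x)" using dom by blast
  from someI_ex[OF this, folded inv_I_plus_L_def]
  have inv: "inv_I_plus_L f \<in> dom_L" "AE x in lborel. inv_I_plus_L f x + op_L (inv_I_plus_L f) x = f x"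
    by auto
  then show L: "inv_I_plus_L f \<in> L2" by (simp add: dom_L_def)
  show "AE \<xi> in lborel. (1 + complex_of_real (log_symbol \<xi>)) * fourier (inv_I_plus_L f) \<xi> = fourier f \<xi>"
    using sum[OF inv(1)] fourier_cong_AE[OF L2_add[OF L op_L(1)[OF inv(1)]] f inv(2)]
    by eventually_elim simp
qed

text \<open>Since \<mu>^2 \<le> (1 + \<mu>)^2. It ensures that \<open>op_L\<close> is applied to the
  solution only inside its domain, where its value is a genuine multiplier image.\<close>

lemma Y_2_subset_dom_L: "Y 2 \<subseteq> dom_L"
proof
  fix f :: "real^'n \<Rightarrow> complex" assume "f \<in> Y 2"
  then have f: "f \<in> L2" and int: "integrable lborel (\<lambda>\<xi>. (1 + log_symbol \<xi>) powr 2 * (cmod (fourier f \<xi>))\<^sup>2)"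
    by (auto simp: Y_def)
  note [measurable] = L2_measurable[OF fourier_L2[OF f]]
  have "integrable lborel (\<lambda>\<xi>. (cmod (complex_of_real (log_symbol \<xi>) * fourier f \<xi>))\<^sup>2)"
  proof (rule Bochner_Integration.integrable_bound[OF int])
    show "AE \<xi> in lborel. norm ((cmod (complex_of_real (log_symbol \<xi>) * fourier f \<xi>))\<^sup>2)
       \<le> norm ((1 + log_symbol \<xi>) powr 2 * (cmod (fourier f \<xi>))\<^sup>2)"
      by (intro AE_I2) (auto simp: norm_mult power_mult_distrib powr_numeral add_nonneg_pos
            intro!: mult_right_mono power_mono)
  qed simp
  then show "f \<in> dom_L" using f by (auto simp: dom_L_def intro!: L2I)
qed

text \<open>Carries time derivatives in L2 over to the Fourier side. Linearity of
  \<open>fourier\<close> holds only almost everywhere, so norms are compared rather than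
  functions.\<close>

lemma fourier_difference_quotient_norm:
  fixes f g h :: "real^'n \<Rightarrow> complex"
  assumes "f \<in> L2" "g \<in> L2" "h \<in> L2"
  shows "L2_norm (\<lambda>\<xi>. (fourier f \<xi> - fourier g \<xi>) / c - fourier h \<xi>)
    = sqrt ((2 * pi) ^ CARD('n)) * L2_norm (\<lambda>x. (f x - g x) / c - h x)"
proof -
  note fg = L2_diff[OF assms(1,2)]
  have q: "(\<lambda>x. (f x - g x) / c) \<in> L2"
    using L2_scale[OF fg, of "1 / c"] by simp
  have F: "(\<lambda>\<xi>. (fourier f \<xi> - fourier g \<xi>) / c) \<in> L2"
    using L2_scale[OF L2_diff[OF fourier_L2[OF assms(1)] fourier_L2[OF assms(2)]], of "1 / c"] by simp
  have "AE \<xi> in lborel. (fourier f \<xi> - fourier g \<xi>) / c - fourier h \<xi> = fourier (\<lambda>x. (f x - g x) / c - h x) \<xi>"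
    using fourier_diff[OF q assms(3)] fourier_scale[OF fg, of "1 / c"] fourier_diff[OF assms(1,2)]
    by eventually_elim simp
  then have "L2_norm (\<lambda>\<xi>. (fourier f \<xi> - fourier g \<xi>) / c - fourier h \<xi>) = L2_norm (fourier (\<lambda>x. (f x - g x) / c - h x))"
    by (intro L2_norm_cong_AE L2_measurable) (auto intro!: L2_diff F fourier_L2 q assms)
  then show ?thesis using plancherel[OF L2_diff[OF q assms(3)]] by simp
qed

section \<open>The differential equation on the Fourier side\<close>

text \<open>The mean value inequality on the convex half-plane Re z \<le> M, where the derivative of
  exp has modulus at most exp M.\<close>

lemma norm_exp_diff_le:
  assumes "Re z \<le> M" "Re w \<le> M"
  shows "cmod (exp z - exp w) \<le> exp M * cmod (z - w)"
proof (rule field_differentiable_bound[where S="{z. Re z \<le> M}" and f'=exp])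
  show "convex {z. Re z \<le> M}" by (rule convex_halfspace_Re_le)
  show "(exp has_field_derivative exp x) (at x within {z. Re z \<le> M})" for x :: complex
    by (rule DERIV_subset[OF DERIV_exp]) simp
qed (use assms in \<open>auto simp: norm_exp_eq_Re\<close>)

lemma L2_dominated_tendsto:
  fixes F :: "nat \<Rightarrow> real^'n \<Rightarrow> complex"
  assumes E: "E \<in> sets borel" "emeasure lborel E < \<infinity>"
    and meas: "\<And>k. F k \<in> borel_measurable borel"
    and bd: "\<And>k \<xi>. cmod (F k \<xi>) \<le> B * indicator E \<xi>"
    and lim: "\<And>\<xi>. (\<lambda>k. F k \<xi>) \<longlonglongrightarrow> f \<xi>"
  shows "F k \<in> L2" "f \<in> L2" "(\<lambda>k. L2_norm (\<lambda>\<xi>. F k \<xi> - f \<xi>)) \<longlonglongrightarrow> 0"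
proof -
  note [measurable] = meas
  have [measurable]: "f \<in> borel_measurable borel"
    by (rule borel_measurable_LIMSEQ_metric[OF meas lim])
  have bd': "cmod (f \<xi>) \<le> B * indicator E \<xi>" for \<xi>
    using bd by (intro LIMSEQ_le_const2[OF tendsto_norm[OF lim]]) auto
  have int: "integrable lborel (\<lambda>\<xi>. 4 * B\<^sup>2 * indicator E \<xi>)" using E by simp
  have B: "(B * indicator E \<xi>)\<^sup>2 = B\<^sup>2 * indicator E \<xi>" for \<xi> :: "real^'n" by (simp add: indicator_def)
  have sq: "g \<in> L2" if [measurable]: "g \<in> borel_measurable borel" and g: "\<And>\<xi>. cmod (g \<xi>) \<le> B * indicator E \<xi>" for g
  proof (rule L2I)
    show "integrable lborel (\<lambda>x. (cmod (g x))\<^sup>2)"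
    proof (rule Bochner_Integration.integrable_bound[OF int])
      show "AE x in lborel. norm ((cmod (g x))\<^sup>2) \<le> norm (4 * B\<^sup>2 * indicator E x)"
      proof (rule AE_I2)
        fix x
        have "(cmod (g x))\<^sup>2 \<le> (B * indicator E x)\<^sup>2" by (intro power_mono g) simp
        also have "\<dots> \<le> 4 * B\<^sup>2 * indicator E x" unfolding B by (simp add: indicator_def)
        finally show "norm ((cmod (g x))\<^sup>2) \<le> norm (4 * B\<^sup>2 * indicator E x)" by simp
      qed
    qed simp
  qed simp
  show "F k \<in> L2" by (rule sq[OF meas bd])
  show "f \<in> L2" by (rule sq[OF _ bd']) simp
  have "(\<lambda>k. \<integral>\<xi>. (cmod (F k \<xi> - f \<xi>))\<^sup>2 \<partial>lborel) \<longlonglongrightarrow> (\<integral>\<xi>. 0 \<partial>(lborel :: (real^'n) measure))"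
  proof (rule integral_dominated_convergence[OF _ _ int])
    show "AE \<xi> in lborel. (\<lambda>k. (cmod (F k \<xi> - f \<xi>))\<^sup>2) \<longlonglongrightarrow> 0"
    proof (rule AE_I2)
      fix \<xi> have "(\<lambda>k. (cmod (F k \<xi> - f \<xi>))\<^sup>2) \<longlonglongrightarrow> (cmod (f \<xi> - f \<xi>))\<^sup>2"
        by (intro tendsto_intros lim)
      then show "(\<lambda>k. (cmod (F k \<xi> - f \<xi>))\<^sup>2) \<longlonglongrightarrow> 0" by simp
    qed
    show "AE \<xi> in lborel. norm ((cmod (F k \<xi> - f \<xi>))\<^sup>2) \<le> 4 * B\<^sup>2 * indicator E \<xi>" for k
    proof (rule AE_I2)
      fix \<xi>
      have "cmod (F k \<xi> - f \<xi>) \<le> 2 * (B * indicator E \<xi>)"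
        using norm_triangle_ineq4[of "F k \<xi>" "f \<xi>"] bd[of k \<xi>] bd'[of \<xi>] by linarith
      then have "(cmod (F k \<xi> - f \<xi>))\<^sup>2 \<le> (2 * (B * indicator E \<xi>))\<^sup>2" by (rule power_mono) simp
      then show "norm ((cmod (F k \<xi> - f \<xi>))\<^sup>2) \<le> 4 * B\<^sup>2 * indicator E \<xi>"
        by (cases "\<xi> \<in> E") (auto simp: power_mult_distrib)
    qed
  qed auto
  then have "(\<lambda>k. sqrt (\<integral>\<xi>. (cmod (F k \<xi> - f \<xi>))\<^sup>2 \<partial>lborel)) \<longlonglongrightarrow> sqrt 0"
    by (intro tendsto_real_sqrt) simp
  then show "(\<lambda>k. L2_norm (\<lambda>\<xi>. F k \<xi> - f \<xi>)) \<longlonglongrightarrow> 0" by (simp add: L2_norm_def)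
qed

text \<open>The product rule for the pairing of the integrating factor \<open>m\<close> with the
  mode \<open>q\<close>. The quotient of \<open>m\<close> converges by dominated convergence, that
  of \<open>q\<close> in L2 by hypothesis. Restricting to a set of finite measure with bounded roots
  puts \<open>m\<close> into L2; times run along a sequence because dominated convergence is
  sequential.\<close>

lemma mode_pairing_quotient_tendsto:
  fixes U V W :: "real \<Rightarrow> real^'n \<Rightarrow> complex" and r r' :: "real^'n \<Rightarrow> complex" and X :: "nat \<Rightarrow> real"
  assumes L2: "\<And>t. 0 \<le> t \<Longrightarrow> U t \<in> L2" "\<And>t. 0 \<le> t \<Longrightarrow> V t \<in> L2" "\<And>t. 0 \<le> t \<Longrightarrow> W t \<in> L2"
    and X: "\<And>k. 0 \<le> X k" "\<And>k. X k \<noteq> t" "X \<longlonglongrightarrow> t" and t: "0 \<le> t"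
    and dU: "(\<lambda>k. L2_norm (\<lambda>\<xi>. (U (X k) \<xi> - U t \<xi>) / of_real (X k - t) - V t \<xi>)) \<longlonglongrightarrow> 0"
    and dV: "(\<lambda>k. L2_norm (\<lambda>\<xi>. (V (X k) \<xi> - V t \<xi>) / of_real (X k - t) - W t \<xi>)) \<longlonglongrightarrow> 0"
    and r: "r \<in> borel_measurable borel" "r' \<in> borel_measurable borel"
      "\<And>\<xi>. \<xi> \<in> E \<Longrightarrow> cmod (r \<xi>) \<le> B" "\<And>\<xi>. \<xi> \<in> E \<Longrightarrow> cmod (r' \<xi>) \<le> B"
    and E: "E \<in> sets borel" "emeasure lborel E < \<infinity>" and B: "0 \<le> B"
  defines "q \<equiv> \<lambda>s \<xi>. indicator E \<xi> * (V s \<xi> - r' \<xi> * U s \<xi>)"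
    and "m \<equiv> \<lambda>s \<xi>. indicator E \<xi> * exp (- (r \<xi> * of_real s))"
  shows "(\<lambda>k. ((\<integral>\<xi>. m (X k) \<xi> * q (X k) \<xi> \<partial>lborel) - (\<integral>\<xi>. m t \<xi> * q t \<xi> \<partial>lborel)) / of_real (X k - t))
    \<longlonglongrightarrow> (\<integral>\<xi>. m t \<xi> * (indicator E \<xi> * (W t \<xi> - r' \<xi> * V t \<xi>) - r \<xi> * q t \<xi>) \<partial>lborel)"
proof -
  note [measurable] = r(1,2) E(1)
  have one: "(\<lambda>\<xi>. indicator E \<xi> :: complex) \<in> borel_measurable lborel" "cmod (indicator E \<xi>) \<le> 1" for \<xi>
    by (auto simp: indicator_def)
  have rr: "(\<lambda>\<xi>. indicator E \<xi> * r' \<xi>) \<in> borel_measurable lborel" "cmod (indicator E \<xi> * r' \<xi>) \<le> B" for \<xi>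
    using r(4) B by (auto simp: indicator_def)
  have qL: "(\<lambda>\<xi>. indicator E \<xi> * (g \<xi> - r' \<xi> * f \<xi>)) \<in> L2" if "f \<in> L2" "g \<in> L2" for f g
  proof -
    have "(\<lambda>\<xi>. indicator E \<xi> * (g \<xi> - r' \<xi> * f \<xi>)) = (\<lambda>\<xi>. indicator E \<xi> * g \<xi> - (indicator E \<xi> * r' \<xi>) * f \<xi>)"
      by (simp add: algebra_simps)
    then show ?thesis
      using L2_diff[OF L2_mult_bounded[OF that(2) one] L2_mult_bounded[OF that(1) rr]] by simp
  qed
  have q: "q s \<in> L2" if "0 \<le> s" for s unfolding q_def by (intro qL L2 that)
  have z: "(\<lambda>\<xi>. indicator E \<xi> * (W t \<xi> - r' \<xi> * V t \<xi>)) \<in> L2" by (intro qL L2 t)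
  \<comment> \<open>A common bound for all times involved makes the exponentials uniformly bounded
    on \<open>E\<close>.\<close>
  obtain T where T: "\<And>k. \<bar>X k\<bar> \<le> T" "\<bar>t\<bar> \<le> T"
  proof -
    have "bounded (range X)" using X(3) by (rule convergent_imp_bounded)
    then obtain C where "\<And>k. \<bar>X k\<bar> \<le> C" by (auto simp: bounded_iff)
    then show thesis by (intro that[of "max C \<bar>t\<bar>"]) (auto simp: max.coboundedI1)
  qed
  have Re_bd: "Re (- (r \<xi> * of_real s)) \<le> B * T" if "\<xi> \<in> E" "\<bar>s\<bar> \<le> T" for s \<xi>
  proof -
    have "Re (- (r \<xi> * of_real s)) \<le> cmod (r \<xi> * of_real s)"
      using complex_Re_le_cmod[of "- (r \<xi> * of_real s)"] by simp
    also have "\<dots> \<le> B * T" unfolding norm_mult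
      using that r(3)[OF that(1)] B by (intro mult_mono) auto
    finally show ?thesis .
  qed
  have m_lim: "(\<lambda>k. m (X k) \<xi>) \<longlonglongrightarrow> m t \<xi>" for \<xi>
    unfolding m_def by (intro tendsto_intros X)
  have m_bd: "cmod (m (X k) \<xi>) \<le> exp (B * T) * indicator E \<xi>" for k \<xi>
    using Re_bd[of \<xi> "X k"] T by (auto simp: m_def indicator_def norm_exp_eq_Re)
  have m_meas: "m s \<in> borel_measurable borel" for s unfolding m_def by measurable
  note mL = L2_dominated_tendsto[OF E m_meas m_bd m_lim]
  define N where "N k \<xi> = (m (X k) \<xi> - m t \<xi>) / of_real (X k - t)" for k \<xi>
  have N_meas: "N k \<in> borel_measurable borel" for k
    unfolding N_def using m_meas by measurable
  \<comment> \<open>The mean value bound contains the factor |X k - t|, which cancels the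
    denominator.\<close>
  have N_bd: "cmod (N k \<xi>) \<le> (exp (B * T) * B) * indicator E \<xi>" for k \<xi>
  proof (cases "\<xi> \<in> E")
    case True
    have "cmod (exp (- (r \<xi> * of_real (X k))) - exp (- (r \<xi> * of_real t)))
       \<le> exp (B * T) * cmod (- (r \<xi> * of_real (X k)) - - (r \<xi> * of_real t))"
      by (intro norm_exp_diff_le Re_bd True T)
    also have "- (r \<xi> * of_real (X k)) - - (r \<xi> * of_real t) = - (r \<xi> * of_real (X k - t))"
      by (simp add: algebra_simps)
    also have "cmod \<dots> = cmod (r \<xi>) * \<bar>X k - t\<bar>"
      by (simp only: norm_minus_cancel norm_mult norm_of_real)
    also have "exp (B * T) * (cmod (r \<xi>) * \<bar>X k - t\<bar>) \<le> exp (B * T) * (B * \<bar>X k - t\<bar>)"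
      using r(3)[OF True] by (intro mult_left_mono mult_right_mono) auto
    finally have "cmod (m (X k) \<xi> - m t \<xi>) \<le> (exp (B * T) * B) * \<bar>X k - t\<bar>"
      using True by (simp add: m_def mult.assoc)
    then show ?thesis
      using True X(2)[of k] unfolding N_def norm_divide norm_of_real by (simp add: divide_le_eq)
  qed (simp add: N_def m_def)
  \<comment> \<open>The derivative is taken in a complex time variable and then evaluated along the
    real times \<open>X k\<close>.\<close>
  have N_lim: "(\<lambda>k. N k \<xi>) \<longlonglongrightarrow> - (r \<xi> * m t \<xi>)" for \<xi>
  proof -
    have "((\<lambda>z. indicator E \<xi> * exp (- (r \<xi> * z))) has_field_derivative - (r \<xi> * m t \<xi>)) (at (of_real t))"
      unfolding m_def by (auto intro!: derivative_eq_intros)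
    then have "((\<lambda>z. (indicator E \<xi> * exp (- (r \<xi> * z)) - m t \<xi>) / (z - of_real t)) \<longlongrightarrow> - (r \<xi> * m t \<xi>)) (at (of_real t))"
      unfolding has_field_derivative_iff m_def .
    moreover have "(\<lambda>k. complex_of_real (X k)) \<longlonglongrightarrow> of_real t" by (intro tendsto_intros X)
    ultimately have "((\<lambda>z. (indicator E \<xi> * exp (- (r \<xi> * z)) - m t \<xi>) / (z - of_real t)) \<circ> (\<lambda>k. of_real (X k)))
        \<longlonglongrightarrow> - (r \<xi> * m t \<xi>)"
      using X(2) unfolding tendsto_at_iff_sequentially by (auto simp del: comp_apply)
    then show ?thesis by (simp add: o_def N_def m_def)
  qed
  note NL = L2_dominated_tendsto[OF E N_meas N_bd N_lim]
  define g where "g k \<xi> = (q (X k) \<xi> - q t \<xi>) / of_real (X k - t)" for k \<xi>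
  have gL: "g k \<in> L2" for k
    using L2_scale[OF L2_diff[OF q[OF X(1)] q[OF t]], of "1 / of_real (X k - t)"] by (simp add: g_def[abs_def])
  have g_lim: "(\<lambda>k. L2_norm (\<lambda>\<xi>. g k \<xi> - indicator E \<xi> * (W t \<xi> - r' \<xi> * V t \<xi>))) \<longlonglongrightarrow> 0"
  proof (rule tendsto_sandwich[OF _ _ tendsto_const])
    let ?dU = "\<lambda>k \<xi>. (U (X k) \<xi> - U t \<xi>) / of_real (X k - t) - V t \<xi>"
    let ?dV = "\<lambda>k \<xi>. (V (X k) \<xi> - V t \<xi>) / of_real (X k - t) - W t \<xi>"
    show "(\<lambda>k. 1 * L2_norm (?dV k) + B * L2_norm (?dU k)) \<longlonglongrightarrow> 0"
      using tendsto_add[OF tendsto_mult_left[OF dV, of 1] tendsto_mult_left[OF dU, of B]] by simp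
    have dUL: "?dU k \<in> L2" for k
      using L2_diff[OF L2_scale[OF L2_diff[OF L2(1)[OF X(1)] L2(1)[OF t]], of "1 / of_real (X k - t)"] L2(2)[OF t]] by simp
    have dVL: "?dV k \<in> L2" for k
      using L2_diff[OF L2_scale[OF L2_diff[OF L2(2)[OF X(1)] L2(2)[OF t]], of "1 / of_real (X k - t)"] L2(3)[OF t]] by simp
    show "\<forall>\<^sub>F k in sequentially. L2_norm (\<lambda>\<xi>. g k \<xi> - indicator E \<xi> * (W t \<xi> - r' \<xi> * V t \<xi>))
        \<le> 1 * L2_norm (?dV k) + B * L2_norm (?dU k)"
    proof (rule always_eventually, rule allI)
      fix k
      have eq: "(\<lambda>\<xi>. g k \<xi> - indicator E \<xi> * (W t \<xi> - r' \<xi> * V t \<xi>))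
        = (\<lambda>\<xi>. indicator E \<xi> * ?dV k \<xi> + (- (indicator E \<xi> * r' \<xi>)) * ?dU k \<xi>)"
        by (auto simp: g_def q_def fun_eq_iff divide_inverse algebra_simps)
      have "L2_norm (\<lambda>\<xi>. (- (indicator E \<xi> * r' \<xi>)) * ?dU k \<xi>) \<le> B * L2_norm (?dU k)"
        by (intro L2_norm_mult_bounded dUL) (use rr in auto)
      moreover have "L2_norm (\<lambda>\<xi>. indicator E \<xi> * ?dV k \<xi>) \<le> 1 * L2_norm (?dV k)"
        by (intro L2_norm_mult_bounded dVL one)
      moreover have "L2_norm (\<lambda>\<xi>. indicator E \<xi> * ?dV k \<xi> + (- (indicator E \<xi> * r' \<xi>)) * ?dU k \<xi>)
        \<le> L2_norm (\<lambda>\<xi>. indicator E \<xi> * ?dV k \<xi>) + L2_norm (\<lambda>\<xi>. (- (indicator E \<xi> * r' \<xi>)) * ?dU k \<xi>)"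
        by (intro L2_norm_triangle L2_mult_bounded[OF dUL, where B=B] L2_mult_bounded[OF dVL one]) (use rr in auto)
      ultimately show "L2_norm (\<lambda>\<xi>. g k \<xi> - indicator E \<xi> * (W t \<xi> - r' \<xi> * V t \<xi>))
        \<le> 1 * L2_norm (?dV k) + B * L2_norm (?dU k)"
        unfolding eq by linarith
    qed
  qed simp
  \<comment> \<open>The usual splitting: the change of \<open>q\<close> is paired with
    \<open>m\<close> at the new time, the change of \<open>m\<close> with \<open>q\<close> at the
    old time.\<close>
  have "(\<lambda>k. (\<integral>\<xi>. m (X k) \<xi> * g k \<xi> \<partial>lborel) + (\<integral>\<xi>. N k \<xi> * q t \<xi> \<partial>lborel))
    \<longlonglongrightarrow> (\<integral>\<xi>. m t \<xi> * (indicator E \<xi> * (W t \<xi> - r' \<xi> * V t \<xi>)) \<partial>lborel) + (\<integral>\<xi>. - (r \<xi> * m t \<xi>) * q t \<xi> \<partial>lborel)"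
    by (intro tendsto_add L2_pairing_tendsto mL gL g_lim NL z q t) (simp add: L2_norm_def)
  moreover have "(\<integral>\<xi>. m (X k) \<xi> * g k \<xi> \<partial>lborel) + (\<integral>\<xi>. N k \<xi> * q t \<xi> \<partial>lborel)
    = ((\<integral>\<xi>. m (X k) \<xi> * q (X k) \<xi> \<partial>lborel) - (\<integral>\<xi>. m t \<xi> * q t \<xi> \<partial>lborel)) / of_real (X k - t)" for k
  proof -
    have "(\<integral>\<xi>. m (X k) \<xi> * g k \<xi> \<partial>lborel) + (\<integral>\<xi>. N k \<xi> * q t \<xi> \<partial>lborel)
      = (\<integral>\<xi>. m (X k) \<xi> * g k \<xi> + N k \<xi> * q t \<xi> \<partial>lborel)"
      by (intro Bochner_Integration.integral_add[symmetric] integrable_L2_mult mL gL NL q t)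
    also have "\<dots> = (\<integral>\<xi>. (m (X k) \<xi> * q (X k) \<xi> - m t \<xi> * q t \<xi>) / of_real (X k - t) \<partial>lborel)"
      by (intro Bochner_Integration.integral_cong refl) (simp add: g_def N_def divide_inverse algebra_simps)
    also have "\<dots> = (\<integral>\<xi>. m (X k) \<xi> * q (X k) \<xi> - m t \<xi> * q t \<xi> \<partial>lborel) / of_real (X k - t)"
      by (rule integral_divide_zero)
    also have "(\<integral>\<xi>. m (X k) \<xi> * q (X k) \<xi> - m t \<xi> * q t \<xi> \<partial>lborel)
      = (\<integral>\<xi>. m (X k) \<xi> * q (X k) \<xi> \<partial>lborel) - (\<integral>\<xi>. m t \<xi> * q t \<xi> \<partial>lborel)"
      by (intro Bochner_Integration.integral_diff integrable_L2_mult mL q t X)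
    finally show ?thesis .
  qed
  moreover have "(\<integral>\<xi>. m t \<xi> * (indicator E \<xi> * (W t \<xi> - r' \<xi> * V t \<xi>)) \<partial>lborel) + (\<integral>\<xi>. - (r \<xi> * m t \<xi>) * q t \<xi> \<partial>lborel)
    = (\<integral>\<xi>. m t \<xi> * (indicator E \<xi> * (W t \<xi> - r' \<xi> * V t \<xi>) - r \<xi> * q t \<xi>) \<partial>lborel)"
  proof -
    have "(\<integral>\<xi>. m t \<xi> * (indicator E \<xi> * (W t \<xi> - r' \<xi> * V t \<xi>)) \<partial>lborel) + (\<integral>\<xi>. - (r \<xi> * m t \<xi>) * q t \<xi> \<partial>lborel)
      = (\<integral>\<xi>. m t \<xi> * (indicator E \<xi> * (W t \<xi> - r' \<xi> * V t \<xi>)) + (- (r \<xi> * m t \<xi>)) * q t \<xi> \<partial>lborel)"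
      by (intro Bochner_Integration.integral_add[symmetric] integrable_L2_mult mL NL z q t)
    then show ?thesis by (simp add: algebra_simps)
  qed
  ultimately show ?thesis by simp
qed


text \<open>Formally exp(-r t) (V - r' U) has zero time derivative at each frequency. Since only L2
  derivatives exist, the statement is tested: for every measurable subset A of a ball, the integral
  over A is a scalar function of time with zero derivative, hence constant. Letting A vary
  identifies the integrands almost everywhere. The exceptional null set may depend on t.\<close>

lemma mode_conserved:
  fixes U V W :: "real \<Rightarrow> real^'n \<Rightarrow> complex" and r r' :: "real^'n \<Rightarrow> complex"
  assumes L2: "\<And>t. 0 \<le> t \<Longrightarrow> U t \<in> L2" "\<And>t. 0 \<le> t \<Longrightarrow> V t \<in> L2" "\<And>t. 0 \<le> t \<Longrightarrow> W t \<in> L2"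
    and dU: "\<And>t. 0 \<le> t \<Longrightarrow> ((\<lambda>s. L2_norm (\<lambda>\<xi>. (U s \<xi> - U t \<xi>) / of_real (s - t) - V t \<xi>)) \<longlongrightarrow> 0) (at t within {0..})"
    and dV: "\<And>t. 0 \<le> t \<Longrightarrow> ((\<lambda>s. L2_norm (\<lambda>\<xi>. (V s \<xi> - V t \<xi>) / of_real (s - t) - W t \<xi>)) \<longlongrightarrow> 0) (at t within {0..})"
    and r: "r \<in> borel_measurable borel" "r' \<in> borel_measurable borel"
      "\<And>R. bounded (r ` ball 0 R)" "\<And>R. bounded (r' ` ball 0 R)"
    and eq: "\<And>t. 0 < t \<Longrightarrow> AE \<xi> in lborel. W t \<xi> - r' \<xi> * V t \<xi> = r \<xi> * (V t \<xi> - r' \<xi> * U t \<xi>)"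
    and t: "0 \<le> t"
  shows "AE \<xi> in lborel. V t \<xi> - r' \<xi> * U t \<xi> = exp (r \<xi> * of_real t) * (V 0 \<xi> - r' \<xi> * U 0 \<xi>)"
proof -
  note [measurable] = r(1,2)
  have "AE \<xi> in lborel. \<xi> \<in> ball 0 (real N) \<longrightarrow>
      exp (- (r \<xi> * of_real t)) * (V t \<xi> - r' \<xi> * U t \<xi>) = V 0 \<xi> - r' \<xi> * U 0 \<xi>" for N
  proof -
    let ?E = "ball 0 (real N) :: (real^'n) set"
    have [measurable]: "?E \<in> sets borel" by simp
    obtain B1 B2 where B12: "\<And>\<xi>. \<xi> \<in> ?E \<Longrightarrow> cmod (r \<xi>) \<le> B1" "\<And>\<xi>. \<xi> \<in> ?E \<Longrightarrow> cmod (r' \<xi>) \<le> B2"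
      using r(3)[of "real N"] r(4)[of "real N"] unfolding bounded_iff by blast
    \<comment> \<open>The maximum with 0 covers N = 0, where the ball is empty and the bounds
      obtained may be negative.\<close>
    define B where "B = max 0 (max B1 B2)"
    have B: "cmod (r \<xi>) \<le> B" "cmod (r' \<xi>) \<le> B" if "\<xi> \<in> ?E" for \<xi>
      using B12[OF that] by (auto simp: B_def)
    define q where "q A s \<xi> = indicator A \<xi> * (V s \<xi> - r' \<xi> * U s \<xi>)" for A s \<xi>
    define m where "m A s \<xi> = indicator A \<xi> * exp (- (r \<xi> * complex_of_real s))" for A s \<xi>
    define h where "h A s = (\<integral>\<xi>. m A s \<xi> * q A s \<xi> \<partial>lborel)" for A s
    define D where "D A s = (\<integral>\<xi>. m A s \<xi> * (indicator A \<xi> * (W s \<xi> - r' \<xi> * V s \<xi>) - r \<xi> * q A s \<xi>) \<partial>lborel)" for A s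
    have const: "h A t = h A 0" if A: "A \<in> sets borel" "A \<subseteq> ?E" for A
    proof -
      have Af: "emeasure lborel A < \<infinity>"
        using A(2) by (intro emeasure_bounded_finite bounded_subset[OF bounded_ball])
      have quot: "((\<lambda>y. (h A y - h A s) / of_real (y - s)) \<longlongrightarrow> D A s) (at s within {0..})" if s: "0 \<le> s" for s
        unfolding tendsto_at_iff_sequentially
      proof (intro allI impI)
        fix X :: "nat \<Rightarrow> real" assume X: "\<forall>i. X i \<in> {0..} - {s}" "X \<longlonglongrightarrow> s"
        have "(\<lambda>k. (h A (X k) - h A s) / of_real (X k - s)) \<longlonglongrightarrow> D A s"
          unfolding h_def m_def q_def D_def
        proof (rule mode_pairing_quotient_tendsto[where B=B, OF L2 _ _ X(2) s _ _ r(1,2) _ _ A(1) Af])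
          show "(\<lambda>k. L2_norm (\<lambda>\<xi>. (U (X k) \<xi> - U s \<xi>) / of_real (X k - s) - V s \<xi>)) \<longlonglongrightarrow> 0"
            using dU[OF s] X unfolding tendsto_at_iff_sequentially by (auto simp: o_def)
          show "(\<lambda>k. L2_norm (\<lambda>\<xi>. (V (X k) \<xi> - V s \<xi>) / of_real (X k - s) - W s \<xi>)) \<longlonglongrightarrow> 0"
            using dV[OF s] X unfolding tendsto_at_iff_sequentially by (auto simp: o_def)
        qed (use X A(2) B in \<open>auto simp: B_def\<close>)
        then show "((\<lambda>y. (h A y - h A s) / of_real (y - s)) \<circ> X) \<longlonglongrightarrow> D A s"
          by (simp add: o_def)
      qed
      have der: "(h A has_derivative (\<lambda>d. d *\<^sub>R D A s)) (at s within {0..})" if s: "0 \<le> s" for s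
        unfolding has_derivative_iff_norm
      proof
        show "bounded_linear (\<lambda>d. d *\<^sub>R D A s)" by (rule bounded_linear_scaleR_left)
        have "((\<lambda>y. norm ((h A y - h A s) / of_real (y - s) - D A s)) \<longlongrightarrow> 0) (at s within {0..})"
          using quot[OF s] by (simp add: LIM_zero_iff tendsto_norm_zero_iff)
        then show "((\<lambda>y. norm (h A y - h A s - (y - s) *\<^sub>R D A s) / norm (y - s)) \<longlongrightarrow> 0) (at s within {0..})"
        proof (rule Lim_transform_eventually)
          have "norm ((h A y - h A s) / of_real (y - s) - D A s) = norm (h A y - h A s - (y - s) *\<^sub>R D A s) / norm (y - s)"
            if "y \<noteq> s" for y
          proof -
            have "(h A y - h A s) / of_real (y - s) - D A s = (h A y - h A s - (y - s) *\<^sub>R D A s) / of_real (y - s)"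
              using that by (simp add: scaleR_conv_of_real field_simps)
            then show ?thesis by (simp only: norm_divide norm_of_real real_norm_def)
          qed
          then show "\<forall>\<^sub>F y in at s within {0..}. norm ((h A y - h A s) / of_real (y - s) - D A s)
              = norm (h A y - h A s - (y - s) *\<^sub>R D A s) / norm (y - s)"
            by (auto simp: eventually_at_filter)
        qed
      qed
      have D0: "D A s = 0" if s: "0 < s" for s
        unfolding D_def
      proof (rule integral_eq_zero_AE)
        show "AE \<xi> in lborel. m A s \<xi> * (indicator A \<xi> * (W s \<xi> - r' \<xi> * V s \<xi>) - r \<xi> * q A s \<xi>) = 0"
          using eq[OF s] by eventually_elim (simp add: q_def)
      qed
      show ?thesis
      \<comment> \<open>The equation is available only at positive times, so time 0 is exempted and
        continuity there is used instead.\<close>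
      proof (rule has_derivative_zero_unique_strong_interval[of "{0}" 0 t])
        show "continuous_on {0..t} (h A)"
          unfolding continuous_on_eq_continuous_within
          by (auto intro!: has_derivative_continuous[OF has_derivative_subset[OF der]])
        show "(h A has_derivative (\<lambda>h. 0)) (at s within {0..t})" if "s \<in> {0..t} - {0}" for s
          using has_derivative_subset[OF der[of s], of "{0..t}"] D0[of s] that by auto
      qed (use t in auto)
    qed
    have qL: "(\<lambda>\<xi>. indicator ?E \<xi> * (V s \<xi> - r' \<xi> * U s \<xi>)) \<in> L2" if "0 \<le> s" for s
    proof -
      have "(\<lambda>\<xi>. indicator ?E \<xi> * (V s \<xi> - r' \<xi> * U s \<xi>)) = (\<lambda>\<xi>. indicator ?E \<xi> * V s \<xi> - (indicator ?E \<xi> * r' \<xi>) * U s \<xi>)"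
        by (simp add: algebra_simps)
      moreover have "\<dots> \<in> L2"
        using B by (intro L2_diff L2_indicator_mult L2 L2_mult_bounded[where B=B] that)
          (auto simp: indicator_def B_def)
      ultimately show ?thesis by simp
    qed
    have Efin: "emeasure lborel ?E < \<infinity>" by (intro emeasure_bounded_finite) auto
    define G where "G \<xi> = m ?E t \<xi> * q ?E t \<xi> - m ?E 0 \<xi> * q ?E 0 \<xi>" for \<xi>
    have mL: "m ?E s \<in> L2" for s
      unfolding m_def
    proof (rule L2_dominated_tendsto(2)[OF _ Efin, where F="\<lambda>k. m ?E s" and B="exp (B * \<bar>s\<bar>)"])
      show "m ?E s \<in> borel_measurable borel" unfolding m_def by measurable
      show "cmod (m ?E s \<xi>) \<le> exp (B * \<bar>s\<bar>) * indicator ?E \<xi>" for \<xi>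
      proof (cases "\<xi> \<in> ?E")
        case True
        have "Re (- (r \<xi> * of_real s)) \<le> cmod (r \<xi> * of_real s)"
          using complex_Re_le_cmod[of "- (r \<xi> * of_real s)"] by simp
        also have "\<dots> \<le> B * \<bar>s\<bar>" using B(1)[OF True] by (simp add: norm_mult mult_right_mono)
        finally show ?thesis using True by (simp add: m_def norm_exp_eq_Re)
      qed (simp add: m_def)
    qed (auto simp: m_def)
    have int: "integrable lborel (\<lambda>\<xi>. m ?E s \<xi> * q ?E s \<xi>)" if "0 \<le> s" for s
      unfolding q_def by (intro integrable_L2_mult mL qL that)
    have "AE \<xi> in lborel. G \<xi> = 0"
    \<comment> \<open>An integrable function whose integral over every measurable set vanishes is
      zero almost everywhere.\<close>
    proof (rule sigma_finite_measure.density_zero[OF lborel.sigma_finite_measure_axioms])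
      show "integrable lborel G" unfolding G_def using int t by simp
      fix A :: "(real^'n) set" assume A: "A \<in> sets lborel"
      have mq: "indicator A \<xi> *\<^sub>R (m ?E s \<xi> * q ?E s \<xi>) = m (A \<inter> ?E) s \<xi> * q (A \<inter> ?E) s \<xi>" for s \<xi>
        by (simp add: m_def q_def indicator_def)
      have ints: "integrable lborel (\<lambda>\<xi>. indicator A \<xi> *\<^sub>R (m ?E s \<xi> * q ?E s \<xi>))" if "0 \<le> s" for s
        by (rule integrable_mult_indicator[OF A int[OF that]])
      have "set_lebesgue_integral lborel A G = h (A \<inter> ?E) t - h (A \<inter> ?E) 0"
        unfolding set_lebesgue_integral_def G_def h_def scaleR_diff_right
        using Bochner_Integration.integral_diff[OF ints[OF t] ints[of 0]] by (simp only: mq)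
      also have "\<dots> = 0" using const[of "A \<inter> ?E"] A by auto
      finally show "set_lebesgue_integral lborel A G = 0" .
    qed
    then show ?thesis
      by eventually_elim (auto simp: G_def m_def q_def)
  qed
  \<comment> \<open>Countably many balls exhaust the space, so their null sets may be
    united.\<close>
  then have "AE \<xi> in lborel. \<forall>N. \<xi> \<in> ball 0 (real N) \<longrightarrow>
      exp (- (r \<xi> * of_real t)) * (V t \<xi> - r' \<xi> * U t \<xi>) = V 0 \<xi> - r' \<xi> * U 0 \<xi>"
    unfolding AE_all_countable by blast
  then show ?thesis
  proof eventually_elim
    fix \<xi> :: "real^'n"
    assume *: "\<forall>N. \<xi> \<in> ball 0 (real N) \<longrightarrow>
      exp (- (r \<xi> * of_real t)) * (V t \<xi> - r' \<xi> * U t \<xi>) = V 0 \<xi> - r' \<xi> * U 0 \<xi>"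
    obtain N :: nat where "norm \<xi> < real N" using reals_Archimedean2 by blast
    with * have "V 0 \<xi> - r' \<xi> * U 0 \<xi> = exp (- (r \<xi> * of_real t)) * (V t \<xi> - r' \<xi> * U t \<xi>)" by auto
    then have "exp (r \<xi> * of_real t) * (V 0 \<xi> - r' \<xi> * U 0 \<xi>)
      = (exp (r \<xi> * of_real t) * exp (- (r \<xi> * of_real t))) * (V t \<xi> - r' \<xi> * U t \<xi>)" by simp
    then show "V t \<xi> - r' \<xi> * U t \<xi> = exp (r \<xi> * of_real t) * (V 0 \<xi> - r' \<xi> * U 0 \<xi>)"
      by (simp flip: exp_add)
  qed
qed


section \<open>Roots of the characteristic equation and the formula for the transformed
  solution\<close>

text \<open>The characteristic equation is \<open>z\<^sup>2 + z / (1 + \<mu>) + \<mu> = 0\<close> with \<open>\<mu> = log_symbol \<xi>\<close>; \<open>root_disc\<close> is a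
  continuous square root of its discriminant, real or purely imaginary.\<close>

definition disc :: "real \<Rightarrow> real" where
  "disc \<mu> = (1 / (1 + \<mu>))\<^sup>2 - 4 * \<mu>"

definition root_disc :: "real \<Rightarrow> complex" where
  "root_disc \<mu> = complex_of_real (sqrt (max (disc \<mu>) 0)) + \<i> * complex_of_real (sqrt (max (- disc \<mu>) 0))"

definition root_plus :: "real \<Rightarrow> complex" where
  "root_plus \<mu> = (- complex_of_real (1 / (1 + \<mu>)) + root_disc \<mu>) / 2"

definition root_minus :: "real \<Rightarrow> complex" where
  "root_minus \<mu> = (- complex_of_real (1 / (1 + \<mu>)) - root_disc \<mu>) / 2"

lemma root_disc_power2: "(root_disc \<mu>)\<^sup>2 = complex_of_real (disc \<mu>)"
  by (cases "0 \<le> disc \<mu>")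
     (simp_all add: root_disc_def max_def power_mult_distrib flip: of_real_power)

lemma root_sum: "root_plus \<mu> + root_minus \<mu> = - complex_of_real (1 / (1 + \<mu>))"
proof -
  have "(- a + s) / 2 + (- a - s) / 2 = - a" for a s :: complex by (simp add: field_simps)
  then show ?thesis unfolding root_plus_def root_minus_def .
qed

lemma root_diff: "root_plus \<mu> - root_minus \<mu> = root_disc \<mu>"
  by (simp add: root_plus_def root_minus_def field_simps)

lemma root_prod: "root_plus \<mu> * root_minus \<mu> = complex_of_real \<mu>"
proof -
  have "root_plus \<mu> * root_minus \<mu> = ((complex_of_real (1 / (1 + \<mu>)))\<^sup>2 - (root_disc \<mu>)\<^sup>2) / 4"
    by (simp add: root_plus_def root_minus_def power2_eq_square algebra_simps)
  also have "\<dots> = complex_of_real \<mu>"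
    unfolding root_disc_power2 by (simp add: disc_def)
  finally show ?thesis .
qed

lemma log_symbol_continuous: "continuous_on A log_symbol"
  unfolding log_symbol_def by (intro continuous_intros) (auto simp: add_nonneg_eq_0_iff)

lemma one_plus_log_symbol_nonzero: "1 + log_symbol \<xi> \<noteq> 0"
  using log_symbol_nonneg[of \<xi>] by linarith

lemma root_disc_continuous: "continuous_on A (\<lambda>\<xi>. root_disc (log_symbol \<xi>))"
  unfolding root_disc_def disc_def
  by (intro continuous_intros log_symbol_continuous) (auto simp: one_plus_log_symbol_nonzero)

lemma root_continuous:
  "continuous_on A (\<lambda>\<xi>. root_plus (log_symbol \<xi>))" "continuous_on A (\<lambda>\<xi>. root_minus (log_symbol \<xi>))"
  unfolding root_plus_def root_minus_def
  by (intro continuous_intros log_symbol_continuous root_disc_continuous; simp add: one_plus_log_symbol_nonzero)+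

lemma root_measurable [measurable]:
  "(\<lambda>\<xi>. root_plus (log_symbol \<xi>)) \<in> borel_measurable borel"
  "(\<lambda>\<xi>. root_minus (log_symbol \<xi>)) \<in> borel_measurable borel"
  by (intro borel_measurable_continuous_onI root_continuous)+

lemma bounded_image_ball:
  fixes f :: "'a::euclidean_space \<Rightarrow> complex"
  assumes "continuous_on UNIV f" shows "bounded (f ` ball 0 R)"
proof -
  have "compact (f ` cball 0 R)"
    by (intro compact_continuous_image continuous_on_subset[OF assms]) auto
  then show ?thesis
    by (intro bounded_subset[OF compact_imp_bounded]) (auto intro: image_mono)
qed

text \<open>The conserved quantities for both orderings of the roots are two linear equations for
  the transforms of u and its time derivative; subtracting them eliminates the derivative. The
  factor \<open>root_disc\<close> stays on the left, so the identity also makes sense at a double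
  root.\<close>

lemma solution_fourier:
  fixes u :: "real \<Rightarrow> real^'n \<Rightarrow> complex"
  assumes sol: "is_solution u0 u1 u" and u0: "u0 \<in> L2" and u1: "u1 \<in> L2" and t: "0 \<le> t"
  shows "u t \<in> L2"
    and "AE \<xi> in lborel. root_disc (log_symbol \<xi>) * fourier (u t) \<xi> =
      exp (root_plus (log_symbol \<xi>) * of_real t) * (fourier u1 \<xi> - root_minus (log_symbol \<xi>) * fourier u0 \<xi>)
      - exp (root_minus (log_symbol \<xi>) * of_real t) * (fourier u1 \<xi> - root_plus (log_symbol \<xi>) * fourier u0 \<xi>)"
proof -
  from sol obtain v w where
    uY: "\<And>t. 0 \<le> t \<Longrightarrow> u t \<in> Y 2"
    and uv: "C1_into L2 L2_norm u v" and vw: "C1_into L2 L2_norm v w"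
    and eq: "\<And>t. 0 < t \<Longrightarrow> AE x in lborel. w t x + op_L (u t) x + inv_I_plus_L (v t) x = 0"
    and ini: "AE x in lborel. u 0 x = u0 x" "AE x in lborel. v 0 x = u1 x"
    unfolding is_solution_def C0_into_def[of "Y 2"] by blast
  have L2: "u s \<in> L2" "v s \<in> L2" "w s \<in> L2" if "0 \<le> s" for s
    using uv vw that by (auto simp: C1_into_def C0_into_def)
  show "u t \<in> L2" by (rule L2[OF t])
  let ?c = "sqrt ((2 * pi) ^ CARD('n))"
  have der: "((\<lambda>s. L2_norm (\<lambda>\<xi>. (fourier (f s) \<xi> - fourier (f s') \<xi>) / of_real (s - s') - fourier (g s') \<xi>)) \<longlongrightarrow> 0)
      (at s' within {0..})"
    if s': "0 \<le> s'" and f: "\<And>s. 0 \<le> s \<Longrightarrow> f s \<in> L2" "g s' \<in> L2"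
      and lim: "((\<lambda>s. L2_norm (\<lambda>x. (f s x - f s' x) / of_real (s - s') - g s' x)) \<longlongrightarrow> 0) (at s' within {0..})"
    for f g :: "real \<Rightarrow> real^'n \<Rightarrow> complex" and s'
  proof (rule Lim_transform_eventually)
    show "((\<lambda>s. ?c * L2_norm (\<lambda>x. (f s x - f s' x) / of_real (s - s') - g s' x)) \<longlongrightarrow> 0) (at s' within {0..})"
      using tendsto_mult_left[OF lim, of ?c] by simp
    have "?c * L2_norm (\<lambda>x. (f s x - f s' x) / of_real (s - s') - g s' x)
      = L2_norm (\<lambda>\<xi>. (fourier (f s) \<xi> - fourier (f s') \<xi>) / of_real (s - s') - fourier (g s') \<xi>)" if "0 \<le> s" for s
      using fourier_difference_quotient_norm[OF f(1)[OF that] f(1)[OF s'] f(2)] by metis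
    then show "\<forall>\<^sub>F s in at s' within {0..}. ?c * L2_norm (\<lambda>x. (f s x - f s' x) / of_real (s - s') - g s' x)
      = L2_norm (\<lambda>\<xi>. (fourier (f s) \<xi> - fourier (f s') \<xi>) / of_real (s - s') - fourier (g s') \<xi>)"
      by (auto simp: eventually_at_filter)
  qed
  have dU: "((\<lambda>s. L2_norm (\<lambda>\<xi>. (fourier (u s) \<xi> - fourier (u s') \<xi>) / of_real (s - s') - fourier (v s') \<xi>)) \<longlongrightarrow> 0)
      (at s' within {0..})" if "0 \<le> s'" for s'
    using uv that by (intro der L2) (auto simp: C1_into_def)
  have dV: "((\<lambda>s. L2_norm (\<lambda>\<xi>. (fourier (v s) \<xi> - fourier (v s') \<xi>) / of_real (s - s') - fourier (w s') \<xi>)) \<longlongrightarrow> 0)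
      (at s' within {0..})" if "0 \<le> s'" for s'
    using vw that by (intro der L2) (auto simp: C1_into_def)
  have ode: "AE \<xi> in lborel. fourier (w s) \<xi> = - (complex_of_real (1 / (1 + log_symbol \<xi>)) * fourier (v s) \<xi>)
      - complex_of_real (log_symbol \<xi>) * fourier (u s) \<xi>" if s: "0 < s" for s
  proof -
    have s0: "0 \<le> s" using s by simp
    have dom: "u s \<in> dom_L" using uY[OF s0] Y_2_subset_dom_L by blast
    note LL = L2(3)[OF s0] op_L(1)[OF dom] inv_I_plus_L(1)[OF L2(2)[OF s0]]
    \<comment> \<open>The zero function is written as \<open>0 * u s x\<close>, so that its
      transform is given by \<open>fourier_scale\<close>.\<close>
    have "AE \<xi> in lborel. fourier (\<lambda>x. (w s x + op_L (u s) x) + inv_I_plus_L (v s) x) \<xi> = fourier (\<lambda>x. 0 * u s x) \<xi>"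
      using eq[OF s]
      by (intro fourier_cong_AE[OF L2_add[OF L2_add[OF LL(1,2)] LL(3)] L2_scale[OF L2(1)[OF s0]]]) simp
    with fourier_add[OF LL(1,2)] fourier_add[OF L2_add[OF LL(1,2)] LL(3)] fourier_scale[OF L2(1)[OF s0], of 0]
      op_L(2)[OF dom] inv_I_plus_L(2)[OF L2(2)[OF s0]]
    show ?thesis
    proof eventually_elim
      fix \<xi> :: "real^'n"
      let ?L = "complex_of_real (log_symbol \<xi>)"
      assume *: "fourier (\<lambda>x. w s x + op_L (u s) x + inv_I_plus_L (v s) x) \<xi> = fourier (\<lambda>x. 0 * u s x) \<xi>"
        "fourier (\<lambda>x. w s x + op_L (u s) x) \<xi> = fourier (w s) \<xi> + fourier (op_L (u s)) \<xi>"
        "fourier (\<lambda>x. w s x + op_L (u s) x + inv_I_plus_L (v s) x) \<xi>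
          = fourier (\<lambda>x. w s x + op_L (u s) x) \<xi> + fourier (inv_I_plus_L (v s)) \<xi>"
        "fourier (\<lambda>x. 0 * u s x) \<xi> = 0 * fourier (u s) \<xi>"
        "fourier (op_L (u s)) \<xi> = ?L * fourier (u s) \<xi>"
        and inv: "(1 + ?L) * fourier (inv_I_plus_L (v s)) \<xi> = fourier (v s) \<xi>"
      have nz: "1 + ?L \<noteq> 0"
        using one_plus_log_symbol_nonzero[of \<xi>] by (metis of_real_1 of_real_add of_real_eq_0_iff)
      have "fourier (inv_I_plus_L (v s)) \<xi> = complex_of_real (1 / (1 + log_symbol \<xi>)) * fourier (v s) \<xi>"
        using nz by (simp add: inv[symmetric])
      moreover have "fourier (w s) \<xi> + ?L * fourier (u s) \<xi> + fourier (inv_I_plus_L (v s)) \<xi> = 0"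
        using * by simp
      ultimately show "fourier (w s) \<xi> = - (complex_of_real (1 / (1 + log_symbol \<xi>)) * fourier (v s) \<xi>) - ?L * fourier (u s) \<xi>"
        by algebra
    qed
  qed
  have mode: "AE \<xi> in lborel. fourier (v t) \<xi> - r' \<xi> * fourier (u t) \<xi>
      = exp (r \<xi> * of_real t) * (fourier (v 0) \<xi> - r' \<xi> * fourier (u 0) \<xi>)"
    if r: "continuous_on UNIV r" "continuous_on UNIV r'"
      and sum: "\<And>\<xi>. r \<xi> + r' \<xi> = - complex_of_real (1 / (1 + log_symbol \<xi>))"
      and prod: "\<And>\<xi>. r \<xi> * r' \<xi> = complex_of_real (log_symbol \<xi>)" for r r' :: "real^'n \<Rightarrow> complex"
  proof (rule mode_conserved[where W="\<lambda>s. fourier (w s)", OF _ _ _ dU dV _ _ _ _ _ t])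
    show "AE \<xi> in lborel. fourier (w s) \<xi> - r' \<xi> * fourier (v s) \<xi> = r \<xi> * (fourier (v s) \<xi> - r' \<xi> * fourier (u s) \<xi>)"
      if "0 < s" for s
      using ode[OF that]
    proof eventually_elim
      fix \<xi> assume e: "fourier (w s) \<xi> = - (complex_of_real (1 / (1 + log_symbol \<xi>)) * fourier (v s) \<xi>)
        - complex_of_real (log_symbol \<xi>) * fourier (u s) \<xi>"
      have "fourier (w s) \<xi> = (r \<xi> + r' \<xi>) * fourier (v s) \<xi> - (r \<xi> * r' \<xi>) * fourier (u s) \<xi>"
        unfolding sum prod e by simp
      then show "fourier (w s) \<xi> - r' \<xi> * fourier (v s) \<xi> = r \<xi> * (fourier (v s) \<xi> - r' \<xi> * fourier (u s) \<xi>)"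
        by (simp add: algebra_simps)
    qed
  qed (auto intro!: fourier_L2 L2 bounded_image_ball borel_measurable_continuous_onI r)
  have m1: "AE \<xi> in lborel. fourier (v t) \<xi> - root_minus (log_symbol \<xi>) * fourier (u t) \<xi>
      = exp (root_plus (log_symbol \<xi>) * of_real t) * (fourier (v 0) \<xi> - root_minus (log_symbol \<xi>) * fourier (u 0) \<xi>)"
    by (rule mode) (simp_all only: root_continuous root_sum root_prod)
  have m2: "AE \<xi> in lborel. fourier (v t) \<xi> - root_plus (log_symbol \<xi>) * fourier (u t) \<xi>
      = exp (root_minus (log_symbol \<xi>) * of_real t) * (fourier (v 0) \<xi> - root_plus (log_symbol \<xi>) * fourier (u 0) \<xi>)"
    by (rule mode) (simp_all only: root_continuous add.commute[of "root_minus _"] mult.commute[of "root_minus _"] root_sum root_prod)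
  have i: "AE \<xi> in lborel. fourier (u 0) \<xi> = fourier u0 \<xi>" "AE \<xi> in lborel. fourier (v 0) \<xi> = fourier u1 \<xi>"
    using fourier_cong_AE[OF L2(1) u0 ini(1)] fourier_cong_AE[OF L2(2) u1 ini(2)] by simp_all
  show "AE \<xi> in lborel. root_disc (log_symbol \<xi>) * fourier (u t) \<xi> =
      exp (root_plus (log_symbol \<xi>) * of_real t) * (fourier u1 \<xi> - root_minus (log_symbol \<xi>) * fourier u0 \<xi>)
      - exp (root_minus (log_symbol \<xi>) * of_real t) * (fourier u1 \<xi> - root_plus (log_symbol \<xi>) * fourier u0 \<xi>)"
    using m1 m2 i
  proof eventually_elim
    case (elim \<xi>)
    \<comment> \<open>(V - r_- U) - (V - r_+ U) = (r_+ - r_-) U.\<close>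
    show ?case
      unfolding root_diff[symmetric] elim(3,4)[symmetric] elim(1,2)[symmetric] by (simp add: algebra_simps)
  qed
qed

section \<open>Pointwise estimates of the solution operator\<close>

text \<open>Apply ln y \<le> y to y = (c / p) x and multiply by p; the bound is (p / c)^p.\<close>

lemma exp_powr_bounded:
  fixes c p :: real
  assumes c: "0 < c" and p: "0 < p"
  shows "\<exists>K>0. \<forall>x\<ge>0. exp (- (c * x)) * x powr p \<le> K"
proof (intro exI conjI allI impI)
  let ?e = "c / p"
  show "0 < exp (- (p * ln ?e))" by simp
  fix x :: real assume x: "0 \<le> x"
  show "exp (- (c * x)) * x powr p \<le> exp (- (p * ln ?e))"
  proof (cases "x = 0")
    case False
    then have x: "0 < x" using x by simp
    have "ln (?e * x) \<le> ?e * x" using ln_le_minus_one[of "?e * x"] c p x by simp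
    then have "p * (ln ?e + ln x) \<le> p * (?e * x)"
      using c p x ln_mult_pos[of ?e x] by (intro mult_left_mono) auto
    also have "p * (?e * x) = c * x" using p by simp
    finally have "p * ln x - c * x \<le> - (p * ln ?e)" by (simp add: distrib_left)
    then have "exp (p * ln x - c * x) \<le> exp (- (p * ln ?e))" by simp
    then show ?thesis using x by (simp add: powr_def exp_diff exp_minus field_simps)
  qed simp
qed

lemma exp_powr_bounded_linear:
  fixes c p :: real
  assumes c: "0 < c" and p: "0 < p"
  shows "\<exists>K>0. \<forall>x\<ge>0. exp (- (c * x)) * (1 + x) * x powr p \<le> K"
proof -
  obtain K1 where K1: "0 < K1" "\<And>x. 0 \<le> x \<Longrightarrow> exp (- (c * x)) * x powr p \<le> K1"
    using exp_powr_bounded[OF c p] by blast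
  obtain K2 where K2: "0 < K2" "\<And>x. 0 \<le> x \<Longrightarrow> exp (- (c * x)) * x powr (p + 1) \<le> K2"
    using exp_powr_bounded[OF c, of "p + 1"] p by auto
  show ?thesis
  proof (intro exI[of _ "K1 + K2"] conjI allI impI)
    fix x :: real assume x: "0 \<le> x"
    have "x * x powr p = x powr (p + 1)" using x by (cases "x = 0") (auto simp: powr_add)
    then have "exp (- (c * x)) * (1 + x) * x powr p = exp (- (c * x)) * x powr p + exp (- (c * x)) * x powr (p + 1)"
      by (simp add: algebra_simps)
    then show "exp (- (c * x)) * (1 + x) * x powr p \<le> K1 + K2"
      using K1(2)[OF x] K2(2)[OF x] by linarith
  qed (use K1 K2 in simp)
qed

text \<open>The conclusion of \<open>solution_fourier\<close> at a single frequency, with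
  \<open>A\<close> for the transform of the solution. From here on the estimates concern numbers
  only.\<close>

definition solution_relation :: "real \<Rightarrow> real \<Rightarrow> complex \<Rightarrow> complex \<Rightarrow> complex \<Rightarrow> bool" where
  "solution_relation t \<mu> F0 F1 A \<longleftrightarrow> root_disc \<mu> * A =
     exp (root_plus \<mu> * of_real t) * (F1 - root_minus \<mu> * F0)
     - exp (root_minus \<mu> * of_real t) * (F1 - root_plus \<mu> * F0)"

text \<open>Arranged so that \<open>root_disc\<close> divides only the difference of the two
  exponentials, a quotient that stays bounded when the roots coalesce.\<close>

lemma solution_relation_formula:
  assumes "solution_relation t \<mu> F0 F1 A" "root_disc \<mu> \<noteq> 0"
  shows "A = exp (root_plus \<mu> * of_real t) * F0
    + (F1 - root_plus \<mu> * F0) * ((exp (root_plus \<mu> * of_real t) - exp (root_minus \<mu> * of_real t)) / root_disc \<mu>)"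
proof -
  let ?p = "root_plus \<mu>" and ?m = "root_minus \<mu>" and ?s = "root_disc \<mu>"
  let ?E = "exp (?p * of_real t)" and ?E' = "exp (?m * of_real t)"
  have "?s * A = ?s * (?E * F0) + (F1 - ?p * F0) * (?E - ?E')"
    using assms(1) unfolding solution_relation_def root_diff[of \<mu>, symmetric] by (simp add: algebra_simps)
  then have "A = (?s * (?E * F0) + (F1 - ?p * F0) * (?E - ?E')) / ?s"
    using assms(2) by (simp add: eq_divide_eq mult.commute)
  then show ?thesis using assms(2) by (simp add: add_divide_distrib)
qed

lemma exp_root_oscillating:
  fixes \<mu> t :: real
  assumes "disc \<mu> < 0"
  defines "\<omega> \<equiv> sqrt (- disc \<mu>) / 2" and "E \<equiv> exp (- (1 / (1 + \<mu>) / 2) * t)"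
  shows "exp (root_plus \<mu> * of_real t) = of_real E * (of_real (cos (\<omega> * t)) + \<i> * of_real (sin (\<omega> * t)))"
    and "exp (root_minus \<mu> * of_real t) = of_real E * (of_real (cos (\<omega> * t)) - \<i> * of_real (sin (\<omega> * t)))"
    and "root_disc \<mu> = 2 * \<i> * of_real \<omega>"
    and "root_plus \<mu> = - of_real (1 / (1 + \<mu>) / 2) + \<i> * of_real \<omega>"
    and "root_minus \<mu> = - of_real (1 / (1 + \<mu>) / 2) - \<i> * of_real \<omega>"
proof -
  show d: "root_disc \<mu> = 2 * \<i> * of_real \<omega>"
    using assms(1) by (simp add: root_disc_def \<omega>_def max_def)
  define b where "b = 1 / (1 + \<mu>) / 2"
  have ab: "complex_of_real (1 / (1 + \<mu>)) = 2 * of_real b"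
  proof -
    have "y = 2 * (y / 2)" for y :: real by simp
    from this[of "1 / (1 + \<mu>)", folded b_def] show ?thesis by (simp only: of_real_mult of_real_numeral)
  qed
  have E: "E = exp (- b * t)" by (simp add: E_def b_def)
  show p: "root_plus \<mu> = - of_real (1 / (1 + \<mu>) / 2) + \<i> * of_real \<omega>"
    unfolding root_plus_def d ab b_def[symmetric] by simp
  show m: "root_minus \<mu> = - of_real (1 / (1 + \<mu>) / 2) - \<i> * of_real \<omega>"
    unfolding root_minus_def d ab b_def[symmetric] by (simp add: field_simps)
  have euler: "exp (\<i> * complex_of_real y) = of_real (cos y) + \<i> * of_real (sin y)" for y
    by (simp add: exp_Euler cos_of_real sin_of_real)
  have "root_plus \<mu> * of_real t = of_real (- b * t) + \<i> * of_real (\<omega> * t)"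
    unfolding p b_def[symmetric] by (simp add: algebra_simps)
  then show "exp (root_plus \<mu> * of_real t) = of_real E * (of_real (cos (\<omega> * t)) + \<i> * of_real (sin (\<omega> * t)))"
    unfolding E by (simp only: exp_add exp_of_real euler)
  have "root_minus \<mu> * of_real t = of_real (- b * t) + \<i> * of_real (- (\<omega> * t))"
    unfolding m b_def[symmetric] by (simp add: algebra_simps)
  then show "exp (root_minus \<mu> * of_real t) = of_real E * (of_real (cos (\<omega> * t)) - \<i> * of_real (sin (\<omega> * t)))"
    unfolding E by (simp only: exp_add exp_of_real euler) simp
qed

text \<open>The classical formula for the damped oscillator with damping 1 / (1 + \<mu>).\<close>

lemma solution_oscillating:
  fixes \<mu> t :: real
  assumes rel: "solution_relation t \<mu> F0 F1 A" and neg: "disc \<mu> < 0"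
  defines "\<omega> \<equiv> sqrt (- disc \<mu>) / 2" and "E \<equiv> exp (- (1 / (1 + \<mu>) / 2) * t)"
  shows "A = of_real (E * cos (\<omega> * t) + E * (1 / (1 + \<mu>) / 2) * (sin (\<omega> * t) / \<omega>)) * F0
    + of_real (E * (sin (\<omega> * t) / \<omega>)) * F1"
proof -
  have w: "\<omega> \<noteq> 0" using neg by (simp add: \<omega>_def)
  define b where "b = 1 / (1 + \<mu>) / 2"
  note osc = exp_root_oscillating(1,2)[OF neg, of t, folded \<omega>_def E_def]
    exp_root_oscillating(3-)[OF neg, folded \<omega>_def, folded b_def]
  have "(2 * \<i> * of_real \<omega>) * A
    = (2 * \<i> * of_real \<omega>) * (of_real (E * cos (\<omega> * t) + E * b * (sin (\<omega> * t) / \<omega>)) * F0 + of_real (E * (sin (\<omega> * t) / \<omega>)) * F1)"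
    using rel w unfolding solution_relation_def osc(1,2) unfolding osc(3-) by (simp add: field_simps)
  moreover have "2 * \<i> * complex_of_real \<omega> \<noteq> 0" using w by simp
  ultimately show ?thesis unfolding b_def[symmetric] using mult_left_cancel by blast
qed

section \<open>High frequencies: comparison of two damped oscillations\<close>

lemma abs_sin_diff_le: "\<bar>sin x - sin y\<bar> \<le> \<bar>x - y\<bar>" for x y :: real
proof -
  have "\<bar>sin x - sin y\<bar> = 2 * \<bar>sin ((x - y) / 2)\<bar> * \<bar>cos ((x + y) / 2)\<bar>"
    by (simp add: sin_diff_sin abs_mult)
  also have "\<dots> \<le> 2 * \<bar>(x - y) / 2\<bar> * 1"
    by (intro mult_mono abs_sin_x_le_abs_x abs_cos_le_one) auto
  finally show ?thesis by simp
qed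

lemma abs_cos_diff_le: "\<bar>cos x - cos y\<bar> \<le> \<bar>x - y\<bar>" for x y :: real
proof -
  have "\<bar>cos x - cos y\<bar> = 2 * \<bar>sin ((x + y) / 2)\<bar> * \<bar>sin ((y - x) / 2)\<bar>"
    by (simp add: cos_diff_cos abs_mult)
  also have "\<dots> \<le> 2 * 1 * \<bar>(y - x) / 2\<bar>"
    by (intro mult_mono abs_sin_x_le_abs_x abs_sin_le_one) auto
  finally show ?thesis by simp
qed

lemma abs_sin_div_le: "\<bar>sin (w * t) / w\<bar> \<le> \<bar>t\<bar>" for w t :: real
proof (cases "w = 0")
  case False
  have "\<bar>sin (w * t)\<bar> \<le> \<bar>w * t\<bar>" by (rule abs_sin_x_le_abs_x)
  then show ?thesis using False by (simp add: abs_mult divide_le_eq mult.commute)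
qed simp

text \<open>The value of \<open>phi2\<close> at one frequency, as a function of \<mu> and of the
  transformed data.\<close>

definition osc_part :: "real \<Rightarrow> real \<Rightarrow> complex \<Rightarrow> complex \<Rightarrow> complex" where
  "osc_part t \<mu> F0 F1 = of_real (exp (- t / (2 * \<mu>)) * (sin (sqrt \<mu> * t) / sqrt \<mu>)) * F1
     + of_real (exp (- t / (2 * \<mu>)) * cos (sqrt \<mu> * t)) * F0"

text \<open>The singular factor 1 / sqrt \<mu> is traded for t, a price paid only where the
  exponential is small.\<close>

lemma osc_part_bound:
  assumes "0 \<le> t"
  shows "cmod (osc_part t \<mu> F0 F1) \<le> exp (- t / (2 * \<mu>)) * (t * cmod F1 + cmod F0)"
proof -
  have "cmod (osc_part t \<mu> F0 F1) \<le> cmod (of_real (exp (- t / (2 * \<mu>)) * (sin (sqrt \<mu> * t) / sqrt \<mu>)) * F1)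
     + cmod (of_real (exp (- t / (2 * \<mu>)) * cos (sqrt \<mu> * t)) * F0)"
    unfolding osc_part_def by (rule norm_triangle_ineq)
  also have "\<dots> = exp (- t / (2 * \<mu>)) * (\<bar>sin (sqrt \<mu> * t) / sqrt \<mu>\<bar> * cmod F1 + \<bar>cos (sqrt \<mu> * t)\<bar> * cmod F0)"
    by (simp only: norm_mult norm_of_real abs_mult abs_exp_cancel distrib_left mult.assoc)
  also have "\<dots> \<le> exp (- t / (2 * \<mu>)) * (t * cmod F1 + 1 * cmod F0)"
    using assms abs_sin_div_le[of "sqrt \<mu>" t]
    by (intro mult_left_mono add_mono mult_right_mono abs_cos_le_one) auto
  finally show ?thesis by simp
qed

text \<open>Both terms are damped oscillations. The frequencies \<omega> and \<nu> = sqrt \<mu>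
  satisfy \<omega>^2 = \<nu>^2 - a^2 / 4, and the damping exponents t / (2 (1 + \<mu>)) and t / (2
  \<mu>) differ by x / (2 \<mu>). Phase and damping errors are thus both at most a x, which is small
  at fixed x.\<close>

lemma high_frequency_bound:
  fixes \<mu> t :: real
  assumes rel: "solution_relation t \<mu> F0 F1 A" and mu: "1 \<le> \<mu>" and t: "0 \<le> t"
  defines "x \<equiv> t / (1 + \<mu>)"
  shows "cmod (A - osc_part t \<mu> F0 F1)
     \<le> 4 * exp (- (x / 2)) * (1 + x) * (cmod F0 / sqrt (1 + \<mu>) + cmod F1 / (1 + \<mu>))"
proof -
  define a where "a = 1 / (1 + \<mu>)"
  define r where "r = sqrt a"
  have a: "0 < a" "a \<le> 1 / 2" "a * (1 + \<mu>) = 1" using mu by (auto simp: a_def field_simps)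
  have r: "0 < r" "r * r = a" "r \<le> 1" using a by (auto simp: r_def real_le_rsqrt)
  have a_le_r: "a \<le> r" using mult_left_le[of r r] r by simp
  have x: "x = a * t" "0 \<le> x" using t mu by (auto simp: x_def a_def)
  define \<omega> where "\<omega> = sqrt (- disc \<mu>) / 2"
  define \<nu> where "\<nu> = sqrt \<mu>"
  define E where "E = exp (- (1 / (1 + \<mu>) / 2) * t)"
  define E' where "E' = exp (- t / (2 * \<mu>))"
  have aa: "a\<^sup>2 \<le> 1 / 4" using a power_mono[of a "1/2" 2] by (simp add: power2_eq_square)
  have w2: "\<omega>\<^sup>2 = \<mu> - a\<^sup>2 / 4" and neg: "disc \<mu> < 0"
    using aa mu by (auto simp: \<omega>_def disc_def a_def[symmetric] power_divide field_simps)
  have w0: "0 < \<omega>" using neg by (simp add: \<omega>_def)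
  have n0: "1 \<le> \<nu>" "\<nu>\<^sup>2 = \<mu>" using mu by (auto simp: \<nu>_def)
  \<comment> \<open>\<open>r\<close> is 1 / sqrt (1 + \<mu>), and both frequencies turn out to be at
    least half of sqrt (1 + \<mu>).\<close>
  have inv_le: "1 / y \<le> 2 * r" if "0 < y" "(1 + \<mu>) / 4 \<le> y\<^sup>2" for y
  proof -
    have "1 = (4 * a) * ((1 + \<mu>) / 4)" using a by simp
    also have "\<dots> \<le> (4 * a) * y\<^sup>2" using that a by (intro mult_left_mono) auto
    also have "\<dots> = (2 * r * y)\<^sup>2" using r by (simp add: power2_eq_square)
    finally have "1\<^sup>2 \<le> (2 * r * y)\<^sup>2" by simp
    then have "1 \<le> 2 * r * y" by (rule power2_le_imp_le) (use r that in simp)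
    then show ?thesis using that by (simp add: divide_le_eq)
  qed
  have iw: "1 / \<omega> \<le> 2 * r"
    by (rule inv_le[OF w0], unfold w2) (use aa mu in \<open>simp add: field_simps\<close>)
  have inu: "1 / \<nu> \<le> 2 * r"
    by (rule inv_le, use n0 in simp, unfold n0) (use mu in simp)
  \<comment> \<open>Difference of squares, with \<omega> + \<nu> \<ge> 1.\<close>
  have dif: "\<bar>\<omega> - \<nu>\<bar> \<le> a\<^sup>2 / 4"
  proof -
    have "\<bar>\<omega> - \<nu>\<bar> * 1 \<le> \<bar>\<omega> - \<nu>\<bar> * (\<omega> + \<nu>)" using w0 n0 by (intro mult_left_mono) auto
    also have "\<dots> = \<bar>(\<omega> - \<nu>) * (\<omega> + \<nu>)\<bar>" using w0 n0 by (simp add: abs_mult)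
    also have "(\<omega> - \<nu>) * (\<omega> + \<nu>) = \<omega>\<^sup>2 - \<nu>\<^sup>2" by (simp add: power2_eq_square algebra_simps)
    also have "\<bar>\<dots>\<bar> = a\<^sup>2 / 4" by (simp add: w2 n0)
    finally show ?thesis by simp
  qed
  have ph: "\<bar>\<omega> * t - \<nu> * t\<bar> \<le> a * x"
  proof -
    have "\<bar>\<omega> * t - \<nu> * t\<bar> = \<bar>\<omega> - \<nu>\<bar> * t" using t by (simp add: abs_mult flip: left_diff_distrib)
    also have "\<dots> \<le> (a\<^sup>2 / 4) * t" using dif t by (rule mult_right_mono)
    also have "\<dots> \<le> a * x" using t a by (simp add: x power2_eq_square)
    finally show ?thesis .
  qed
  have E: "E = exp (- (x / 2))" "0 < E" by (simp_all add: E_def x_def)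
  have E': "0 < E'" "E' \<le> E" "E - E' \<le> E * (a * x)"
  proof -
    have d: "t / (2 * \<mu>) - x / 2 = x / (2 * \<mu>)" using mu by (simp add: x_def field_simps)
    \<comment> \<open>This inequality is equivalent to \<mu> \<ge> 1.\<close>
    have "1 / (2 * \<mu>) \<le> a" using mu by (simp add: a_def field_simps)
    then have d2: "x / (2 * \<mu>) \<le> a * x" using mult_right_mono[of "1 / (2 * \<mu>)" a x] x by simp
    have eq: "E' = E * exp (- (x / (2 * \<mu>)))"
      unfolding E E'_def d[symmetric] by (simp flip: exp_add)
    show "0 < E'" by (simp add: E'_def)
    show "E' \<le> E" unfolding eq using E x mu by (intro mult_left_le) auto
    have "1 - x / (2 * \<mu>) \<le> exp (- (x / (2 * \<mu>)))" using exp_ge_add_one_self[of "- (x / (2 * \<mu>))"] by simp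
    then have "1 - exp (- (x / (2 * \<mu>))) \<le> a * x" using d2 by linarith
    then have "E * (1 - exp (- (x / (2 * \<mu>)))) \<le> E * (a * x)" using E by (intro mult_left_mono) auto
    then show "E - E' \<le> E * (a * x)" unfolding eq by (simp add: algebra_simps)
  qed
  have c1: "\<bar>E * (sin (\<omega> * t) / \<omega>) - E' * (sin (\<nu> * t) / \<nu>)\<bar> \<le> 4 * E * (1 + x) * a"
  proof -
    \<comment> \<open>One change at a time: first the frequency in the denominator, then the phase,
      then the damping.\<close>
    have split: "E * (sin (\<omega> * t) / \<omega>) - E' * (sin (\<nu> * t) / \<nu>)
      = E * (sin (\<omega> * t) * (1 / \<omega> - 1 / \<nu>)) + E * ((sin (\<omega> * t) - sin (\<nu> * t)) * (1 / \<nu>)) + (E - E') * (sin (\<nu> * t) * (1 / \<nu>))"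
      by (simp add: algebra_simps diff_divide_distrib)
    have "1 / \<omega> - 1 / \<nu> = (\<nu> - \<omega>) * (1 / \<omega>) * (1 / \<nu>)" using w0 n0 by (simp add: field_simps)
    then have "\<bar>1 / \<omega> - 1 / \<nu>\<bar> = \<bar>\<omega> - \<nu>\<bar> * (1 / \<omega>) * (1 / \<nu>)"
      using w0 n0 by (simp add: abs_mult abs_minus_commute)
    also have "\<dots> \<le> (a\<^sup>2 / 4) * (2 * r) * (2 * r)"
      using dif iw inu r w0 n0 by (intro mult_mono) auto
    also have "\<dots> = a * (a * a)" using r by (simp add: power2_eq_square)
    also have "\<dots> \<le> a" using a by (intro mult_left_le) (auto intro!: mult_le_one)
    finally have i: "\<bar>1 / \<omega> - 1 / \<nu>\<bar> \<le> a" .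
    have t1: "\<bar>E * (sin (\<omega> * t) * (1 / \<omega> - 1 / \<nu>))\<bar> \<le> E * (1 * a)"
      unfolding abs_mult using E i by (intro mult_mono abs_sin_le_one) auto
    have t2: "\<bar>E * ((sin (\<omega> * t) - sin (\<nu> * t)) * (1 / \<nu>))\<bar> \<le> E * ((a * x) * 1)"
      unfolding abs_mult using E n0 a x by (intro mult_mono order_trans[OF abs_sin_diff_le ph]) auto
    have t3: "\<bar>(E - E') * (sin (\<nu> * t) * (1 / \<nu>))\<bar> \<le> (E * (a * x)) * (1 * 1)"
      unfolding abs_mult using E E' n0 a x by (intro mult_mono abs_sin_le_one) auto
    have "\<bar>E * (sin (\<omega> * t) / \<omega>) - E' * (sin (\<nu> * t) / \<nu>)\<bar> \<le> E * (1 * a) + E * ((a * x) * 1) + (E * (a * x)) * (1 * 1)"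
      unfolding split using t1 t2 t3 by linarith
    also have "\<dots> = E * a * (1 + 2 * x)" by (simp add: algebra_simps)
    also have "\<dots> \<le> E * a * (4 * (1 + x))" using E a x by (intro mult_left_mono) auto
    finally show ?thesis by (simp add: algebra_simps)
  qed
  have c0: "\<bar>E * cos (\<omega> * t) + E * (1 / (1 + \<mu>) / 2) * (sin (\<omega> * t) / \<omega>) - E' * cos (\<nu> * t)\<bar> \<le> 4 * E * (1 + x) * r"
  proof -
    have split: "E * cos (\<omega> * t) + E * (1 / (1 + \<mu>) / 2) * (sin (\<omega> * t) / \<omega>) - E' * cos (\<nu> * t)
      = E * (cos (\<omega> * t) - cos (\<nu> * t)) + (E - E') * cos (\<nu> * t) + E * ((a / 2) * (sin (\<omega> * t) * (1 / \<omega>)))"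
      by (simp add: algebra_simps a_def)
    have t1: "\<bar>E * (cos (\<omega> * t) - cos (\<nu> * t))\<bar> \<le> E * (a * x)"
      unfolding abs_mult using E by (intro mult_mono order_trans[OF abs_cos_diff_le ph]) auto
    have t2: "\<bar>(E - E') * cos (\<nu> * t)\<bar> \<le> (E * (a * x)) * 1"
      unfolding abs_mult using E E' a x by (intro mult_mono abs_cos_le_one) auto
    have t3: "\<bar>E * ((a / 2) * (sin (\<omega> * t) * (1 / \<omega>)))\<bar> \<le> E * ((a / 2) * (1 * 2))"
      unfolding abs_mult using E a w0 iw r by (intro mult_mono abs_sin_le_one) auto
    have "\<bar>E * cos (\<omega> * t) + E * (1 / (1 + \<mu>) / 2) * (sin (\<omega> * t) / \<omega>) - E' * cos (\<nu> * t)\<bar>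
        \<le> E * (a * x) + (E * (a * x)) * 1 + E * ((a / 2) * (1 * 2))"
      unfolding split using t1 t2 t3 by linarith
    also have "\<dots> = E * (1 + 2 * x) * a" by (simp add: algebra_simps)
    \<comment> \<open>The factor a is weakened to its square root; that is the power of 1 + \<mu>
      for which the norm of u_0 in Y^(l+1) gives the required decay.\<close>
    also have "\<dots> \<le> E * (4 * (1 + x)) * r" using E a x a_le_r by (intro mult_mono mult_nonneg_nonneg) auto
    finally show ?thesis by (simp add: algebra_simps)
  qed
  have "A - osc_part t \<mu> F0 F1
    = of_real (E * cos (\<omega> * t) + E * (1 / (1 + \<mu>) / 2) * (sin (\<omega> * t) / \<omega>) - E' * cos (\<nu> * t)) * F0
      + of_real (E * (sin (\<omega> * t) / \<omega>) - E' * (sin (\<nu> * t) / \<nu>)) * F1"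
    unfolding solution_oscillating[OF rel neg, folded \<omega>_def E_def] osc_part_def \<nu>_def[symmetric] E'_def[symmetric]
    by (simp only: of_real_diff of_real_add left_diff_distrib distrib_right) simp
  then have "cmod (A - osc_part t \<mu> F0 F1)
    \<le> \<bar>E * cos (\<omega> * t) + E * (1 / (1 + \<mu>) / 2) * (sin (\<omega> * t) / \<omega>) - E' * cos (\<nu> * t)\<bar> * cmod F0
      + \<bar>E * (sin (\<omega> * t) / \<omega>) - E' * (sin (\<nu> * t) / \<nu>)\<bar> * cmod F1"
    using norm_triangle_ineq by (metis norm_mult norm_of_real)
  also have "\<dots> \<le> (4 * E * (1 + x) * r) * cmod F0 + (4 * E * (1 + x) * a) * cmod F1"
    by (intro add_mono mult_right_mono c0 c1) auto
  also have "\<dots> = 4 * exp (- (x / 2)) * (1 + x) * (cmod F0 / sqrt (1 + \<mu>) + cmod F1 / (1 + \<mu>))"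
    by (simp add: E(1) r_def a_def real_sqrt_divide algebra_simps)
  finally show ?thesis .
qed


section \<open>Middle frequencies: separate exponential bounds\<close>

lemma root_bounds_medium:
  fixes \<mu> :: real
  assumes mu: "1 / 16 \<le> \<mu>" "\<mu> \<le> 1"
  shows "Re (root_plus \<mu>) \<le> - (1 / 16)" "Re (root_minus \<mu>) \<le> - (1 / 16)" "cmod (root_plus \<mu>) \<le> 3 / 2"
proof -
  define a where "a = 1 / (1 + \<mu>)"
  have a: "1 / 2 \<le> a" "a \<le> 1" using mu by (auto simp: a_def field_simps)
  have a2: "a\<^sup>2 \<le> 1" using a power_mono[of a 1 2] by simp
  have d: "disc \<mu> = a\<^sup>2 - 4 * \<mu>" by (simp add: disc_def a_def)
  \<comment> \<open>As a \<le> 1 and 4 \<mu> \<ge> 1/4, this square dominates the discriminant,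
    whether the roots are real or complex. So the real part of \<open>root_plus\<close> is at most
    -1/16.\<close>
  have "(a - 1 / 8)\<^sup>2 = a\<^sup>2 - a / 4 + 1 / 64" by (simp add: power2_eq_square field_simps)
  then have "max (disc \<mu>) 0 \<le> (a - 1 / 8)\<^sup>2" using d mu a zero_le_power2[of "a - 1 / 8"] by auto
  then have S: "sqrt (max (disc \<mu>) 0) \<le> a - 1 / 8" using a by (intro real_le_lsqrt) auto
  have S0: "0 \<le> sqrt (max (disc \<mu>) 0)" by simp
  have Re: "Re (root_plus \<mu>) = (- a + sqrt (max (disc \<mu>) 0)) / 2" "Re (root_minus \<mu>) = (- a - sqrt (max (disc \<mu>) 0)) / 2"
    by (simp_all add: root_plus_def root_minus_def root_disc_def a_def[symmetric] flip: of_real_divide)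
  show "Re (root_plus \<mu>) \<le> - (1 / 16)" unfolding Re using S by simp
  have "- a - sqrt (max (disc \<mu>) 0) \<le> - (1 / 8)" using S0 a by linarith
  then show "Re (root_minus \<mu>) \<le> - (1 / 16)" unfolding Re by simp
  have "(cmod (root_disc \<mu>))\<^sup>2 = \<bar>disc \<mu>\<bar>"
    using root_disc_power2[of \<mu>] by (metis norm_of_real norm_power)
  also have "\<dots> \<le> 2\<^sup>2"
  proof -
    have "a\<^sup>2 - 4 * \<mu> \<le> 4" "- (a\<^sup>2 - 4 * \<mu>) \<le> 4" using a2 mu zero_le_power2[of a] by linarith+
    then show ?thesis unfolding d by (simp add: abs_le_iff)
  qed
  finally have "cmod (root_disc \<mu>) \<le> 2" by (rule power2_le_imp_le) simp
  moreover have "cmod (root_plus \<mu>) \<le> (cmod (complex_of_real a) + cmod (root_disc \<mu>)) / 2"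
    unfolding root_plus_def a_def[symmetric] norm_divide
    using norm_triangle_ineq[of "- complex_of_real a" "root_disc \<mu>"] by simp
  ultimately show "cmod (root_plus \<mu>) \<le> 3 / 2" using a by simp
qed

text \<open>No cancellation is used. On this band x \<le> t \<le> 2 x and the weights are bounded
  below, so exponential decay of both terms gives a bound of the same shape as at high
  frequency.\<close>

lemma medium_frequency_bound:
  fixes \<mu> t :: real
  assumes rel: "solution_relation t \<mu> F0 F1 A" and nz: "root_disc \<mu> \<noteq> 0"
    and mu: "1 / 16 \<le> \<mu>" "\<mu> \<le> 1" and t: "0 \<le> t"
  defines "x \<equiv> t / (1 + \<mu>)"
  shows "cmod (A - osc_part t \<mu> F0 F1)
     \<le> 12 * exp (- (x / 16)) * (1 + x) * (cmod F0 / sqrt (1 + \<mu>) + cmod F1 / (1 + \<mu>))"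
proof -
  define e where "e = exp (- (t / 16))"
  have e0: "0 < e" by (simp add: e_def)
  have x: "0 \<le> x" "t \<le> 2 * x" "x \<le> t"
    using t mu mult_left_mono[of \<mu> 1 t] by (auto simp: x_def field_simps)
  note rb = root_bounds_medium[OF mu]
  have Re: "Re (root_plus \<mu> * of_real t) \<le> - (t / 16)" "Re (root_minus \<mu> * of_real t) \<le> - (t / 16)"
    using mult_right_mono[OF rb(1) t] mult_right_mono[OF rb(2) t] by auto
  have E: "cmod (exp (root_plus \<mu> * of_real t)) \<le> e"
    using Re(1) by (simp add: norm_exp_eq_Re e_def)
  \<comment> \<open>The mean value bound carries \<open>root_disc\<close> as a factor, so the
    quotient is controlled uniformly near the double root.\<close>
  have Q: "cmod ((exp (root_plus \<mu> * of_real t) - exp (root_minus \<mu> * of_real t)) / root_disc \<mu>) \<le> e * t"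
  proof -
    have "cmod (exp (root_plus \<mu> * of_real t) - exp (root_minus \<mu> * of_real t))
       \<le> e * cmod (root_plus \<mu> * of_real t - root_minus \<mu> * of_real t)"
      unfolding e_def by (rule norm_exp_diff_le[OF Re])
    also have "root_plus \<mu> * of_real t - root_minus \<mu> * of_real t = root_disc \<mu> * of_real t"
      unfolding root_diff[of \<mu>, symmetric] by (simp add: algebra_simps)
    finally show ?thesis using nz t by (simp add: norm_divide norm_mult divide_le_eq mult_ac)
  qed
  have "cmod A \<le> cmod (exp (root_plus \<mu> * of_real t) * F0) + cmod ((F1 - root_plus \<mu> * F0)
      * ((exp (root_plus \<mu> * of_real t) - exp (root_minus \<mu> * of_real t)) / root_disc \<mu>))"
    by (subst solution_relation_formula[OF rel nz]) (rule norm_triangle_ineq)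
  also have "\<dots> \<le> e * cmod F0 + (cmod F1 + 3 / 2 * cmod F0) * (e * t)"
    unfolding norm_mult
  proof (intro add_mono mult_mono E Q order_trans[OF norm_triangle_ineq4])
    show "cmod (root_plus \<mu> * F0) \<le> 3 / 2 * cmod F0"
      unfolding norm_mult using rb(3) by (intro mult_right_mono) auto
  qed (use e0 in auto)
  finally have A: "cmod A \<le> e * cmod F0 + (cmod F1 + 3 / 2 * cmod F0) * (e * t)" .
  have "exp (- t / (2 * \<mu>)) \<le> e"
    unfolding e_def using t mu mult_left_mono[of \<mu> 1 t] by (simp add: field_simps)
  then have O: "cmod (osc_part t \<mu> F0 F1) \<le> e * (t * cmod F1 + cmod F0)"
    using t by (intro order_trans[OF osc_part_bound[OF t]] mult_right_mono) auto
  have "cmod (A - osc_part t \<mu> F0 F1) \<le> cmod A + cmod (osc_part t \<mu> F0 F1)"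
    by (rule norm_triangle_ineq4)
  also have "\<dots> \<le> (e * cmod F0 + (cmod F1 + 3 / 2 * cmod F0) * (e * t)) + e * (t * cmod F1 + cmod F0)"
    by (intro add_mono A O)
  also have "\<dots> = e * ((2 + 3 / 2 * t) * cmod F0 + 2 * t * cmod F1)"
    by (simp add: algebra_simps)
  also have "\<dots> \<le> e * ((6 * (1 + x)) * cmod F0 + 6 * (1 + x) * cmod F1)"
    using x e0 by (intro mult_left_mono add_mono mult_right_mono) auto
  also have "\<dots> = e * (6 * (1 + x)) * (cmod F0 + cmod F1)" by (simp add: algebra_simps)
  also have "\<dots> \<le> exp (- (x / 16)) * (6 * (1 + x)) * (2 * (cmod F0 / sqrt (1 + \<mu>) + cmod F1 / (1 + \<mu>)))"
  proof (intro mult_mono)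
    show "e \<le> exp (- (x / 16))" using x by (simp add: e_def)
    have "sqrt (1 + \<mu>) \<le> sqrt (2\<^sup>2)" using mu by (intro real_sqrt_le_mono) auto
    then have "sqrt (1 + \<mu>) \<le> 2" by simp
    then have "cmod F0 / 2 \<le> cmod F0 / sqrt (1 + \<mu>)" using mu by (intro divide_left_mono) auto
    moreover have "cmod F1 / 2 \<le> cmod F1 / (1 + \<mu>)" using mu by (intro divide_left_mono) auto
    moreover have "v + w \<le> 2 * (y + z)" if "v / 2 \<le> y" "w / 2 \<le> z" for v w y z :: real
      using that by simp
    ultimately show "cmod F0 + cmod F1 \<le> 2 * (cmod F0 / sqrt (1 + \<mu>) + cmod F1 / (1 + \<mu>))" by blast
  qed (use x e0 in auto)
  finally show ?thesis by (simp add: algebra_simps)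
qed

section \<open>Low frequencies: a slow real mode and a fast one\<close>

lemma exp_neg_linear_le: "0 \<le> y \<Longrightarrow> y * exp (- y) \<le> exp (- (y / 2))" for y :: real
proof -
  assume y: "0 \<le> y"
  \<comment> \<open>The difference of the two sides is (1 - y / 4)^2.\<close>
  have "y \<le> (1 + y / 4)\<^sup>2"
    using zero_le_power2[of "1 - y / 4"] by (simp add: power2_eq_square algebra_simps)
  also have "\<dots> \<le> (exp (y / 4))\<^sup>2" using y by (intro power_mono exp_ge_add_one_self) auto
  also have "\<dots> = exp (y / 2)" by (simp flip: exp_double)
  finally have "y * exp (- y) \<le> exp (y / 2) * exp (- y)" by (intro mult_right_mono) auto
  also have "\<dots> = exp (- (y / 2))" by (simp flip: exp_add)
  finally show ?thesis .
qed

text \<open>Everything follows from (a - S) (a + S) = 4 \<mu>. Since p = - (a - S) / 2 = - 2 \<mu> /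
  (a + S), replacing S by a gives - \<mu> / a = - \<mu> (1 + \<mu>), the exponent in
  \<open>phi1\<close>; the error is quadratic because a - S is of order \<mu>.\<close>

lemma root_bounds_low:
  fixes \<mu> :: real
  assumes mu: "0 \<le> \<mu>" "\<mu> < 1 / 16"
  obtains S p m where "root_disc \<mu> = of_real S" "root_plus \<mu> = of_real p" "root_minus \<mu> = of_real m"
    "3 / 4 \<le> S" "\<bar>1 / S - 1\<bar> \<le> 8 * \<mu>" "p \<le> - (\<mu> * (1 + \<mu>))" "- (\<mu> * (1 + \<mu>)) - p \<le> 2 * \<mu>\<^sup>2"
    "- p \<le> 4 / 3 * \<mu>" "m \<le> - (3 / 4)"
proof -
  define a where "a = 1 / (1 + \<mu>)"
  have a: "16 / 17 \<le> a" "a \<le> 1" "1 - a \<le> \<mu>" "a * (1 + \<mu>) = 1" using mu by (auto simp: a_def field_simps)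
  have a2: "(16 / 17)\<^sup>2 \<le> a\<^sup>2" using a by (intro power_mono) auto
  have d: "disc \<mu> = a\<^sup>2 - 4 * \<mu>" by (simp add: disc_def a_def)
  have "9 / 16 \<le> disc \<mu>" unfolding d using a2 mu by (simp add: power2_eq_square)
  define S where "S = sqrt (disc \<mu>)"
  have S2: "S\<^sup>2 = a\<^sup>2 - 4 * \<mu>" using \<open>9 / 16 \<le> disc \<mu>\<close> by (simp add: S_def d)
  have "sqrt ((3 / 4)\<^sup>2) \<le> S"
    unfolding S_def using \<open>9 / 16 \<le> disc \<mu>\<close> by (intro real_sqrt_le_mono) (simp add: power2_eq_square)
  then have S: "3 / 4 \<le> S" by simp
  have Sa: "S \<le> a" by (rule power2_le_imp_le) (use S2 mu a in auto)
  have prod: "(a - S) * (a + S) = 4 * \<mu>"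
    using S2 by (simp add: power2_eq_square algebra_simps)
  have aS: "a - S \<le> 8 / 3 * \<mu>"
  proof -
    have "(a - S) * (3 / 2) \<le> (a - S) * (a + S)" using a S Sa by (intro mult_left_mono) auto
    then show ?thesis unfolding prod by simp
  qed
  define p where "p = (- a + S) / 2"
  define m where "m = (- a - S) / 2"
  have rd: "root_disc \<mu> = of_real S"
    using \<open>9 / 16 \<le> disc \<mu>\<close> by (simp add: root_disc_def S_def max_def)
  show thesis
  proof (rule that[OF rd _ _ S])
    show "root_plus \<mu> = of_real p" "root_minus \<mu> = of_real m"
      unfolding root_plus_def root_minus_def a_def[symmetric] rd p_def m_def by simp_all
    have "\<bar>1 / S - 1\<bar> = (1 - S) / S" using S Sa a by (simp add: field_simps)
    \<comment> \<open>1 - S = (1 - a) + (a - S) \<le> \<mu> + 8/3 \<mu>.\<close>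
    also have "\<dots> \<le> (4 * \<mu>) / (3 / 4)" using aS a S mu Sa by (intro frac_le) auto
    also have "\<dots> \<le> 8 * \<mu>" using mu by simp
    finally show "\<bar>1 / S - 1\<bar> \<le> 8 * \<mu>" .
    \<comment> \<open>S \<le> a shows that the true exponent is at least as negative as that of
      \<open>phi1\<close>.\<close>
    have "(a - S) * (a + S) \<le> (a - S) * (2 * a)" using a S Sa by (intro mult_left_mono) auto
    then have "2 * \<mu> \<le> (a - S) * a" unfolding prod by (simp add: mult.commute)
    then have "2 * \<mu> * (1 + \<mu>) \<le> (a - S) * a * (1 + \<mu>)" using mu by (intro mult_right_mono) auto
    also have "\<dots> = a - S" using a(4) by (simp add: mult.assoc)
    finally show "p \<le> - (\<mu> * (1 + \<mu>))" by (simp add: p_def)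
    show "- p \<le> 4 / 3 * \<mu>" using aS unfolding p_def by (simp add: field_simps)
    show "m \<le> - (3 / 4)" using a S by (simp add: m_def)
    show "- (\<mu> * (1 + \<mu>)) - p \<le> 2 * \<mu>\<^sup>2"
    proof -
      have "(a - S) * (a - S) \<le> (8 / 3 * \<mu>) * (8 / 3 * \<mu>)"
        using aS Sa mu by (intro mult_mono) auto
      \<comment> \<open>Follows by writing 2 a as (a + S) + (a - S); the second summand produces the
        quadratic error.\<close>
      moreover have "2 * a * (a - S) = 4 * \<mu> + (a - S) * (a - S)"
        using prod by (simp add: algebra_simps)
      ultimately have "2 * a * (a - S) \<le> 4 * \<mu> + 64 / 9 * \<mu>\<^sup>2" by (simp add: power2_eq_square)
      then have "2 * a * (a - S) * (1 + \<mu>) \<le> (4 * \<mu> + 64 / 9 * \<mu>\<^sup>2) * (1 + \<mu>)"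
        using mu by (intro mult_right_mono) auto
      moreover have "2 * a * (a - S) * (1 + \<mu>) = 2 * (a - S)"
        using a(4) by (metis mult.assoc mult.commute mult.right_neutral)
      moreover have "(4 * \<mu> + 64 / 9 * \<mu>\<^sup>2) * (1 + \<mu>) \<le> 4 * (\<mu> * (1 + \<mu>)) + 8 * \<mu>\<^sup>2"
      proof -
        have "64 / 9 * \<mu>\<^sup>2 * (1 + \<mu>) \<le> 64 / 9 * \<mu>\<^sup>2 * (9 / 8)" using mu by (intro mult_left_mono) auto
        then show ?thesis by (simp add: algebra_simps)
      qed
      ultimately have "2 * (a - S) \<le> 4 * (\<mu> * (1 + \<mu>)) + 8 * \<mu>\<^sup>2" by linarith
      then show ?thesis unfolding p_def by (simp add: field_simps)
    qed
  qed
qed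

text \<open>The three groups of terms are the errors of order \<mu> in the exponent and in the
  coefficients, the variation of the transformed data away from the origin, and the fast mode
  belonging to \<open>root_minus\<close>.\<close>

lemma low_frequency_bound:
  fixes \<mu> t :: real
  assumes rel: "solution_relation t \<mu> F0 F1 A" and mu: "0 \<le> \<mu>" "\<mu> < 1 / 16" and t: "0 \<le> t"
  shows "cmod (A - of_real (exp (- t * \<mu> * (1 + \<mu>))) * (P0 + P1))
    \<le> 12 * (\<mu> * exp (- (\<mu> * t / 2))) * (cmod F0 + cmod F1)
      + exp (- (\<mu> * t / 2)) * (cmod (F0 - P0) + cmod (F1 - P1)) + 2 * exp (- (t / 2)) * (cmod F0 + cmod F1)"
proof -
  obtain S p m where r: "root_disc \<mu> = of_real S" "root_plus \<mu> = of_real p" "root_minus \<mu> = of_real m"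
    and S: "3 / 4 \<le> S" "\<bar>1 / S - 1\<bar> \<le> 8 * \<mu>"
    and p: "p \<le> - (\<mu> * (1 + \<mu>))" "- (\<mu> * (1 + \<mu>)) - p \<le> 2 * \<mu>\<^sup>2" "- p \<le> 4 / 3 * \<mu>" and m: "m \<le> - (3 / 4)"
    using root_bounds_low[OF mu] by metis
  define b where "b = exp (- (\<mu> * t / 2))"
  define e where "e = exp (p * t)"
  define e' where "e' = exp (m * t)"
  define h where "h = exp (- t * \<mu> * (1 + \<mu>))"
  have pn: "p \<le> 0" using p(1) mu by (auto intro: order_trans)
  have mmt: "0 \<le> \<mu> * t" using mu t by simp
  have hb: "h \<le> exp (- (\<mu> * t))"
    using mult_nonneg_nonneg[OF mmt mu(1)] by (simp add: h_def algebra_simps)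
  have b1: "exp (- (\<mu> * t)) \<le> b" using mmt by (simp add: b_def)
  have h0: "0 < h" "0 < e" "0 < e'" "0 < b" by (simp_all add: h_def e_def e'_def b_def)
  have eh: "e \<le> h"
    using mult_right_mono[OF p(1) t] by (simp add: e_def h_def algebra_simps)
  \<comment> \<open>The exponents differ by at most 2 \<mu>^2 t. One factor \<mu> t is absorbed at
    the cost of half of the decay exp(-\<mu> t), which leaves one factor \<mu>.\<close>
  have ehb: "h - e \<le> 2 * \<mu> * b"
  proof -
    let ?d = "- (\<mu> * (1 + \<mu>)) - p"
    have "e = h * exp (- (?d * t))" by (simp add: e_def h_def algebra_simps flip: exp_add)
    moreover have "1 - ?d * t \<le> exp (- (?d * t))" using exp_ge_add_one_self[of "- (?d * t)"] by linarith
    ultimately have "h - e \<le> h * (?d * t)"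
      using mult_left_mono[of "1 - ?d * t" "exp (- (?d * t))" h] h0 by (simp add: algebra_simps)
    also have "\<dots> \<le> exp (- (\<mu> * t)) * ((2 * \<mu>\<^sup>2) * t)"
      using hb p h0 t by (intro mult_mono) auto
    also have "\<dots> = 2 * \<mu> * ((\<mu> * t) * exp (- (\<mu> * t)))" by (simp add: power2_eq_square)
    also have "\<dots> \<le> 2 * \<mu> * b"
      unfolding b_def using mu exp_neg_linear_le[OF mmt] by (intro mult_left_mono) auto
    finally show ?thesis .
  qed
  have e_b: "e \<le> b" using eh hb b1 by linarith
  have e'_le: "e' \<le> exp (- (t / 2))"
    using mult_right_mono[OF m t] t by (simp add: e'_def)
  \<comment> \<open>Makes the quotient (e - e') / S nonnegative and at most e / S.\<close>
  have ee': "e' \<le> e"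
  proof -
    have "p \<ge> - (3 / 4)" using p(3) mu by linarith
    then have "m * t \<le> p * t" using m t by (intro mult_right_mono) auto
    then show ?thesis by (simp add: e_def e'_def)
  qed
  have S0: "S \<noteq> 0" using S by auto
  have A: "A = of_real e * F0 + (F1 - of_real p * F0) * of_real ((e - e') / S)"
    using solution_relation_formula[OF rel] S0 unfolding r e_def e'_def
    by (simp flip: exp_of_real)
  \<comment> \<open>The coefficient (e - e') / S of \<open>F1\<close> is split as e + e (1 / S - 1)
    - e' / S, whose first term combines with that of \<open>F0\<close>.\<close>
  have split: "A - of_real h * (P0 + P1) = of_real (e - h) * (F0 + F1) + of_real h * ((F0 - P0) + (F1 - P1))
     + of_real (e * (1 / S - 1)) * F1 - of_real (p * ((e - e') / S)) * F0 - of_real (e' / S) * F1"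
    unfolding A by (simp add: algebra_simps diff_divide_distrib)
  have q: "0 \<le> (e - e') / S" "\<bar>(e - e') / S\<bar> = (e - e') / S" "(e - e') / S \<le> 4 / 3 * b"
  proof -
    show "0 \<le> (e - e') / S" using ee' S by auto
    then show "\<bar>(e - e') / S\<bar> = (e - e') / S" by (rule abs_of_nonneg)
    have "(e - e') / S \<le> b / (3 / 4)" using ee' S e_b h0 by (intro frac_le) auto
    then show "(e - e') / S \<le> 4 / 3 * b" by simp
  qed
  have n1: "cmod (of_real (e - h) * (F0 + F1)) \<le> 2 * \<mu> * b * (cmod F0 + cmod F1)"
    unfolding norm_mult norm_of_real using ehb eh by (intro mult_mono norm_triangle_ineq) auto
  have n2: "cmod (of_real h * ((F0 - P0) + (F1 - P1))) \<le> b * (cmod (F0 - P0) + cmod (F1 - P1))"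
    unfolding norm_mult norm_of_real using hb b1 h0 by (intro mult_mono norm_triangle_ineq) auto
  have n3: "cmod (of_real (e * (1 / S - 1)) * F1) \<le> b * (8 * \<mu>) * cmod F1"
    unfolding norm_mult norm_of_real abs_mult using S e_b h0 by (intro mult_mono) auto
  have n4: "cmod (of_real (p * ((e - e') / S)) * F0) \<le> (4 / 3 * \<mu>) * (4 / 3 * b) * cmod F0"
    unfolding norm_mult norm_of_real abs_mult q(2) using p pn q(1,3) mu h0 by (intro mult_mono) auto
  have n5: "cmod (of_real (e' / S) * F1) \<le> (exp (- (t / 2)) / (3 / 4)) * cmod F1"
    unfolding norm_mult norm_of_real abs_mult using S h0 e'_le
    by (intro mult_mono) (auto simp: abs_of_pos simp del: divide_divide_eq_right intro!: frac_le)
  have "cmod (A - of_real h * (P0 + P1)) \<le> 2 * \<mu> * b * (cmod F0 + cmod F1) + b * (cmod (F0 - P0) + cmod (F1 - P1))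
     + b * (8 * \<mu>) * cmod F1 + (4 / 3 * \<mu>) * (4 / 3 * b) * cmod F0 + (exp (- (t / 2)) / (3 / 4)) * cmod F1"
    unfolding split
    by (intro order_trans[OF norm_triangle_ineq4] order_trans[OF norm_triangle_ineq] add_mono n1 n2 n3 n4 n5)
  also have "\<dots> \<le> 12 * (\<mu> * b) * (cmod F0 + cmod F1) + b * (cmod (F0 - P0) + cmod (F1 - P1)) + 2 * exp (- (t / 2)) * (cmod F0 + cmod F1)"
  proof -
    define v0 v1 w0 w1 where vw: "v0 = (\<mu> * b) * cmod F0" "v1 = (\<mu> * b) * cmod F1"
      "w0 = exp (- (t / 2)) * cmod F0" "w1 = exp (- (t / 2)) * cmod F1"
    \<comment> \<open>The totals are 2 + 16/9 and 2 + 8 for the terms with \<mu>, and 4/3 for the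
      fast mode; 12 and 2 are round upper bounds.\<close>
    have "0 \<le> v0" "0 \<le> v1" "0 \<le> w0" "0 \<le> w1" using mu h0 by (simp_all add: vw)
    then have "2 * v0 + 2 * v1 + 8 * v1 + 16 / 9 * v0 + 4 / 3 * w1 \<le> 12 * v0 + 12 * v1 + 2 * w0 + 2 * w1"
      by linarith
    then show ?thesis unfolding vw by (simp add: algebra_simps)
  qed
  finally show ?thesis by (simp add: b_def h_def)
qed

section \<open>Symbol and data near the origin\<close>

lemma log_symbol_le: "log_symbol \<xi> \<le> (norm \<xi>)\<^sup>2"
  using ln_add_one_self_le_self[of "(norm \<xi>)\<^sup>2"] by (simp add: log_symbol_def)

text \<open>1/16 < ln 2 confines \<xi> to the unit ball, and there ln (1 + y) \<ge> y / (1 + y)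
  \<ge> y / 2. Decay in \<mu> thereby becomes Gaussian decay in \<xi>.\<close>

lemma log_symbol_low:
  assumes "log_symbol \<xi> < 1 / 16"
  shows "norm \<xi> \<le> 1" "(norm \<xi>)\<^sup>2 / 2 \<le> log_symbol \<xi>"
proof -
  let ?y = "(norm \<xi>)\<^sup>2"
  show n1: "norm \<xi> \<le> 1"
  proof (rule ccontr)
    assume "\<not> norm \<xi> \<le> 1"
    then have "1 \<le> ?y" using power_mono[of 1 "norm \<xi>" 2] by simp
    then have "ln 2 \<le> log_symbol \<xi>" unfolding log_symbol_def by (intro ln_mono) auto
    then show False using ln2_ge_two_thirds assms by simp
  qed
  have y1: "?y \<le> 1" using n1 power_mono[of "norm \<xi>" 1 2] by simp
  have "0 < 1 + ?y" by (simp add: add_pos_nonneg)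
  then have "?y / 2 \<le> ?y / (1 + ?y)" using y1 by (intro frac_le) auto
  also have "\<dots> = 1 - 1 / (1 + ?y)" by (simp add: field_simps add_nonneg_eq_0_iff)
  also have "\<dots> \<le> ln (1 + ?y)"
    using ln_le_minus_one[of "inverse (1 + ?y)"] ln_inverse[of "1 + ?y"] \<open>0 < 1 + ?y\<close>
    by (simp add: divide_inverse)
  finally show "?y / 2 \<le> log_symbol \<xi>" by (simp add: log_symbol_def)
qed

text \<open>The first moment makes the transform Lipschitz at the origin. The resulting factor
  |\<xi>| is what gains t^(-1/2) over the decay of the Gaussian alone.\<close>

lemma fourier_L11:
  fixes f :: "real^'n \<Rightarrow> complex"
  assumes f: "f \<in> L11"
  shows "cmod (fourier f \<xi>) \<le> L11_norm f" "cmod (fourier f \<xi> - P f) \<le> norm \<xi> * L11_norm f"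
    "cmod (P f) \<le> L11_norm f" "0 \<le> L11_norm f"
proof -
  have int: "integrable lborel f" "integrable lborel (\<lambda>x. (1 + norm x) * cmod (f x))"
    using f by (auto simp: L11_def)
  have F: "fourier f \<xi> = fourier_integral f \<xi>" by (simp add: fourier_def int)
  have "(\<integral>x. cmod (f x) \<partial>lborel) \<le> L11_norm f"
    unfolding L11_norm_def using int by (intro integral_mono) (auto simp: algebra_simps)
  then show "cmod (fourier f \<xi>) \<le> L11_norm f" "cmod (P f) \<le> L11_norm f"
    unfolding F P_def using fourier_integral_bound[of f \<xi>] integral_norm_bound[of lborel f] by linarith+
  show "0 \<le> L11_norm f" unfolding L11_norm_def by (intro integral_nonneg_AE) auto
  have "fourier f \<xi> - P f = (\<integral>x. exp (- (\<i> * complex_of_real (x \<bullet> \<xi>))) * f x - f x \<partial>lborel)"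
    unfolding F P_def fourier_integral_def
    using fourier_integrand_integrable[OF int(1), of \<xi>] int(1) by simp
  also have "cmod \<dots> \<le> (\<integral>x. norm \<xi> * ((1 + norm x) * cmod (f x)) \<partial>lborel)"
  proof (rule Bochner_Integration.integral_norm_bound_integral)
    fix x
    \<comment> \<open>Both exponents are imaginary, so the mean value bound applies with M =
      0.\<close>
    have "cmod (exp (- (\<i> * complex_of_real (x \<bullet> \<xi>))) - exp 0) \<le> exp 0 * cmod (- (\<i> * complex_of_real (x \<bullet> \<xi>)) - 0)"
      by (rule norm_exp_diff_le) auto
    also have "\<dots> = \<bar>x \<bullet> \<xi>\<bar>" by (simp add: norm_mult)
    also have "\<dots> \<le> norm x * norm \<xi>" by (rule Cauchy_Schwarz_ineq2)
    also have "\<dots> \<le> norm \<xi> * (1 + norm x)" by (simp add: algebra_simps)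
    finally have "cmod (exp (- (\<i> * complex_of_real (x \<bullet> \<xi>))) - 1) * cmod (f x) \<le> norm \<xi> * (1 + norm x) * cmod (f x)"
      by (intro mult_right_mono) auto
    then show "cmod (exp (- (\<i> * complex_of_real (x \<bullet> \<xi>))) * f x - f x) \<le> norm \<xi> * ((1 + norm x) * cmod (f x))"
      by (simp add: left_diff_distrib flip: norm_mult mult.assoc)
  qed (use int fourier_integrand_integrable[OF int(1), of \<xi>] in auto)
  also have "\<dots> = norm \<xi> * L11_norm f" by (simp add: L11_norm_def)
  finally show "cmod (fourier f \<xi> - P f) \<le> norm \<xi> * L11_norm f" .
qed

section \<open>Integration of the pointwise estimates\<close>

lemma nonlow_frequency_bound:
  fixes \<mu> t :: real
  assumes rel: "solution_relation t \<mu> F0 F1 A" and nz: "root_disc \<mu> \<noteq> 0"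
    and mu: "1 / 16 \<le> \<mu>" and t: "0 \<le> t"
  defines "x \<equiv> t / (1 + \<mu>)"
  shows "cmod (A - osc_part t \<mu> F0 F1)
     \<le> 12 * (exp (- (1 / 16 * x)) * (1 + x)) * (cmod F0 / sqrt (1 + \<mu>) + cmod F1 / (1 + \<mu>))"
proof (cases "\<mu> \<le> 1")
  case True
  then show ?thesis
    using medium_frequency_bound[OF rel nz mu True t, folded x_def] by (simp add: mult.assoc)
next
  case False
  then have mu1: "1 \<le> \<mu>" by simp
  have x: "0 \<le> x" using t mu by (simp add: x_def)
  have "exp (- (x / 2)) \<le> exp (- (1 / 16 * x))" using x by simp
  then have "4 * exp (- (x / 2)) \<le> 12 * exp (- (1 / 16 * x))"
    using exp_gt_zero[of "- (1 / 16 * x)"] by linarith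
  from mult_right_mono[OF this, of "1 + x"]
  have "4 * exp (- (x / 2)) * (1 + x) \<le> 12 * (exp (- (1 / 16 * x)) * (1 + x))"
    using x by (simp only: mult.assoc)
  then have "4 * exp (- (x / 2)) * (1 + x) * (cmod F0 / sqrt (1 + \<mu>) + cmod F1 / (1 + \<mu>))
     \<le> 12 * (exp (- (1 / 16 * x)) * (1 + x)) * (cmod F0 / sqrt (1 + \<mu>) + cmod F1 / (1 + \<mu>))"
    using mu by (intro mult_right_mono) auto
  with high_frequency_bound[OF rel mu1 t] show ?thesis unfolding x_def by linarith
qed

lemma nonlow_frequency_weighted_bound:
  fixes l :: real
  assumes l: "0 \<le> l"
  obtains K where "0 < K"
    "\<And>\<mu> t F0 F1 A. \<lbrakk>solution_relation t \<mu> F0 F1 A; root_disc \<mu> \<noteq> 0; 1 / 16 \<le> \<mu>; 0 < t\<rbrakk> \<Longrightarrow>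
      (cmod (A - osc_part t \<mu> F0 F1))\<^sup>2
        \<le> K * t powr (- (l + 2)) * ((1 + \<mu>) powr (l + 1) * (cmod F0)\<^sup>2 + (1 + \<mu>) powr l * (cmod F1)\<^sup>2)"
proof -
  \<comment> \<open>Chosen so that p - 1/2 and p - 1 are half of l + 1 and of l, the exponents of
    the weights in the Y norms; then t^(-2p) = t^(-(l+2)).\<close>
  define p where "p = (l + 2) / 2"
  have p: "0 < p" using l by (simp add: p_def)
  obtain K0 where K0: "0 < K0" "\<And>x. 0 \<le> x \<Longrightarrow> exp (- (1 / 16 * x)) * (1 + x) * x powr p \<le> K0"
    using exp_powr_bounded_linear[of "1 / 16" p] p by auto
  show thesis
  proof (rule that[of "2 * (12 * K0)\<^sup>2"])
    show "0 < 2 * (12 * K0)\<^sup>2" using K0 by simp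
    fix \<mu> t :: real and F0 F1 A
    assume rel: "solution_relation t \<mu> F0 F1 A" and nz: "root_disc \<mu> \<noteq> 0" and mu: "1 / 16 \<le> \<mu>" and t: "0 < t"
    define x where "x = t / (1 + \<mu>)"
    have m1: "0 < 1 + \<mu>" using mu by simp
    have x: "0 < x" using t m1 by (simp add: x_def)
    have xp: "x powr p = t powr p / (1 + \<mu>) powr p" using t m1 by (simp add: x_def powr_divide)
    have "exp (- (1 / 16 * x)) * (1 + x) \<le> K0 / x powr p"
      using K0(2)[of x] x by (simp add: pos_le_divide_eq)
    also have "\<dots> = K0 * t powr (- p) * (1 + \<mu>) powr p"
      using t m1 by (simp add: xp powr_minus divide_inverse)
    finally have e: "exp (- (1 / 16 * x)) * (1 + x) \<le> K0 * t powr (- p) * (1 + \<mu>) powr p" .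
    have w: "(1 + \<mu>) powr p / sqrt (1 + \<mu>) = (1 + \<mu>) powr ((l + 1) / 2)" "(1 + \<mu>) powr p / (1 + \<mu>) = (1 + \<mu>) powr (l / 2)"
    proof -
      have "(1 + \<mu>) powr p / sqrt (1 + \<mu>) = (1 + \<mu>) powr (p - 1 / 2)"
        using m1 by (simp add: powr_diff powr_half_sqrt)
      moreover have "p - 1 / 2 = (l + 1) / 2" "p - 1 = l / 2" by (simp_all add: p_def field_simps)
      ultimately show "(1 + \<mu>) powr p / sqrt (1 + \<mu>) = (1 + \<mu>) powr ((l + 1) / 2)" by simp
      have "(1 + \<mu>) powr p / (1 + \<mu>) = (1 + \<mu>) powr (p - 1)" using m1 by (simp add: powr_diff)
      then show "(1 + \<mu>) powr p / (1 + \<mu>) = (1 + \<mu>) powr (l / 2)" by (simp add: p_def field_simps)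
    qed
    have "cmod (A - osc_part t \<mu> F0 F1) \<le> 12 * (exp (- (1 / 16 * x)) * (1 + x)) * (cmod F0 / sqrt (1 + \<mu>) + cmod F1 / (1 + \<mu>))"
      unfolding x_def using nonlow_frequency_bound[OF rel nz mu] t by simp
    also have "\<dots> \<le> 12 * (K0 * t powr (- p) * (1 + \<mu>) powr p) * (cmod F0 / sqrt (1 + \<mu>) + cmod F1 / (1 + \<mu>))"
      using e m1 by (intro mult_right_mono mult_left_mono) auto
    also have "\<dots> = 12 * K0 * t powr (- p) * (((1 + \<mu>) powr p / sqrt (1 + \<mu>)) * cmod F0 + ((1 + \<mu>) powr p / (1 + \<mu>)) * cmod F1)"
      by (simp add: algebra_simps)
    finally have b: "cmod (A - osc_part t \<mu> F0 F1)
       \<le> 12 * K0 * t powr (- p) * ((1 + \<mu>) powr ((l + 1) / 2) * cmod F0 + (1 + \<mu>) powr (l / 2) * cmod F1)"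
      unfolding w .
    have sq: "(y powr (q / 2))\<^sup>2 = y powr q" if "0 < y" for y q :: real
      using that by (simp add: power2_eq_square flip: powr_add)
    have "(cmod (A - osc_part t \<mu> F0 F1))\<^sup>2
      \<le> (12 * K0 * t powr (- p) * ((1 + \<mu>) powr ((l + 1) / 2) * cmod F0 + (1 + \<mu>) powr (l / 2) * cmod F1))\<^sup>2"
      by (rule power_mono[OF b]) simp
    also have "\<dots> = (12 * K0)\<^sup>2 * t powr (- (l + 2)) * ((1 + \<mu>) powr ((l + 1) / 2) * cmod F0 + (1 + \<mu>) powr (l / 2) * cmod F1)\<^sup>2"
    proof -
      have "- p = - (l + 2) / 2" by (simp add: p_def field_simps)
      then have "(t powr (- p))\<^sup>2 = t powr (- (l + 2))" using sq[OF t, of "- (l + 2)"] by metis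
      then show ?thesis by (simp only: power_mult_distrib)
    qed
    also have "\<dots> \<le> (12 * K0)\<^sup>2 * t powr (- (l + 2)) * (2 * ((1 + \<mu>) powr ((l + 1) / 2) * cmod F0)\<^sup>2 + 2 * ((1 + \<mu>) powr (l / 2) * cmod F1)\<^sup>2)"
      using norm_add_power2_le[of "(1 + \<mu>) powr ((l + 1) / 2) * cmod F0" "(1 + \<mu>) powr (l / 2) * cmod F1"]
      by (intro mult_left_mono) auto
    also have "\<dots> = 2 * (12 * K0)\<^sup>2 * t powr (- (l + 2)) * ((1 + \<mu>) powr (l + 1) * (cmod F0)\<^sup>2 + (1 + \<mu>) powr l * (cmod F1)\<^sup>2)"
      unfolding power_mult_distrib sq[OF m1] by (simp add: algebra_simps)
    finally show "(cmod (A - osc_part t \<mu> F0 F1))\<^sup>2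
        \<le> 2 * (12 * K0)\<^sup>2 * t powr (- (l + 2)) * ((1 + \<mu>) powr (l + 1) * (cmod F0)\<^sup>2 + (1 + \<mu>) powr l * (cmod F1)\<^sup>2)" .
  qed
qed

section \<open>An integrable majorant and the exceptional sphere\<close>

definition tail_weight :: "real^'n \<Rightarrow> real" where
  "tail_weight \<xi> = 1 / (1 + (norm \<xi>)\<^sup>2) ^ CARD('n)"

text \<open>Each coordinate is bounded by the norm, so the n equal factors are dominated by the
  factors 1 / (1 + x^2) of a product of integrable one-dimensional functions.\<close>

lemma tail_weight_integrable: "integrable lborel (tail_weight :: real^'n \<Rightarrow> real)"
proof (rule Bochner_Integration.integrable_bound)
  have "integrable lborel (\<lambda>x::real. inverse (1 + x\<^sup>2))"
    using integrable_inverse_1_plus_square by (simp add: set_integrable_def)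
  then show "integrable lborel (\<lambda>\<xi>::real^'n. \<Prod>b\<in>Basis. inverse (1 + (\<xi> \<bullet> b)\<^sup>2))"
    by (rule lborel_prod_integral)
  show "tail_weight \<in> borel_measurable (lborel :: (real^'n) measure)"
    unfolding tail_weight_def by measurable
  show "AE \<xi> in (lborel :: (real^'n) measure). norm (tail_weight \<xi>) \<le> norm (\<Prod>b\<in>Basis. inverse (1 + (\<xi> \<bullet> b)\<^sup>2))"
  proof (rule AE_I2)
    fix \<xi> :: "real^'n"
    have "tail_weight \<xi> = (\<Prod>b\<in>(Basis :: (real^'n) set). inverse (1 + (norm \<xi>)\<^sup>2))"
      by (simp add: tail_weight_def power_inverse divide_inverse)
    also have "\<dots> \<le> (\<Prod>b\<in>Basis. inverse (1 + (\<xi> \<bullet> b)\<^sup>2))"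
    proof (intro prod_mono conjI le_imp_inverse_le add_left_mono)
      fix b :: "real^'n" assume "b \<in> Basis"
      then have "\<bar>\<xi> \<bullet> b\<bar> \<le> norm \<xi>" by (rule Basis_le_norm)
      then show "(\<xi> \<bullet> b)\<^sup>2 \<le> (norm \<xi>)\<^sup>2" by (rule power2_le_iff_abs_le[THEN iffD2, rotated]) simp
    qed (auto simp: add_pos_nonneg)
    finally show "norm (tail_weight \<xi>) \<le> norm (\<Prod>b\<in>Basis. inverse (1 + (\<xi> \<bullet> b)\<^sup>2))"
      by (simp add: tail_weight_def prod_nonneg)
  qed
qed

lemma tail_weight_nonneg: "0 \<le> tail_weight \<xi>"
  by (simp add: tail_weight_def)

text \<open>exp(-s \<mu>) is (1 + |\<xi>|^2)^(-s); this is the origin of the time threshold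
  n.\<close>

lemma exp_log_symbol_le_tail_weight:
  fixes \<xi> :: "real^'n"
  assumes "real CARD('n) \<le> s"
  shows "exp (- (s * log_symbol \<xi>)) \<le> tail_weight \<xi>"
proof -
  have pos: "0 < 1 + (norm \<xi>)\<^sup>2" by (simp add: add_pos_nonneg)
  have "exp (- (s * log_symbol \<xi>)) \<le> exp (- (real CARD('n) * log_symbol \<xi>))"
    using assms by (simp add: mult_right_mono)
  also have "\<dots> = tail_weight \<xi>"
    unfolding tail_weight_def log_symbol_def using pos
    by (simp add: exp_minus exp_of_nat_mult inverse_eq_divide)
  finally show ?thesis .
qed

text \<open>The discriminant is strictly decreasing on \<mu> \<ge> 0, so a double root occurs for at
  most one value of \<mu>, that is on at most one sphere.\<close>

lemma root_disc_log_symbol_nonzero_AE: "AE \<xi> in (lborel :: (real^'n) measure). root_disc (log_symbol \<xi>) \<noteq> 0"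
proof -
  have inj: "x = y" if "disc x = 0" "disc y = 0" "0 \<le> x" "0 \<le> y" for x y
  proof -
    have mono: "disc b < disc a" if "0 \<le> a" "a < b" for a b
    proof -
      have "(1 / (1 + b))\<^sup>2 \<le> (1 / (1 + a))\<^sup>2" using that by (intro power_mono divide_left_mono) auto
      then show ?thesis using that unfolding disc_def by linarith
    qed
    show ?thesis using mono[of x y] mono[of y x] that by (metis less_irrefl linorder_less_linear)
  qed
  have d: "disc \<mu> = 0" if "root_disc \<mu> = 0" for \<mu> using root_disc_power2[of \<mu>] that by simp
  show ?thesis
  proof (cases "\<exists>\<xi>::real^'n. root_disc (log_symbol \<xi>) = 0")
    case True
    then obtain \<xi>0 :: "real^'n" where x0: "root_disc (log_symbol \<xi>0) = 0" by blast
    have sub: "{\<xi> \<in> space lborel. \<not> root_disc (log_symbol \<xi>) \<noteq> 0} \<subseteq> sphere (0 :: real^'n) (norm \<xi>0)"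
    proof
      fix \<xi> :: "real^'n" assume "\<xi> \<in> {\<xi> \<in> space lborel. \<not> root_disc (log_symbol \<xi>) \<noteq> 0}"
      then have "log_symbol \<xi> = log_symbol \<xi>0" using inj[OF d d[OF x0], of "log_symbol \<xi>"] by simp
      then have "(norm \<xi>)\<^sup>2 = (norm \<xi>0)\<^sup>2"
        unfolding log_symbol_def by (subst (asm) ln_inj_iff) (auto simp: add_pos_nonneg)
      then show "\<xi> \<in> sphere 0 (norm \<xi>0)" by simp
    qed
    have "sphere (0 :: real^'n) (norm \<xi>0) \<in> null_sets lborel"
      using negligible_sphere[of "0 :: real^'n" "norm \<xi>0"]
      by (simp add: negligible_iff_null_sets null_sets_completion_iff closed_sphere borel_closed)
    then show ?thesis by (rule AE_I'[OF _ sub])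
  qed simp
qed

section \<open>Error in the low-frequency zone in terms of the initial data\<close>

lemma low_frequency_phi_bound:
  fixes u0 u1 :: "real^'n \<Rightarrow> complex"
  assumes u: "u0 \<in> L11" "u1 \<in> L11" and t: "0 < t" and low: "log_symbol \<xi> < 1 / 16" and \<xi>: "\<xi> \<noteq> 0"
    and rel: "solution_relation t (log_symbol \<xi>) (fourier u0 \<xi>) (fourier u1 \<xi>) A"
  shows "cmod (A - phi u0 u1 t \<xi>)
    \<le> 13 * (L11_norm u0 + L11_norm u1) * (norm \<xi> * exp (- ((norm \<xi>)\<^sup>2 * t / 4)) + exp (- (t / 2)))"
proof -
  let ?\<mu> = "log_symbol \<xi>" and ?F0 = "fourier u0 \<xi>" and ?F1 = "fourier u1 \<xi>"
  define N0 N1 where N: "N0 = L11_norm u0" "N1 = L11_norm u1"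
  define g where "g = exp (- ((norm \<xi>)\<^sup>2 * t / 4))"
  define e where "e = exp (- (t / 2))"
  have pos: "0 < g" "0 < e" by (simp_all add: g_def e_def)
  note f0 = fourier_L11(1,2)[OF u(1), of \<xi>, folded N] fourier_L11(3,4)[OF u(1), folded N]
    and f1 = fourier_L11(1,2)[OF u(2), of \<xi>, folded N] fourier_L11(3,4)[OF u(2), folded N]
  note sm = log_symbol_low[OF low]
  \<comment> \<open>At \<xi> = 0 the exponent of \<open>phi2\<close> would be a division by 0 with
    value 0, and its decay would be lost.\<close>
  have mu0: "0 < ?\<mu>" by (rule less_le_trans[OF _ sm(2)]) (use \<xi> in simp)
  have ge: "exp (- (?\<mu> * t / 2)) \<le> g"
    using mult_right_mono[OF sm(2), of t] t by (simp add: g_def field_simps)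
  have "?\<mu> \<le> (norm \<xi>)\<^sup>2" by (rule log_symbol_le)
  also have "\<dots> \<le> norm \<xi>" using sm(1) mult_left_le[of "norm \<xi>" "norm \<xi>"] by (simp add: power2_eq_square)
  finally have mu_le: "?\<mu> \<le> norm \<xi>" .
  have dF: "cmod (?F0 - P u0) + cmod (?F1 - P u1) \<le> norm \<xi> * (N0 + N1)" using f0(2) f1(2) by (simp add: distrib_left)
  have N_nn: "0 \<le> N0" "0 \<le> N1" using f0(4) f1(4) by auto
  have "cmod (A - phi1 u0 u1 t \<xi>) \<le> 12 * (?\<mu> * exp (- (?\<mu> * t / 2))) * (cmod ?F0 + cmod ?F1)
      + exp (- (?\<mu> * t / 2)) * (cmod (?F0 - P u0) + cmod (?F1 - P u1)) + 2 * exp (- (t / 2)) * (cmod ?F0 + cmod ?F1)"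
    unfolding phi1_def by (rule low_frequency_bound[OF rel]) (use low t in auto)
  also have "\<dots> \<le> 12 * (norm \<xi> * g) * (N0 + N1) + g * (norm \<xi> * (N0 + N1)) + 2 * e * (N0 + N1)"
    unfolding e_def[symmetric] using ge mu_le f0(1) f1(1) dF pos mu0
    by (intro add_mono mult_mono) auto
  finally have A1: "cmod (A - phi1 u0 u1 t \<xi>) \<le> 12 * (norm \<xi> * g) * (N0 + N1) + g * (norm \<xi> * (N0 + N1)) + 2 * e * (N0 + N1)" .
  \<comment> \<open>Here the singular exponent helps: for \<mu> < 1/16 the damping t / (2 \<mu>)
    exceeds 8 t, so \<open>phi2\<close> is negligible and may simply be added to the error.\<close>
  have E: "exp (- t / (2 * ?\<mu>)) \<le> exp (- (8 * t))"
  proof -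
    have "8 * t * (2 * ?\<mu>) \<le> 8 * t * (1 / 8)" using low t by (intro mult_left_mono) auto
    then have "8 * t \<le> t / (2 * ?\<mu>)" using mu0 by (simp add: le_divide_eq)
    then show ?thesis by simp
  qed
  have "phi2 u0 u1 t \<xi> = osc_part t ?\<mu> ?F0 ?F1" by (simp add: phi2_def osc_part_def)
  then have "cmod (phi2 u0 u1 t \<xi>) \<le> exp (- t / (2 * ?\<mu>)) * (t * cmod ?F1 + cmod ?F0)"
    using osc_part_bound[of t] t by simp
  also have "\<dots> \<le> exp (- (8 * t)) * ((1 + t) * (N0 + N1))"
  proof (intro mult_mono E)
    have "t * cmod ?F1 + cmod ?F0 \<le> t * N1 + N0" using f0(1) f1(1) t by (intro add_mono mult_left_mono) auto
    also have "\<dots> \<le> (1 + t) * (N0 + N1)" using N_nn t by (simp add: algebra_simps)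
    finally show "t * cmod ?F1 + cmod ?F0 \<le> (1 + t) * (N0 + N1)" .
  qed (use t in auto)
  \<comment> \<open>The polynomial factor 1 + t costs a single exp t.\<close>
  also have "\<dots> \<le> exp (- (8 * t)) * (exp t * (N0 + N1))"
    using N_nn by (intro mult_left_mono mult_right_mono exp_ge_add_one_self) auto
  also have "\<dots> = exp (- (7 * t)) * (N0 + N1)" by (simp flip: exp_add mult.assoc)
  also have "\<dots> \<le> e * (N0 + N1)" using N_nn t by (intro mult_right_mono) (auto simp: e_def)
  finally have A2: "cmod (phi2 u0 u1 t \<xi>) \<le> e * (N0 + N1)" .
  have "cmod (A - phi u0 u1 t \<xi>) \<le> cmod (A - phi1 u0 u1 t \<xi>) + cmod (phi2 u0 u1 t \<xi>)"
    using norm_triangle_ineq4[of "A - phi1 u0 u1 t \<xi>" "phi2 u0 u1 t \<xi>"] by (simp add: phi_def diff_diff_eq)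
  also have "\<dots> \<le> (12 * (norm \<xi> * g) * (N0 + N1) + g * (norm \<xi> * (N0 + N1)) + 2 * e * (N0 + N1)) + e * (N0 + N1)"
    by (intro add_mono A1 A2)
  also have "\<dots> = 13 * (N0 + N1) * (norm \<xi> * g) + 3 * ((N0 + N1) * e)" by (simp add: algebra_simps)
  also have "\<dots> \<le> 13 * (N0 + N1) * (norm \<xi> * g) + 13 * ((N0 + N1) * e)" using N_nn pos by simp
  finally show ?thesis by (simp add: N g_def e_def algebra_simps)
qed

lemma low_frequency_phi_square_bound:
  fixes u0 u1 :: "real^'n \<Rightarrow> complex"
  assumes u: "u0 \<in> L11" "u1 \<in> L11" and t: "0 < t" and low: "log_symbol \<xi> < 1 / 16" and \<xi>: "\<xi> \<noteq> 0"
    and rel: "solution_relation t (log_symbol \<xi>) (fourier u0 \<xi>) (fourier u1 \<xi>) A"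
  shows "(cmod (A - phi u0 u1 t \<xi>))\<^sup>2
    \<le> 338 * (L11_norm u0 + L11_norm u1)\<^sup>2 * (4 / t * gauss (t / 2) \<xi> + 2 ^ CARD('n) * exp (- (t / 16)) * tail_weight \<xi>)"
proof -
  define N where "N = L11_norm u0 + L11_norm u1"
  define a where "a = norm \<xi> * exp (- ((norm \<xi>)\<^sup>2 * t / 4))"
  define b where "b = exp (- (t / 2))"
  have a2: "a\<^sup>2 \<le> 4 / t * gauss (t / 2) \<xi>"
  \<comment> \<open>With y = |\<xi>|^2 t / 4 the square is (4 / t) y exp(-2 y), and y exp(-2 y)
    \<le> exp(-y). The gain 1 / t comes from the factor |\<xi>|.\<close>
  proof -
    define y where "y = (norm \<xi>)\<^sup>2 * t / 4"
    have "y \<le> exp y" using exp_ge_add_one_self[of y] by linarith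
    then have "y * exp (- (2 * y)) \<le> exp y * exp (- (2 * y))" by (rule mult_right_mono) simp
    also have "\<dots> = exp (- y)" by (simp flip: exp_add)
    finally have "4 / t * (y * exp (- (2 * y))) \<le> 4 / t * exp (- y)" using t by (intro mult_left_mono) auto
    moreover have "a\<^sup>2 = 4 / t * (y * exp (- (2 * y)))"
      using t by (simp add: a_def power_mult_distrib y_def flip: exp_double)
    moreover have "exp (- y) = gauss (t / 2) \<xi>" by (simp add: y_def gauss_def mult.commute)
    ultimately show ?thesis by simp
  qed
  \<comment> \<open>A constant is not integrable over the whole space, but in the unit ball
    \<open>tail_weight\<close> is at least 2^(-n). The rate 1/16 is the one that also bounds
    \<open>phi1\<close> outside the low zone.\<close>
  have b2: "b\<^sup>2 \<le> 2 ^ CARD('n) * exp (- (t / 16)) * tail_weight \<xi>"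
  proof -
    have "norm \<xi> \<le> 1" by (rule log_symbol_low[OF low])
    then have "(norm \<xi>)\<^sup>2 \<le> 1" using power_mono[of "norm \<xi>" 1 2] by simp
    then have "(1 + (norm \<xi>)\<^sup>2) ^ CARD('n) \<le> 2 ^ CARD('n)" by (intro power_mono) auto
    then have w: "1 \<le> 2 ^ CARD('n) * tail_weight \<xi>"
      by (simp add: tail_weight_def le_divide_eq add_pos_nonneg)
    have "b\<^sup>2 = exp (- t)" by (simp add: b_def flip: exp_double)
    also have "\<dots> \<le> exp (- (t / 16)) * 1" using t by simp
    also have "\<dots> \<le> exp (- (t / 16)) * (2 ^ CARD('n) * tail_weight \<xi>)" by (intro mult_left_mono w) simp
    finally show ?thesis by (simp add: mult_ac)
  qed
  have "(cmod (A - phi u0 u1 t \<xi>))\<^sup>2 \<le> (13 * N * (a + b))\<^sup>2"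
    unfolding N_def a_def b_def by (rule power_mono[OF low_frequency_phi_bound[OF assms]]) simp
  also have "\<dots> = 169 * N\<^sup>2 * (a + b)\<^sup>2" by (simp add: power_mult_distrib)
  also have "\<dots> \<le> 169 * N\<^sup>2 * (2 * (4 / t * gauss (t / 2) \<xi> + 2 ^ CARD('n) * exp (- (t / 16)) * tail_weight \<xi>))"
    using norm_add_power2_le[of a b] a2 b2 by (intro mult_left_mono) auto
  finally show ?thesis by (simp add: N_def algebra_simps)
qed

text \<open>The square provides exp(-t \<mu>) twice: one copy becomes the integrable weight, the
  other is kept for the decay in time.\<close>

lemma phi1_bound:
  fixes u0 u1 :: "real^'n \<Rightarrow> complex"
  assumes u: "u0 \<in> L11" "u1 \<in> L11" and t: "real CARD('n) \<le> t"
  shows "(cmod (phi1 u0 u1 t \<xi>))\<^sup>2 \<le> (L11_norm u0 + L11_norm u1)\<^sup>2 * (exp (- (t * log_symbol \<xi>)) * tail_weight \<xi>)"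
proof -
  let ?\<mu> = "log_symbol \<xi>"
  have t0: "0 \<le> t" using t by (rule order_trans[rotated]) simp
  have "cmod (phi1 u0 u1 t \<xi>) = exp (- t * ?\<mu> * (1 + ?\<mu>)) * cmod (P u0 + P u1)"
    by (simp add: phi1_def norm_mult)
  also have "\<dots> \<le> exp (- (t * ?\<mu>)) * (L11_norm u0 + L11_norm u1)"
  proof (intro mult_mono)
    have "0 \<le> t * ?\<mu> * ?\<mu>" using t0 by simp
    then show "exp (- t * ?\<mu> * (1 + ?\<mu>)) \<le> exp (- (t * ?\<mu>))" by (simp add: algebra_simps)
    show "cmod (P u0 + P u1) \<le> L11_norm u0 + L11_norm u1"
      using norm_triangle_ineq[of "P u0" "P u1"] fourier_L11(3)[OF u(1)] fourier_L11(3)[OF u(2)] by linarith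
  qed auto
  finally have "(cmod (phi1 u0 u1 t \<xi>))\<^sup>2 \<le> (exp (- (t * ?\<mu>)) * (L11_norm u0 + L11_norm u1))\<^sup>2"
    by (rule power_mono) simp
  also have "\<dots> = (L11_norm u0 + L11_norm u1)\<^sup>2 * (exp (- (t * ?\<mu>)) * exp (- (t * ?\<mu>)))"
    by (simp add: power2_eq_square)
  also have "\<dots> \<le> (L11_norm u0 + L11_norm u1)\<^sup>2 * (exp (- (t * ?\<mu>)) * tail_weight \<xi>)"
    by (intro mult_left_mono exp_log_symbol_le_tail_weight t) auto
  finally show ?thesis .
qed

text \<open>Needed for \<open>inv_fourier\<close> to be meaningful. The multipliers in
  \<open>phi2\<close> are bounded by t and by 1, so that part inherits square-integrability from the
  data.\<close>

lemma phi_L2: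
  fixes u0 u1 :: "real^'n \<Rightarrow> complex"
  assumes u: "u0 \<in> L11" "u1 \<in> L11" "u0 \<in> L2" "u1 \<in> L2" and t: "real CARD('n) \<le> t"
  shows "phi u0 u1 t \<in> L2"
proof -
  have t0: "0 \<le> t" using t by (rule order_trans[rotated]) simp
  have m1[measurable]: "phi1 u0 u1 t \<in> borel_measurable borel" unfolding phi1_def by measurable
  have phi1: "phi1 u0 u1 t \<in> L2"
  proof (rule L2I)
    show "integrable lborel (\<lambda>\<xi>. (cmod (phi1 u0 u1 t \<xi>))\<^sup>2)"
    proof (rule Bochner_Integration.integrable_bound)
      show "integrable lborel (\<lambda>\<xi>::real^'n. (L11_norm u0 + L11_norm u1)\<^sup>2 * tail_weight \<xi>)"
        by (intro integrable_mult_right tail_weight_integrable)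
      show "AE \<xi> in lborel. norm ((cmod (phi1 u0 u1 t \<xi>))\<^sup>2) \<le> norm ((L11_norm u0 + L11_norm u1)\<^sup>2 * tail_weight \<xi>)"
      proof (rule AE_I2)
        fix \<xi> :: "real^'n"
        have "exp (- (t * log_symbol \<xi>)) * tail_weight \<xi> \<le> 1 * tail_weight \<xi>"
          using t0 by (intro mult_right_mono tail_weight_nonneg) simp
        then have "(cmod (phi1 u0 u1 t \<xi>))\<^sup>2 \<le> (L11_norm u0 + L11_norm u1)\<^sup>2 * (1 * tail_weight \<xi>)"
          by (intro order_trans[OF phi1_bound[OF u(1,2) t]] mult_left_mono) auto
        then show "norm ((cmod (phi1 u0 u1 t \<xi>))\<^sup>2) \<le> norm ((L11_norm u0 + L11_norm u1)\<^sup>2 * tail_weight \<xi>)"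
          by (simp add: tail_weight_nonneg)
      qed
    qed simp
  qed simp
  have ex: "exp (- t / (2 * log_symbol \<xi>)) \<le> 1" for \<xi> :: "real^'n" using t0 by (simp add: divide_nonneg_nonneg)
  have "phi2 u0 u1 t \<in> L2"
    unfolding phi2_def
  proof (intro L2_add L2_mult_bounded[OF fourier_L2[OF u(4)], where B=t] L2_mult_bounded[OF fourier_L2[OF u(3)], where B=1])
    fix \<xi> :: "real^'n"
    have "exp (- t / (2 * log_symbol \<xi>)) * \<bar>sin (sqrt (log_symbol \<xi>) * t) / sqrt (log_symbol \<xi>)\<bar> \<le> 1 * \<bar>t\<bar>"
      by (intro mult_mono ex abs_sin_div_le) auto
    then show "cmod (complex_of_real (exp (- t / (2 * log_symbol \<xi>)) * (sin (sqrt (log_symbol \<xi>) * t) / sqrt (log_symbol \<xi>)))) \<le> t"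
      unfolding norm_of_real abs_mult using t0 by simp
    have "exp (- t / (2 * log_symbol \<xi>)) * \<bar>cos (sqrt (log_symbol \<xi>) * t)\<bar> \<le> 1 * 1"
      by (intro mult_mono ex abs_cos_le_one) auto
    then show "cmod (complex_of_real (exp (- t / (2 * log_symbol \<xi>)) * cos (sqrt (log_symbol \<xi>) * t))) \<le> 1"
      unfolding norm_of_real abs_mult by simp
  qed measurable
  then show ?thesis using L2_add[OF phi1] by (simp add: phi_def[abs_def])
qed

text \<open>All estimates are kept squared until the end, whence the square root in the constant.
  With l = n/2 - 1 the Gaussian integral and the weighted data decay with the same power, denoted
  \<open>T\<close> below.\<close>

lemma phi_difference_estimate:
  fixes l :: real
  assumes l: "l = real CARD('n::finite) / 2 - 1" "0 \<le> l"
  shows "\<exists>C>0. \<forall>(u0 :: real^'n \<Rightarrow> complex) u1 t A.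
    u0 \<in> L11 \<inter> Y (l + 1) \<longrightarrow> u1 \<in> L11 \<inter> Y l \<longrightarrow> real CARD('n) \<le> t \<longrightarrow> A \<in> L2 \<longrightarrow>
    (AE \<xi> in lborel. solution_relation t (log_symbol \<xi>) (fourier u0 \<xi>) (fourier u1 \<xi>) (A \<xi>)) \<longrightarrow>
    L2_norm (\<lambda>\<xi>. A \<xi> - phi u0 u1 t \<xi>) \<le> C * I0 l u0 u1 * t powr (- ((real CARD('n) + 2) / 4))"
proof -
  let ?n = "CARD('n)"
  have l2: "l + 2 = real ?n / 2 + 1" using l by simp
  obtain K where K: "0 < K" "\<And>\<mu> t F0 F1 A. \<lbrakk>solution_relation t \<mu> F0 F1 A; root_disc \<mu> \<noteq> 0; 1 / 16 \<le> \<mu>; 0 < t\<rbrakk> \<Longrightarrow>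
      (cmod (A - osc_part t \<mu> F0 F1))\<^sup>2
        \<le> K * t powr (- (l + 2)) * ((1 + \<mu>) powr (l + 1) * (cmod F0)\<^sup>2 + (1 + \<mu>) powr l * (cmod F1)\<^sup>2)"
    using nonlow_frequency_weighted_bound[OF l(2)] by metis
  obtain K' where K': "0 < K'" "\<And>t. 0 \<le> t \<Longrightarrow> exp (- (1 / 16 * t)) * t powr (l + 2) \<le> K'"
    using exp_powr_bounded[of "1 / 16" "l + 2"] l(2) by auto
  define J where "J = (\<integral>\<xi>. tail_weight (\<xi> :: real^'n) \<partial>lborel)"
  have J: "0 \<le> J" unfolding J_def by (intro integral_nonneg_AE AE_I2 tail_weight_nonneg)
  \<comment> \<open>338 * 2^n stems from the low zone, 2 from \<open>phi1\<close> outside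
    it.\<close>
  define a where "a = 338 * 2 ^ ?n + (2 :: real)"
  \<comment> \<open>1352 is 338 times the 4 in 4 / t, and sqrt (4 pi)^n is the time-independent
    factor in the integral of \<open>gauss (t / 2)\<close>.\<close>
  define C1 where "C1 = 1352 * sqrt (4 * pi) ^ ?n + a * K' * J"
  define C2 where "C2 = 2 * C1 + 2 * K"
  have C1: "0 \<le> C1" using J K' by (simp add: C1_def a_def)
  have C2: "0 < C2" using C1 K by (simp add: C2_def)
  show ?thesis
  proof (intro exI[of _ "sqrt C2"] conjI allI impI)
    show "0 < sqrt C2" using C2 by simp
    fix u0 u1 :: "real^'n \<Rightarrow> complex" and t :: real and A
    assume u0: "u0 \<in> L11 \<inter> Y (l + 1)" and u1: "u1 \<in> L11 \<inter> Y l" and t: "real ?n \<le> t" and A: "A \<in> L2"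
      and rel: "AE \<xi> in lborel. solution_relation t (log_symbol \<xi>) (fourier u0 \<xi>) (fourier u1 \<xi>) (A \<xi>)"
    have u: "u0 \<in> L11" "u1 \<in> L11" "u0 \<in> L2" "u1 \<in> L2" using u0 u1 by (auto simp: Y_def)
    have "0 < real ?n" by simp
    then have t0: "0 < t" using t by linarith
    define N where "N = L11_norm u0 + L11_norm u1"
    define T where "T = t powr (- (l + 2))"
    have T: "0 < T" using t0 by (simp add: T_def)
    define w0 w1 where w: "w0 \<xi> = (1 + log_symbol \<xi>) powr (l + 1) * (cmod (fourier u0 \<xi>))\<^sup>2"
      "w1 \<xi> = (1 + log_symbol \<xi>) powr l * (cmod (fourier u1 \<xi>))\<^sup>2" for \<xi>
    have wi: "integrable lborel w0" "integrable lborel w1"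
      using u0 u1 by (simp_all add: Y_def w[abs_def])
    have w_nn: "0 \<le> w0 \<xi>" "0 \<le> w1 \<xi>" for \<xi> by (simp_all add: w)
    define e where "e = exp (- (t / 16))"
    have e: "0 < e" "e \<le> K' * T"
    proof -
      have "e * t powr (l + 2) \<le> K'" using K'(2)[of t] t0 by (simp add: e_def)
      then show "e \<le> K' * T" using t0 unfolding T_def powr_minus by (simp add: field_simps)
    qed (simp add: e_def)
    \<comment> \<open>A single majorant for all frequencies: in each zone the terms belonging to the
      other are nonnegative and are added for free, so the integral need not be split.\<close>
    define D where "D \<xi> = 338 * N\<^sup>2 * (4 / t * gauss (t / 2) \<xi>) + a * N\<^sup>2 * e * tail_weight \<xi> + 2 * K * T * (w0 \<xi> + w1 \<xi>)" for \<xi> :: "real^'n"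
    have gi: "integrable lborel (gauss (t / 2) :: real^'n \<Rightarrow> real)" using t0 by (intro gauss_integral) simp
    have Di: "integrable lborel D"
      unfolding D_def
      by (intro Bochner_Integration.integrable_add integrable_mult_right gi tail_weight_integrable wi)
    have bound: "AE \<xi> in lborel. (cmod (A \<xi> - phi u0 u1 t \<xi>))\<^sup>2 \<le> D \<xi>"
      using rel root_disc_log_symbol_nonzero_AE AE_lborel_singleton[of "0 :: real^'n"]
    proof eventually_elim
      fix \<xi> :: "real^'n"
      assume r: "solution_relation t (log_symbol \<xi>) (fourier u0 \<xi>) (fourier u1 \<xi>) (A \<xi>)"
        and nz: "root_disc (log_symbol \<xi>) \<noteq> 0" and \<xi>: "\<xi> \<noteq> 0"
      have parts: "0 \<le> 338 * N\<^sup>2 * (4 / t * gauss (t / 2) \<xi>)" "0 \<le> N\<^sup>2 * e * tail_weight \<xi>" "0 \<le> 2 * K * T * (w0 \<xi> + w1 \<xi>)"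
        "0 \<le> 338 * 2 ^ ?n * (N\<^sup>2 * e * tail_weight \<xi>)"
        using t0 e K T w_nn tail_weight_nonneg[of \<xi>] less_imp_le[OF gauss_pos, of "t / 2" \<xi>] by auto
      have D_eq: "D \<xi> = 338 * N\<^sup>2 * (4 / t * gauss (t / 2) \<xi>) + 338 * 2 ^ ?n * (N\<^sup>2 * e * tail_weight \<xi>)
          + 2 * (N\<^sup>2 * e * tail_weight \<xi>) + 2 * K * T * (w0 \<xi> + w1 \<xi>)"
        unfolding D_def a_def by (simp add: algebra_simps)
      show "(cmod (A \<xi> - phi u0 u1 t \<xi>))\<^sup>2 \<le> D \<xi>"
      proof (cases "log_symbol \<xi> < 1 / 16")
        case True
        have "(cmod (A \<xi> - phi u0 u1 t \<xi>))\<^sup>2 \<le> 338 * N\<^sup>2 * (4 / t * gauss (t / 2) \<xi> + 2 ^ ?n * e * tail_weight \<xi>)"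
          unfolding N_def e_def by (rule low_frequency_phi_square_bound[OF u(1,2) t0 True \<xi> r])
        also have "\<dots> = 338 * N\<^sup>2 * (4 / t * gauss (t / 2) \<xi>) + 338 * 2 ^ ?n * (N\<^sup>2 * e * tail_weight \<xi>)"
          by (simp add: algebra_simps)
        finally show ?thesis unfolding D_eq using parts by linarith
      next
        case False
        then have mu: "1 / 16 \<le> log_symbol \<xi>" by simp
        \<comment> \<open>Outside the low zone \<open>phi1\<close> is no approximation but part of
          the error, of squared size at most exp(-t / 16) times the weight.\<close>
        have eq: "A \<xi> - phi u0 u1 t \<xi> = (A \<xi> - osc_part t (log_symbol \<xi>) (fourier u0 \<xi>) (fourier u1 \<xi>)) + - phi1 u0 u1 t \<xi>"
          by (simp add: phi_def phi2_def osc_part_def)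
        have "(cmod (A \<xi> - phi u0 u1 t \<xi>))\<^sup>2
           \<le> 2 * (cmod (A \<xi> - osc_part t (log_symbol \<xi>) (fourier u0 \<xi>) (fourier u1 \<xi>)))\<^sup>2 + 2 * (cmod (phi1 u0 u1 t \<xi>))\<^sup>2"
          unfolding eq by (rule order_trans[OF norm_add_power2_le]) simp
        moreover have "(cmod (A \<xi> - osc_part t (log_symbol \<xi>) (fourier u0 \<xi>) (fourier u1 \<xi>)))\<^sup>2 \<le> K * T * (w0 \<xi> + w1 \<xi>)"
          unfolding T_def w by (rule K(2)[OF r nz mu t0])
        moreover have "(cmod (phi1 u0 u1 t \<xi>))\<^sup>2 \<le> N\<^sup>2 * e * tail_weight \<xi>"
        proof -
          have "exp (- (t * log_symbol \<xi>)) \<le> e" using mult_left_mono[OF mu, of t] t0 by (simp add: e_def)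
          then have "N\<^sup>2 * (exp (- (t * log_symbol \<xi>)) * tail_weight \<xi>) \<le> N\<^sup>2 * (e * tail_weight \<xi>)"
            by (intro mult_left_mono mult_right_mono tail_weight_nonneg) auto
          with phi1_bound[OF u(1,2) t, of \<xi>] show ?thesis by (simp add: N_def mult.assoc)
        qed
        moreover have "2 * (K * T * (w0 \<xi> + w1 \<xi>)) = 2 * K * T * (w0 \<xi> + w1 \<xi>)" by simp
        ultimately show ?thesis unfolding D_eq using parts by linarith
      qed
    qed
    have AL: "(\<lambda>\<xi>. A \<xi> - phi u0 u1 t \<xi>) \<in> L2" by (intro L2_diff A phi_L2[OF u t])
    have I0: "(I0 l u0 u1)\<^sup>2 = (L11_norm u0)\<^sup>2 + (L11_norm u1)\<^sup>2 + (Y_norm (l + 1) u0)\<^sup>2 + (Y_norm l u1)\<^sup>2"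
      "0 \<le> I0 l u0 u1"
      by (simp_all add: I0_def)
    have Yn: "(Y_norm (l + 1) u0)\<^sup>2 = (\<integral>\<xi>. w0 \<xi> \<partial>lborel)" "(Y_norm l u1)\<^sup>2 = (\<integral>\<xi>. w1 \<xi> \<partial>lborel)"
      unfolding Y_norm_def w by (auto intro!: real_sqrt_pow2 integral_nonneg_AE)
    have NI: "N\<^sup>2 \<le> 2 * (L11_norm u0)\<^sup>2 + 2 * (L11_norm u1)\<^sup>2"
      using norm_add_power2_le[of "L11_norm u0" "L11_norm u1"] by (simp add: N_def)
    \<comment> \<open>The integral is of order t^(-n/2), and the prefactor 1 / t completes the power
      n/2 + 1 = l + 2.\<close>
    have gI: "4 / t * (\<integral>\<xi>. gauss (t / 2) (\<xi> :: real^'n) \<partial>lborel) = 4 * sqrt (4 * pi) ^ ?n * T"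
    proof -
      have "(\<integral>\<xi>. gauss (t / 2) (\<xi> :: real^'n) \<partial>lborel) = sqrt (4 * pi / t) ^ ?n"
        using gauss_integral(2)[of "t / 2", where 'a="real^'n"] t0 by (simp add: mult.commute)
      also have "\<dots> = sqrt (4 * pi) ^ ?n * t powr (- (real ?n / 2))"
      proof -
        have "sqrt t ^ ?n = t powr (real ?n / 2)"
          using t0 by (simp add: powr_half_sqrt[symmetric] powr_power)
        then show ?thesis by (simp only: real_sqrt_divide power_divide powr_minus) (simp only: divide_inverse)
      qed
      finally have "4 / t * (\<integral>\<xi>. gauss (t / 2) (\<xi> :: real^'n) \<partial>lborel) = 4 * sqrt (4 * pi) ^ ?n * (t powr (- (real ?n / 2)) / t)"
        by simp
      also have "t powr (- (real ?n / 2)) / t = T"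
      proof -
        have "- (real ?n / 2 + 1) = - (real ?n / 2) - 1" by simp
        then show ?thesis unfolding T_def l2 using t0 by (simp only: powr_diff) simp
      qed
      finally show ?thesis .
    qed
    have "(L2_norm (\<lambda>\<xi>. A \<xi> - phi u0 u1 t \<xi>))\<^sup>2 \<le> (\<integral>\<xi>. D \<xi> \<partial>lborel)"
      unfolding L2_norm_power2 by (intro integral_mono_AE L2_integrable AL Di bound)
    also have "\<dots> = 338 * N\<^sup>2 * (4 / t * (\<integral>\<xi>. gauss (t / 2) (\<xi> :: real^'n) \<partial>lborel)) + a * N\<^sup>2 * e * J
        + 2 * K * T * ((Y_norm (l + 1) u0)\<^sup>2 + (Y_norm l u1)\<^sup>2)"
      unfolding D_def J_def Yn using gi tail_weight_integrable[where 'n='n] wi by simp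
    also have "\<dots> = 1352 * sqrt (4 * pi) ^ ?n * T * N\<^sup>2 + a * N\<^sup>2 * J * e
        + 2 * K * T * ((Y_norm (l + 1) u0)\<^sup>2 + (Y_norm l u1)\<^sup>2)"
      unfolding gI by simp
    also have "\<dots> \<le> 1352 * sqrt (4 * pi) ^ ?n * T * N\<^sup>2 + a * N\<^sup>2 * J * (K' * T)
        + 2 * K * T * ((Y_norm (l + 1) u0)\<^sup>2 + (Y_norm l u1)\<^sup>2)"
      using e J by (intro add_mono mult_left_mono order_refl) (auto simp: a_def)
    also have "\<dots> = C1 * T * N\<^sup>2 + 2 * K * T * ((Y_norm (l + 1) u0)\<^sup>2 + (Y_norm l u1)\<^sup>2)"
      by (simp add: C1_def algebra_simps)
    also have "\<dots> \<le> C1 * T * (2 * (L11_norm u0)\<^sup>2 + 2 * (L11_norm u1)\<^sup>2) + 2 * K * T * ((Y_norm (l + 1) u0)\<^sup>2 + (Y_norm l u1)\<^sup>2)"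
      using C1 T NI by (intro add_mono mult_left_mono order_refl) auto
    also have "\<dots> = (2 * C1) * T * ((L11_norm u0)\<^sup>2 + (L11_norm u1)\<^sup>2) + (2 * K) * T * ((Y_norm (l + 1) u0)\<^sup>2 + (Y_norm l u1)\<^sup>2)"
      by (simp add: algebra_simps)
    also have "\<dots> \<le> C2 * T * ((L11_norm u0)\<^sup>2 + (L11_norm u1)\<^sup>2) + C2 * T * ((Y_norm (l + 1) u0)\<^sup>2 + (Y_norm l u1)\<^sup>2)"
      using C1 K T by (intro add_mono mult_right_mono) (auto simp: C2_def)
    also have "\<dots> = C2 * (I0 l u0 u1)\<^sup>2 * T" unfolding I0(1) by (simp add: algebra_simps)
    also have "\<dots> = (sqrt C2 * I0 l u0 u1 * t powr (- ((real ?n + 2) / 4)))\<^sup>2"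
    proof -
      have "(t powr (- ((real ?n + 2) / 4)))\<^sup>2 = T"
      proof -
        have "- ((real ?n + 2) / 4) + - ((real ?n + 2) / 4) = - (real ?n / 2 + 1)" by (simp add: field_simps)
        then show ?thesis unfolding T_def l2 power2_eq_square powr_add[symmetric] by simp
      qed
      then show ?thesis using C2 by (simp add: power_mult_distrib)
    qed
    finally show "L2_norm (\<lambda>\<xi>. A \<xi> - phi u0 u1 t \<xi>) \<le> sqrt C2 * I0 l u0 u1 * t powr (- ((real ?n + 2) / 4))"
      by (rule power2_le_imp_le) (use C2 I0 in simp)
  qed
qed

section \<open>Return to physical space\<close>

theorem theorem1p3:
  fixes l :: real
  assumes "CARD('n::finite) \<ge> 4"
    and "l = real CARD('n) / 2 - 1"
  shows "\<exists>C>0. \<exists>t0>1. \<forall>(u0 :: real^'n \<Rightarrow> complex) u1 u.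
           u0 \<in> L11 \<inter> Y (l + 1) \<longrightarrow> u1 \<in> L11 \<inter> Y l \<longrightarrow> is_solution u0 u1 u \<longrightarrow>
           (\<forall>t\<ge>t0.
              phi u0 u1 t \<in> L2 \<and>
              (\<lambda>x. u t x - inv_fourier (phi u0 u1 t) x) \<in> L2 \<and>
              L2_norm (\<lambda>x. u t x - inv_fourier (phi u0 u1 t) x)
                \<le> C * I0 l u0 u1 * t powr (- ((real CARD('n) + 2) / 4)))"
proof -
  have "0 \<le> l" using assms by simp
  from phi_difference_estimate[OF assms(2) this] obtain C where C: "0 < C"
    "\<And>(u0 :: real^'n \<Rightarrow> complex) u1 t A. \<lbrakk>u0 \<in> L11 \<inter> Y (l + 1); u1 \<in> L11 \<inter> Y l; real CARD('n) \<le> t; A \<in> L2;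
      AE \<xi> in lborel. solution_relation t (log_symbol \<xi>) (fourier u0 \<xi>) (fourier u1 \<xi>) (A \<xi>)\<rbrakk> \<Longrightarrow>
      L2_norm (\<lambda>\<xi>. A \<xi> - phi u0 u1 t \<xi>) \<le> C * I0 l u0 u1 * t powr (- ((real CARD('n) + 2) / 4))"
    by blast
  show ?thesis
  \<comment> \<open>The witness for the time threshold is n, from which on \<open>phi1\<close> is
    dominated by \<open>tail_weight\<close>.\<close>
  proof (rule exI[of _ C], rule conjI[OF C(1)], rule exI[of _ "real CARD('n)"], intro conjI allI impI)
    show "1 < real CARD('n)" using assms by simp
    fix u0 u1 :: "real^'n \<Rightarrow> complex" and u t
    assume u0: "u0 \<in> L11 \<inter> Y (l + 1)" and u1: "u1 \<in> L11 \<inter> Y l" and sol: "is_solution u0 u1 u"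
      and t: "real CARD('n) \<le> t"
    have u: "u0 \<in> L11" "u1 \<in> L11" "u0 \<in> L2" "u1 \<in> L2" using u0 u1 by (auto simp: Y_def)
    have t0: "0 \<le> t" using t by (rule order_trans[rotated]) simp
    show phi: "phi u0 u1 t \<in> L2" by (rule phi_L2[OF u t])
    note inv = inv_fourier[OF phi]
    note sf = solution_fourier[OF sol u(3,4) t0]
    show diff: "(\<lambda>x. u t x - inv_fourier (phi u0 u1 t) x) \<in> L2" by (rule L2_diff[OF sf(1) inv(1)])
    have "AE \<xi> in lborel. fourier (\<lambda>x. u t x - inv_fourier (phi u0 u1 t) x) \<xi> = fourier (u t) \<xi> - phi u0 u1 t \<xi>"
      using fourier_diff[OF sf(1) inv(1)] inv(2) by eventually_elim simp
    then have "L2_norm (fourier (\<lambda>x. u t x - inv_fourier (phi u0 u1 t) x)) = L2_norm (\<lambda>\<xi>. fourier (u t) \<xi> - phi u0 u1 t \<xi>)"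
      by (intro L2_norm_cong_AE L2_measurable fourier_L2 diff L2_diff sf(1) phi)
    then have "sqrt ((2 * pi) ^ CARD('n)) * L2_norm (\<lambda>x. u t x - inv_fourier (phi u0 u1 t) x)
      = L2_norm (\<lambda>\<xi>. fourier (u t) \<xi> - phi u0 u1 t \<xi>)"
      using plancherel[OF diff] by simp
    \<comment> \<open>The Plancherel factor is at least 1 and stands on the side of the physical
      norm, so it can be discarded without changing the constant.\<close>
    moreover have "1 \<le> sqrt ((2 * pi) ^ CARD('n))"
      by (intro real_sqrt_ge_one one_le_power) (use pi_ge_two in linarith)
    ultimately have "L2_norm (\<lambda>x. u t x - inv_fourier (phi u0 u1 t) x) \<le> L2_norm (\<lambda>\<xi>. fourier (u t) \<xi> - phi u0 u1 t \<xi>)"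
      using mult_right_mono[of 1 "sqrt ((2 * pi) ^ CARD('n))" "L2_norm (\<lambda>x. u t x - inv_fourier (phi u0 u1 t) x)"] by simp
    also have "\<dots> \<le> C * I0 l u0 u1 * t powr (- ((real CARD('n) + 2) / 4))"
      using sf(2) by (intro C(2) u0 u1 t fourier_L2 sf(1)) (simp add: solution_relation_def)
    finally show "L2_norm (\<lambda>x. u t x - inv_fourier (phi u0 u1 t) x)
        \<le> C * I0 l u0 u1 * t powr (- ((real CARD('n) + 2) / 4))" .
  qed
qed

end
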